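(* Let $\alpha\in\mathbb{C}$ be generic, i.e. transcendental over $\mathbb{Q}$. Then the solution set $X_I\subset\mathcal{U}$ of the first Painlevé equation $y''=6y^2+t$ is orthogonal to the solution set $X_{II}(\alpha)\subset\mathcal{U}$ of the second Painlevé equation $y''=2y^3+ty+\alpha$.
   Context: Ambient structure: $\mathcal{U}=(\mathcal{U},+,-,\cdot,0,1,\partial)$ is a fixed saturated model, of cardinality the continuum, of $DCF_0$, the theory of differentially closed fields of characteristic $0$ with one derivation. Its field of constants is identified with $\mathbb{C}$, and $t\in\mathcal{U}$ is a fixed element with $\partial(t)=1$. We write $y'=\partial(y)$, $y''=\partial(\partial(y))$. "Definable" means definable in $\mathcal{U}$ with parameters, i.e. (by quantifier elimination) a finite Boolean combination of affine differential algebraic varieties (Kolchin closed sets). Strong minimality: a definable set $X$ is strongly minimal if it is infinite and has no infinite co-infinite definable subset. Orthogonality: two strongly minimal sets $X,Y$ are nonorthogonal if there is an infinite definable relation $R\subset X\times Y$ such that the restrictions to $R$ of both projections $\pi_1:X\times Y\to X$ and $\pi_2:X\times Y\to Y$ are finite-to-one. They are orthogonal if they are not nonorthogonal. (The generic Painlevé solution sets considered are known to be strongly minimal, so the notion applies.) *)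

theory Defs
  imports
    Complex_Main
    "HOL-Library.Poly_Mapping"
    "HOL-Library.Equipollence"
    "HOL-Computational_Algebra.Polynomial"
begin

locale differential_field =
  fixes d :: "'a::field_char_0 \<Rightarrow> 'a"
  assumes d_add: "d (x + y) = d x + d y"
    and d_mult: "d (x * y) = d x * y + x * d y"

text \<open>
  Differential polynomials in one indeterminate \<open>X\<close>: polynomials in the countably many
  variables \<open>X\<^sub>0, X\<^sub>1, \<dots>\<close>, where \<open>X\<^sub>i\<close> stands for the \<open>i\<close>-th derivative of \<open>X\<close>.
  A monomial is the finitely supported map of its exponents.
\<close>

type_synonym 'a diff_poly = "(nat \<Rightarrow>\<^sub>0 nat) \<Rightarrow>\<^sub>0 'a"

definition dp_eval :: "('a::field_char_0 \<Rightarrow> 'a) \<Rightarrow> 'a diff_poly \<Rightarrow> 'a \<Rightarrow> 'a" where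
  "dp_eval d p x =
     (\<Sum>m\<in>Poly_Mapping.keys p. Poly_Mapping.lookup p m *
        (\<Prod>i\<in>Poly_Mapping.keys m. ((d ^^ i) x) ^ Poly_Mapping.lookup m i))"

definition dp_vars :: "'a::zero diff_poly \<Rightarrow> nat set" where
  "dp_vars p = (\<Union>m\<in>Poly_Mapping.keys p. Poly_Mapping.keys m)"

text \<open>Elements of the ground field have order \<open>-1\<close>.\<close>

definition dp_order :: "'a::zero diff_poly \<Rightarrow> int" where
  "dp_order p = (if dp_vars p = {} then -1 else int (Max (dp_vars p)))"

text \<open>
  Blum's axioms for \<open>DCF\<^sub>0\<close>; the case of \<open>f\<close> of order \<open>0\<close> and \<open>g\<close> a nonzero element of the
  field says that the field is algebraically closed.
\<close>

locale DCF0 = differential_field +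
  assumes blum: "g \<noteq> 0 \<Longrightarrow> dp_order g < dp_order f \<Longrightarrow>
    \<exists>x. dp_eval d f x = 0 \<and> dp_eval d g x \<noteq> 0"

text \<open>
  First-order formulas in the language \<open>(+, -, \<cdot>, 0, 1, \<partial>)\<close> of differential rings, with
  parameters from \<open>'a\<close> and named variables.
\<close>

datatype (term_params: 'a) dterm =
    Var nat
  | Param 'a
  | Zero
  | One
  | Add "'a dterm" "'a dterm"
  | Sub "'a dterm" "'a dterm"
  | Mul "'a dterm" "'a dterm"
  | Der "'a dterm"

datatype (params: 'a) dform =
    Eq "'a dterm" "'a dterm"
  | Neg "'a dform"
  | Conj "'a dform" "'a dform"
  | Exists nat "'a dform"

primrec term_fv :: "'a dterm \<Rightarrow> nat set" where
  "term_fv (Var n) = {n}"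
| "term_fv (Param c) = {}"
| "term_fv Zero = {}"
| "term_fv One = {}"
| "term_fv (Add s u) = term_fv s \<union> term_fv u"
| "term_fv (Sub s u) = term_fv s \<union> term_fv u"
| "term_fv (Mul s u) = term_fv s \<union> term_fv u"
| "term_fv (Der s) = term_fv s"

primrec fv :: "'a dform \<Rightarrow> nat set" where
  "fv (Eq s u) = term_fv s \<union> term_fv u"
| "fv (Neg \<phi>) = fv \<phi>"
| "fv (Conj \<phi> \<psi>) = fv \<phi> \<union> fv \<psi>"
| "fv (Exists n \<phi>) = fv \<phi> - {n}"

primrec term_val :: "('a::field_char_0 \<Rightarrow> 'a) \<Rightarrow> (nat \<Rightarrow> 'a) \<Rightarrow> 'a dterm \<Rightarrow> 'a" where
  "term_val d e (Var n) = e n"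
| "term_val d e (Param c) = c"
| "term_val d e Zero = 0"
| "term_val d e One = 1"
| "term_val d e (Add s u) = term_val d e s + term_val d e u"
| "term_val d e (Sub s u) = term_val d e s - term_val d e u"
| "term_val d e (Mul s u) = term_val d e s * term_val d e u"
| "term_val d e (Der s) = d (term_val d e s)"

primrec holds :: "('a::field_char_0 \<Rightarrow> 'a) \<Rightarrow> (nat \<Rightarrow> 'a) \<Rightarrow> 'a dform \<Rightarrow> bool" where
  "holds d e (Eq s u) \<longleftrightarrow> term_val d e s = term_val d e u"
| "holds d e (Neg \<phi>) \<longleftrightarrow> \<not> holds d e \<phi>"
| "holds d e (Conj \<phi> \<psi>) \<longleftrightarrow> holds d e \<phi> \<and> holds d e \<psi>"
| "holds d e (Exists n \<phi>) \<longleftrightarrow> (\<exists>x. holds d (e(n := x)) \<phi>)"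

text \<open>
  Every finitely satisfiable set of formulas in the single free variable \<open>0\<close>, over fewer than
  \<open>|UNIV|\<close> parameters, is realized.  (Equivalently, every complete \<open>1\<close>-type is.)
\<close>

definition saturated :: "('a::field_char_0 \<Rightarrow> 'a) \<Rightarrow> bool" where
  "saturated d \<longleftrightarrow>
     (\<forall>A p. A \<prec> (UNIV :: 'a set) \<longrightarrow>
        (\<forall>\<phi>\<in>p. params \<phi> \<subseteq> A \<and> fv \<phi> \<subseteq> {0}) \<longrightarrow>
        (\<forall>q. finite q \<longrightarrow> q \<subseteq> p \<longrightarrow> (\<exists>x. \<forall>\<phi>\<in>q. holds d (\<lambda>_. x) \<phi>)) \<longrightarrow>
        (\<exists>x. \<forall>\<phi>\<in>p. holds d (\<lambda>_. x) \<phi>))"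

text \<open>
  A saturated model of \<open>DCF\<^sub>0\<close> of cardinality the continuum, with a field isomorphism \<open>\<iota>\<close>
  identifying the complex numbers with its field of constants, and an element \<open>t\<close> of
  derivative \<open>1\<close>.
\<close>

locale universal_DCF0 = DCF0 d
  for d :: "'a::field_char_0 \<Rightarrow> 'a" +
  fixes \<iota> :: "complex \<Rightarrow> 'a" and t :: 'a
  assumes saturated: "saturated d"
    and continuum: "(UNIV :: 'a set) \<approx> (UNIV :: real set)"
    and \<iota>_one: "\<iota> 1 = 1"
    and \<iota>_add: "\<iota> (z + w) = \<iota> z + \<iota> w"
    and \<iota>_mult: "\<iota> (z * w) = \<iota> z * \<iota> w"
    and \<iota>_bij: "bij_betw \<iota> UNIV {c. d c = 0}"
    and d_t: "d t = 1"

definition definable_rel :: "('a::field_char_0 \<Rightarrow> 'a) \<Rightarrow> ('a \<times> 'a) set \<Rightarrow> bool" where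
  "definable_rel d R \<longleftrightarrow>
     (\<exists>\<phi>. fv \<phi> \<subseteq> {0, 1} \<and> R = {(x, y). holds d (\<lambda>n. if n = 0 then x else y) \<phi>})"

definition finite_to_one_on :: "('b \<Rightarrow> 'c) \<Rightarrow> 'b set \<Rightarrow> bool" where
  "finite_to_one_on f A \<longleftrightarrow> (\<forall>b. finite {a \<in> A. f a = b})"

text \<open>The following two notions are meant for strongly minimal \<open>X\<close> and \<open>Y\<close>.\<close>

definition nonorthogonal :: "('a::field_char_0 \<Rightarrow> 'a) \<Rightarrow> 'a set \<Rightarrow> 'a set \<Rightarrow> bool" where
  "nonorthogonal d X Y \<longleftrightarrow>
     (\<exists>R. R \<subseteq> X \<times> Y \<and> infinite R \<and> definable_rel d R \<and>
          finite_to_one_on fst R \<and> finite_to_one_on snd R)"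

definition orthogonal :: "('a::field_char_0 \<Rightarrow> 'a) \<Rightarrow> 'a set \<Rightarrow> 'a set \<Rightarrow> bool" where
  "orthogonal d X Y \<longleftrightarrow> \<not> nonorthogonal d X Y"

definition painleve_I :: "('a::field_char_0 \<Rightarrow> 'a) \<Rightarrow> 'a \<Rightarrow> 'a set" where
  "painleve_I d t = {y. d (d y) = 6 * y ^ 2 + t}"

definition painleve_II :: "('a::field_char_0 \<Rightarrow> 'a) \<Rightarrow> 'a \<Rightarrow> 'a \<Rightarrow> 'a set" where
  "painleve_II d t a = {y. d (d y) = 2 * y ^ 3 + t * y + a}"

end

theory Submission
  imports
    Defs
    "HOL-Computational_Algebra.Computational_Algebra"
    "HOL-Computational_Algebra.Field_as_Ring"
    "HOL-Library.Countable_Set"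
    "HOL-Analysis.Continuum_Not_Denumerable"
begin

text \<open>
  If the two sets were nonorthogonal, a generic point \<open>x\<close> of \<open>X\<^sub>I\<close> over a countable differential
  field \<open>K\<close> would be interalgebraic over \<open>K\<close> with some \<open>y\<close> in \<open>X\<^sub>I\<^sub>I\<close>: by a back-and-forth argument
  in the saturated model, an element of a finite definable fibre is algebraic over the differential
  field generated by the parameters.  With \<open>u = x'\<close> and \<open>v = y'\<close>, write
  \<open>dy \<and> dv = J dx \<and> du\<close>.  Both equations are Hamiltonian, so \<open>J\<close> is a constant of the derivation.
  The field \<open>K(x, u)\<close> has no constants outside \<open>K\<close>, because the first Painleve equation has no
  nonconstant Darboux polynomials; hence \<open>J\<close> is algebraic over \<open>K\<close>.  Expand \<open>y\<close> and \<open>v\<close> as Puiseux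
  series on the curves \<open>u\<^sup>2 = w\<^sup>2 x\<^sup>3\<close> at infinity, where \<open>w\<close> is a constant transcendental over \<open>K\<close>.
  The leading terms of the two equations give \<open>dx \<and> du\<close> weight 5 there and \<open>dy \<and> dv\<close> weight at
  most 3, so \<open>J = 0\<close>, contradicting that \<open>x\<close> is algebraic over \<open>K(y, v)\<close>.
\<close>

section \<open>Derivations and partial homomorphisms\<close>

text \<open>Why 5 and 3: in units of the order of \<eta>, \<open>x\<close> and \<open>u\<close> have
  pole orders 2 and 3, as \<open>x'' = 6 x^2\<close> dictates, so d/dx and d/du raise the order by 2
  and 3 and the total derivation lowers it by at most 1. A pole of \<open>y\<close> of order k > 1
  would give \<open>2 y^3\<close> order -3k, out of reach of \<open>y''\<close>, whose order is at
  least -k-2. So \<open>y\<close> and \<open>v\<close> have poles of order at most 1 and 2, and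
  \<open>J\<close> has order at least 5 - 3 = 2, whereas a nonzero element algebraic over
  \<open>K\<close> has order 0. Transcendence of \<open>w\<close> over \<open>K\<close> keeps
  \<open>x\<close> and \<open>u\<close> independent at infinity, and \<open>d w = 0\<close> lets the
  derivation act on coefficients; such a \<open>w\<close> exists because \<open>K\<close> is
  countable and the constants form an infinite definable set. The leading part
  \<open>x'' = 6 x^2\<close> alone has the first integral \<open>u^2 - 4 x^3\<close>, so the absence
  of Darboux polynomials must come from \<open>d t = 1\<close>, which is felt only five weights
  below the top. The fields \<open>K\<close>, \<open>K(x, u)\<close> and \<open>K(y, v)\<close> are
  not types. They are subsets of one field, maps out of them are graphs, and compatibility with
  derivations is checked on generators.\<close>

definition derivation :: "('a::comm_ring_1 \<Rightarrow> 'a) \<Rightarrow> bool" where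
  "derivation d \<longleftrightarrow> (\<forall>x y. d (x + y) = d x + d y) \<and> (\<forall>x y. d (x * y) = d x * y + x * d y)"

lemma derivationI:
  assumes "\<And>x y. d (x + y) = d x + d y" "\<And>x y. d (x * y) = d x * y + x * d y"
  shows "derivation d"
  using assms by (auto simp: derivation_def)

lemma derivation_add: "derivation d \<Longrightarrow> d (x + y) = d x + d y"
  by (auto simp: derivation_def)

lemma derivation_mult: "derivation d \<Longrightarrow> d (x * y) = d x * y + x * d y"
  by (auto simp: derivation_def)

lemma derivation_0 [simp]: "derivation d \<Longrightarrow> d 0 = 0"
  using derivation_add[of d 0 0] by simp

lemma derivation_1 [simp]: "derivation d \<Longrightarrow> d 1 = 0"
  using derivation_mult[of d 1 1] by simp

lemma derivation_minus: "derivation d \<Longrightarrow> d (- x) = - d x"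
  using derivation_add[of d x "- x"] by (simp add: eq_neg_iff_add_eq_0 add.commute)

lemma derivation_diff: "derivation d \<Longrightarrow> d (x - y) = d x - d y"
  using derivation_add[of d x "- y"] by (simp add: derivation_minus)

lemma derivation_sum: "derivation d \<Longrightarrow> d (sum f A) = (\<Sum>i\<in>A. d (f i))"
  by (induction A rule: infinite_finite_induct) (auto simp: derivation_add)

lemma derivation_of_nat [simp]: "derivation d \<Longrightarrow> d (of_nat n) = 0"
  by (induction n) (auto simp: derivation_add)

lemma derivation_numeral [simp]: "derivation d \<Longrightarrow> d (numeral n) = 0"
  using derivation_of_nat[of d "numeral n"] by simp

lemma derivation_inverse:
  assumes "derivation d" "b * b' = 1"
  shows "d b' = - (d b) * b' * b'"
proof -
  have "d b * b' + b * d b' = 0"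
    using derivation_mult[OF assms(1), of b b'] assms by simp
  then have "b' * (d b * b' + b * d b') = 0" by simp
  then have "d b * b' * b' + (b * b') * d b' = 0" by (simp add: algebra_simps)
  then show ?thesis using assms(2) by (simp add: eq_neg_iff_add_eq_0 add.commute)
qed

lemma derivation_poly:
  fixes d :: "'a::idom \<Rightarrow> 'a"
  assumes "derivation d"
  shows "d (poly p a) = poly (map_poly d p) a + poly (pderiv p) a * d a"
proof (induction p)
  case (pCons c p)
  then show ?case using assms
    by (simp add: map_poly_pCons derivation_add derivation_mult pderiv_pCons algebra_simps)
qed (use assms in auto)

lemma derivation_commutator:
  assumes "derivation d" "derivation e"
  shows "derivation (\<lambda>x. d (e x) - e (d x))"
  using assms by (intro derivationI) (simp_all add: derivation_add derivation_mult algebra_simps)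

lemma derivation_lincomb:
  assumes "derivation d" "derivation e"
  shows "derivation (\<lambda>x. p * d x + q * e x)"
  using assms by (intro derivationI) (simp_all add: derivation_add derivation_mult algebra_simps)

text \<open>
  Partial homomorphisms from subfields of \<open>'a\<close> are represented by their graphs, which are
  subrings of \<open>'a \<times> 'b\<close>.
\<close>

definition pring :: "('a::field \<times> 'b::comm_ring_1) set \<Rightarrow> bool" where
  "pring Z \<longleftrightarrow> (1, 1) \<in> Z \<and> (\<forall>a b a' b'. (a, b) \<in> Z \<longrightarrow> (a', b') \<in> Z \<longrightarrow>
      (a + a', b + b') \<in> Z \<and> (a * a', b * b') \<in> Z) \<and> (\<forall>a b. (a, b) \<in> Z \<longrightarrow> (- a, - b) \<in> Z)"

text \<open>Closure under inverses is asked where the image has an inverse \<open>b'\<close>. This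
  makes sense also for sets of pairs that are not graphs of functions; such sets serve as invariants
  in \<open>pfrac_least\<close>.\<close>

definition pfield :: "('a::field \<times> 'b::comm_ring_1) set \<Rightarrow> bool" where
  "pfield Z \<longleftrightarrow> pring Z \<and> (\<forall>a b b'. (a, b) \<in> Z \<longrightarrow> b * b' = 1 \<longrightarrow> (inverse a, b') \<in> Z)"

text \<open>A ring homomorphism that extends to fractions, since nonzero elements go to units. The
  target is only a commutative ring because the dual numbers, which are not a field, occur as a
  target.\<close>

definition prehom :: "('a::field \<times> 'b::comm_ring_1) set \<Rightarrow> bool" where
  "prehom Z \<longleftrightarrow> pring Z \<and> (\<forall>b. (0, b) \<in> Z \<longrightarrow> b = 0) \<and>
     (\<forall>a b. (a, b) \<in> Z \<longrightarrow> a \<noteq> 0 \<longrightarrow> (\<exists>b'. b * b' = 1))"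

definition phom :: "('a::field \<times> 'b::comm_ring_1) set \<Rightarrow> bool" where
  "phom Z \<longleftrightarrow> prehom Z \<and> pfield Z"

text \<open>Without division in \<open>'b\<close>, the image of \<open>r / s\<close> is a solution
  \<open>z\<close> of \<open>s' * z = r'\<close>; for a \<open>prehom\<close> it is unique because
  \<open>s'\<close> is a unit.\<close>

definition pfrac :: "('a::field \<times> 'b::comm_ring_1) set \<Rightarrow> ('a \<times> 'b) set" where
  "pfrac R = {(r / s, z) | r r' s s' z. (r, r') \<in> R \<and> (s, s') \<in> R \<and> s \<noteq> 0 \<and> s' * z = r'}"

lemma pring_1: "pring Z \<Longrightarrow> (1, 1) \<in> Z"
  and pring_add: "pring Z \<Longrightarrow> (a, b) \<in> Z \<Longrightarrow> (a', b') \<in> Z \<Longrightarrow> (a + a', b + b') \<in> Z"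
  and pring_mult: "pring Z \<Longrightarrow> (a, b) \<in> Z \<Longrightarrow> (a', b') \<in> Z \<Longrightarrow> (a * a', b * b') \<in> Z"
  and pring_minus: "pring Z \<Longrightarrow> (a, b) \<in> Z \<Longrightarrow> (- a, - b) \<in> Z"
  unfolding pring_def by blast+

lemma pring_0: "pring Z \<Longrightarrow> (0, 0) \<in> Z"
  using pring_add[of Z 1 1 "-1" "-1"] pring_1[of Z] pring_minus[of Z 1 1] by simp

lemma pring_diff: "pring Z \<Longrightarrow> (a, b) \<in> Z \<Longrightarrow> (a', b') \<in> Z \<Longrightarrow> (a - a', b - b') \<in> Z"
  using pring_add[of Z a b "- a'" "- b'"] pring_minus[of Z a' b'] by simp

lemma pring_of_nat: "pring Z \<Longrightarrow> (of_nat n, of_nat n) \<in> Z"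
  by (induction n) (auto simp: pring_0 pring_1 pring_add)

lemma pring_numeral: "pring Z \<Longrightarrow> (numeral n, numeral n) \<in> Z"
  using pring_of_nat[of Z "numeral n"] by simp

lemma pring_power: "pring Z \<Longrightarrow> (a, b) \<in> Z \<Longrightarrow> (a ^ n, b ^ n) \<in> Z"
  by (induction n) (auto simp: pring_1 pring_mult)

lemma pring_sum: "pring Z \<Longrightarrow> (\<And>i. i \<in> A \<Longrightarrow> (f i, g i) \<in> Z) \<Longrightarrow> (sum f A, sum g A) \<in> Z"
  by (induction A rule: infinite_finite_induct) (auto simp: pring_0 pring_add)

lemma pring_prod: "pring Z \<Longrightarrow> (\<And>i. i \<in> A \<Longrightarrow> (f i, g i) \<in> Z) \<Longrightarrow> (prod f A, prod g A) \<in> Z"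
  by (induction A rule: infinite_finite_induct) (auto simp: pring_1 pring_mult)

lemma pfield_pring: "pfield Z \<Longrightarrow> pring Z"
  by (simp add: pfield_def)

lemma pfield_inverse: "pfield Z \<Longrightarrow> (a, b) \<in> Z \<Longrightarrow> b * b' = 1 \<Longrightarrow> (inverse a, b') \<in> Z"
  by (auto simp: pfield_def)

lemma prehom_pring: "prehom Z \<Longrightarrow> pring Z"
  by (simp add: prehom_def)

lemma prehom_zero: "prehom Z \<Longrightarrow> (0, b) \<in> Z \<Longrightarrow> b = 0"
  by (simp add: prehom_def)

lemma prehom_unit: "prehom Z \<Longrightarrow> (a, b) \<in> Z \<Longrightarrow> a \<noteq> 0 \<Longrightarrow> \<exists>b'. b * b' = 1"
  by (auto simp: prehom_def)

lemma prehom_nz: "prehom Z \<Longrightarrow> (a, b) \<in> Z \<Longrightarrow> a = 0 \<longleftrightarrow> b = 0"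
  using prehom_unit[of Z a b] prehom_zero[of Z b] by (metis mult_zero_left zero_neq_one)

lemma prehom_unique:
  assumes "prehom Z" "(a, b) \<in> Z" "(a, b') \<in> Z"
  shows "b = b'"
  using prehom_zero[OF assms(1), of "b - b'"] pring_diff[OF prehom_pring[OF assms(1)] assms(2,3)]
  by simp

lemma phom_prehom: "phom Z \<Longrightarrow> prehom Z"
  and phom_pfield: "phom Z \<Longrightarrow> pfield Z"
  and phom_pring: "phom Z \<Longrightarrow> pring Z"
  by (auto simp: phom_def pfield_def)

lemma prehom_fieldI:
  fixes Z :: "('a::field \<times> 'b::field) set"
  assumes "pring Z" "\<And>a b. (a, b) \<in> Z \<Longrightarrow> a = 0 \<longleftrightarrow> b = 0"
  shows "prehom Z"
  unfolding prehom_def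
proof (intro conjI allI impI)
  fix a b assume "(a, b) \<in> Z" "a \<noteq> 0"
  then show "\<exists>b'. b * b' = 1"
    using assms(2)[of a b] by (intro exI[of _ "inverse b"]) auto
qed (use assms in auto)

lemma pfrac_subset:
  assumes "pring R" shows "R \<subseteq> pfrac R"
proof clarify
  fix a b assume "(a, b) \<in> R"
  then show "(a, b) \<in> pfrac R"
    using pring_1[OF assms] unfolding pfrac_def
    by (intro CollectI exI[of _ a] exI[of _ b] exI[of _ 1] exI[of _ 1] exI[of _ b]) auto
qed

text \<open>Works as an induction rule: \<open>Z\<close> is taken to be the set of pairs with a
  wanted property, which then has to be checked only on generators and for the field
  operations.\<close>

lemma pfrac_least:
  assumes R: "prehom R" and Z: "pfield Z" and "R \<subseteq> Z"
  shows "pfrac R \<subseteq> Z"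
proof clarify
  fix a b assume "(a, b) \<in> pfrac R"
  then obtain r r' s s' where *: "a = r / s" "(r, r') \<in> R" "(s, s') \<in> R" "s \<noteq> 0" "s' * b = r'"
    by (auto simp: pfrac_def)
  obtain s'' where s'': "s' * s'' = 1" using prehom_unit[OF R *(3,4)] by blast
  have "(r * inverse s, r' * s'') \<in> Z"
    using assms * s'' by (intro pring_mult pfield_inverse pfield_pring) auto
  moreover have "r' * s'' = b" using s'' *(5) by (metis mult.assoc mult.commute mult.right_neutral)
  ultimately show "(a, b) \<in> Z" using * by (simp add: divide_inverse)
qed

lemma pfrac_phom:
  assumes R: "prehom R"
  shows "phom (pfrac R)"
proof -
  note Rr = prehom_pring[OF R]
  have "pring (pfrac R)"
    unfolding pring_def
  proof (intro conjI allI impI)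
    show "(1, 1) \<in> pfrac R" using pring_1[OF Rr] pfrac_subset[OF Rr] by blast
  next
    fix a b a2 b2 assume "(a, b) \<in> pfrac R" "(a2, b2) \<in> pfrac R"
    then obtain r r' s s' p p' q q' where *: "a = r / s" "(r, r') \<in> R" "(s, s') \<in> R" "s \<noteq> 0" "s' * b = r'"
      "a2 = p / q" "(p, p') \<in> R" "(q, q') \<in> R" "q \<noteq> 0" "q' * b2 = p'"
      by (auto simp: pfrac_def)
    have "(r * q + p * s, r' * q' + p' * s') \<in> R" "(s * q, s' * q') \<in> R" "(r * p, r' * p') \<in> R"
      using * Rr by (auto intro!: pring_add pring_mult)
    moreover have "a + a2 = (r * q + p * s) / (s * q)" "a * a2 = (r * p) / (s * q)"
      "(s' * q') * (b + b2) = r' * q' + p' * s'" "(s' * q') * (b * b2) = r' * p'"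
      using *(1,4,6,9) by (auto simp: field_simps *(5)[symmetric] *(10)[symmetric])
    ultimately show "(a + a2, b + b2) \<in> pfrac R" "(a * a2, b * b2) \<in> pfrac R"
      using *(4,9) unfolding pfrac_def by (auto, (metis mult_eq_0_iff)+)
  next
    fix a b assume "(a, b) \<in> pfrac R"
    then obtain r r' s s' where *: "a = r / s" "(r, r') \<in> R" "(s, s') \<in> R" "s \<noteq> 0" "s' * b = r'"
      by (auto simp: pfrac_def)
    have "(- r, - r') \<in> R" "- a = (- r) / s" "s' * (- b) = - r'" using * Rr by (auto intro: pring_minus)
    then show "(- a, - b) \<in> pfrac R" using *(3,4) unfolding pfrac_def by blast
  qed
  moreover have "b = 0" if b0: "(0, b) \<in> pfrac R" for b
  proof -
    obtain a r r' s s' where *: "a = 0" "a = r / s" "(r, r') \<in> R" "(s, s') \<in> R" "s \<noteq> 0" "s' * b = r'"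
      using b0 by (fastforce simp: pfrac_def)
    have "r = 0" using *(1,2,5) by simp
    then have "r' = 0" using prehom_zero[OF R] *(3) by blast
    obtain s'' where s'': "s' * s'' = 1" using prehom_unit[OF R *(4,5)] by blast
    have "b = s'' * (s' * b)" using s'' by (metis mult.assoc mult.commute mult.right_neutral)
    then show "b = 0" using \<open>r' = 0\<close> *(6) by simp
  qed
  moreover have inv: "\<exists>b'. b * b' = 1 \<and> (inverse a, b') \<in> pfrac R"
    if ab: "(a, b) \<in> pfrac R" "a \<noteq> 0" for a b
  proof -
    obtain r r' s s' where *: "a = r / s" "(r, r') \<in> R" "(s, s') \<in> R" "s \<noteq> 0" "s' * b = r'"
      using ab(1) by (auto simp: pfrac_def)
    have "r \<noteq> 0" using ab(2) *(1) by auto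
    then obtain r'' where r'': "r' * r'' = 1" using prehom_unit[OF R *(2)] by blast
    have "b * (s' * r'') = 1" using r'' *(5) by (metis mult.assoc mult.commute)
    moreover have "(inverse a, s' * r'') \<in> pfrac R"
    proof -
      have "inverse a = s / r" using *(1) by simp
      moreover have "r' * (s' * r'') = s'" using r'' by (metis mult.left_commute mult.right_neutral)
      ultimately show ?thesis using *(2,3) \<open>r \<noteq> 0\<close> unfolding pfrac_def by blast
    qed
    ultimately show ?thesis by blast
  qed
  ultimately have pre: "prehom (pfrac R)" unfolding prehom_def by blast
  have "(inverse a, b') \<in> pfrac R" if ab: "(a, b) \<in> pfrac R" "b * b' = 1" for a b b'
  proof -
    have "a \<noteq> 0" using prehom_zero[OF pre, of b] that by auto
    then obtain c where "b * c = 1" "(inverse a, c) \<in> pfrac R" using inv[OF ab(1)] by blast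
    then have c: "b * c = 1" "(inverse a, c) \<in> pfrac R" by auto
    have "b' = b' * (b * c)" using c by simp
    also have "\<dots> = (b * b') * c" by (simp only: ac_simps)
    finally show ?thesis using that(2) c(2) by simp
  qed
  then show ?thesis using pre by (auto simp: phom_def pfield_def prehom_def)
qed

section \<open>Adjoining one element to a partial homomorphism\<close>

definition prel :: "('a::zero \<times> 'b::zero) set \<Rightarrow> 'a poly \<Rightarrow> 'b poly \<Rightarrow> bool" where
  "prel \<Gamma> p q \<longleftrightarrow> (\<forall>i. (coeff p i, coeff q i) \<in> \<Gamma>)"

text \<open>The would-be extension sending \<open>a\<close> to \<open>b\<close>; it is single-valued
  only if every relation of \<open>a\<close> passes to \<open>b\<close>.\<close>

definition padj :: "('a::field \<times> 'b::comm_ring_1) set \<Rightarrow> 'a \<Rightarrow> 'b \<Rightarrow> ('a \<times> 'b) set" where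
  "padj \<Gamma> a b = {(poly p a, poly q b) | p q. prel \<Gamma> p q}"

definition pext :: "('a::field \<times> 'b::comm_ring_1) set \<Rightarrow> 'a \<Rightarrow> 'b \<Rightarrow> ('a \<times> 'b) set" where
  "pext \<Gamma> a b = pfrac (padj \<Gamma> a b)"

lemma prel_add: "pring \<Gamma> \<Longrightarrow> prel \<Gamma> p q \<Longrightarrow> prel \<Gamma> p' q' \<Longrightarrow> prel \<Gamma> (p + p') (q + q')"
  and prel_diff: "pring \<Gamma> \<Longrightarrow> prel \<Gamma> p q \<Longrightarrow> prel \<Gamma> p' q' \<Longrightarrow> prel \<Gamma> (p - p') (q - q')"
  and prel_minus: "pring \<Gamma> \<Longrightarrow> prel \<Gamma> p q \<Longrightarrow> prel \<Gamma> (- p) (- q)"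
  and prel_mult: "pring \<Gamma> \<Longrightarrow> prel \<Gamma> p q \<Longrightarrow> prel \<Gamma> p' q' \<Longrightarrow> prel \<Gamma> (p * p') (q * q')"
  and prel_monom: "pring \<Gamma> \<Longrightarrow> (a, b) \<in> \<Gamma> \<Longrightarrow> prel \<Gamma> (monom a n) (monom b n)"
  and prel_0: "pring \<Gamma> \<Longrightarrow> prel \<Gamma> 0 0"
  and prel_1: "pring \<Gamma> \<Longrightarrow> prel \<Gamma> 1 1"
  and prel_const: "pring \<Gamma> \<Longrightarrow> (a, b) \<in> \<Gamma> \<Longrightarrow> prel \<Gamma> [:a:] [:b:]"
  and prel_X: "pring \<Gamma> \<Longrightarrow> prel \<Gamma> [:0, 1:] [:0, 1:]"
  unfolding prel_def
  by (auto simp: coeff_mult coeff_pderiv coeff_pCons split: nat.split simp del: of_nat_Suc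
      intro!: pring_add pring_diff pring_minus pring_sum pring_mult pring_0 pring_1 pring_of_nat)

lemma prel_pderiv:
  fixes \<Gamma> :: "('a::field_char_0 \<times> 'b::idom) set"
  shows "pring \<Gamma> \<Longrightarrow> prel \<Gamma> p q \<Longrightarrow> prel \<Gamma> (pderiv p) (pderiv q)"
  unfolding prel_def
  by (auto simp: coeff_pderiv simp del: of_nat_Suc intro!: pring_mult pring_of_nat)

lemma prel_sum: "pring \<Gamma> \<Longrightarrow> (\<And>i. i \<in> A \<Longrightarrow> prel \<Gamma> (f i) (g i)) \<Longrightarrow> prel \<Gamma> (sum f A) (sum g A)"
  by (induction A rule: infinite_finite_induct) (auto simp: prel_0 prel_add)

lemma prel_mono: "\<Gamma> \<subseteq> \<Gamma>' \<Longrightarrow> prel \<Gamma> p q \<Longrightarrow> prel \<Gamma>' p q"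
  by (auto simp: prel_def)

lemma prel_map_poly:
  assumes "pring \<Gamma>" "prel \<Gamma> p q" "d 0 = 0" "d' 0 = 0" "\<And>a b. (a, b) \<in> \<Gamma> \<Longrightarrow> (d a, d' b) \<in> \<Gamma>'"
  shows "prel \<Gamma>' (map_poly d p) (map_poly d' q)"
  using assms by (auto simp: prel_def coeff_map_poly)

lemma prel_ex:
  assumes "pring \<Gamma>" "\<And>i. coeff p i \<in> Domain \<Gamma>"
  shows "\<exists>q. prel \<Gamma> p q"
proof -
  have "\<forall>i. \<exists>y. (coeff p i, y) \<in> \<Gamma>" using assms(2) by blast
  then obtain f where f: "\<And>i. (coeff p i, f i) \<in> \<Gamma>" by metis
  have "prel \<Gamma> (\<Sum>i\<le>degree p. monom (coeff p i) i) (\<Sum>i\<le>degree p. monom (f i) i)"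
    using f by (intro prel_sum prel_monom assms) auto
  then show ?thesis by (auto simp: poly_as_sum_of_monoms)
qed

lemma prel_poly:
  assumes "pring \<Gamma>" "prel \<Gamma> p q" "(a, b) \<in> \<Gamma>"
  shows "(poly p a, poly q b) \<in> \<Gamma>"
proof -
  let ?n = "max (degree p) (degree q)"
  have "poly p a = (\<Sum>i\<le>?n. coeff p i * a ^ i)"
    unfolding poly_altdef by (rule sum.mono_neutral_left) (auto simp: coeff_eq_0)
  moreover have "poly q b = (\<Sum>i\<le>?n. coeff q i * b ^ i)"
    unfolding poly_altdef by (rule sum.mono_neutral_left) (auto simp: coeff_eq_0)
  ultimately show ?thesis
    using assms by (auto simp: prel_def intro!: pring_sum pring_mult pring_power)
qed

lemma padj_pring:
  assumes G: "pring \<Gamma>"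
  shows "pring (padj \<Gamma> a b)"
  unfolding pring_def[of "padj \<Gamma> a b"] unfolding padj_def
proof (intro conjI allI impI)
  show "(1, 1) \<in> {(poly p a, poly q b) |p q. prel \<Gamma> p q}"
    using prel_1[OF G] by force
  fix x y x' y'
  assume "(x, y) \<in> {(poly p a, poly q b) |p q. prel \<Gamma> p q}"
  then obtain p q where 1: "x = poly p a" "y = poly q b" "prel \<Gamma> p q" by auto
  show "(- x, - y) \<in> {(poly p a, poly q b) |p q. prel \<Gamma> p q}"
    using 1 prel_minus[OF G 1(3)] by (auto intro!: exI[of _ "- p"] exI[of _ "- q"])
  assume "(x', y') \<in> {(poly p a, poly q b) |p q. prel \<Gamma> p q}"
  then obtain p' q' where 2: "x' = poly p' a" "y' = poly q' b" "prel \<Gamma> p' q'" by auto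
  show "(x + x', y + y') \<in> {(poly p a, poly q b) |p q. prel \<Gamma> p q}"
    using 1 2 prel_add[OF G 1(3) 2(3)] by (auto intro!: exI[of _ "p + p'"] exI[of _ "q + q'"])
  show "(x * x', y * y') \<in> {(poly p a, poly q b) |p q. prel \<Gamma> p q}"
    using 1 2 prel_mult[OF G 1(3) 2(3)] by (auto intro!: exI[of _ "p * p'"] exI[of _ "q * q'"])
qed

lemma padj_subset: "pring \<Gamma> \<Longrightarrow> \<Gamma> \<subseteq> padj \<Gamma> a b"
proof clarify
  fix x y assume "pring \<Gamma>" "(x, y) \<in> \<Gamma>"
  then have "prel \<Gamma> [:x:] [:y:]" by (rule prel_const)
  then show "(x, y) \<in> padj \<Gamma> a b" unfolding padj_def by force
qed

lemma padj_mem: "pring \<Gamma> \<Longrightarrow> (a, b) \<in> padj \<Gamma> a b"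
  unfolding padj_def using prel_X[of \<Gamma>] by force

lemma padj_least: "pring Z \<Longrightarrow> \<Gamma> \<subseteq> Z \<Longrightarrow> (a, b) \<in> Z \<Longrightarrow> padj \<Gamma> a b \<subseteq> Z"
  unfolding padj_def using prel_poly prel_mono by blast

lemma pext_subset: "pring \<Gamma> \<Longrightarrow> \<Gamma> \<subseteq> pext \<Gamma> a b"
  unfolding pext_def using pfrac_subset[OF padj_pring] padj_subset by blast

lemma pext_mem: "pring \<Gamma> \<Longrightarrow> (a, b) \<in> pext \<Gamma> a b"
  unfolding pext_def using pfrac_subset[OF padj_pring] padj_mem by blast

lemma pext_phom: "prehom (padj \<Gamma> a b) \<Longrightarrow> phom (pext \<Gamma> a b)"
  unfolding pext_def by (rule pfrac_phom)

lemma pext_least: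
  "prehom (padj \<Gamma> a b) \<Longrightarrow> pfield Z \<Longrightarrow> \<Gamma> \<subseteq> Z \<Longrightarrow> (a, b) \<in> Z \<Longrightarrow> pext \<Gamma> a b \<subseteq> Z"
  unfolding pext_def by (intro pfrac_least padj_least pfield_pring)

lemma prel_nonzero:
  assumes "prehom \<Gamma>" "prel \<Gamma> p q"
  shows "coeff p i = 0 \<longleftrightarrow> coeff q i = 0"
  using assms prehom_nz by (auto simp: prel_def)

lemma prel_degree: "prehom \<Gamma> \<Longrightarrow> prel \<Gamma> p q \<Longrightarrow> degree q = degree p"
  unfolding degree_def by (simp add: prel_nonzero)

lemma prel_zero_iff: "prehom \<Gamma> \<Longrightarrow> prel \<Gamma> p q \<Longrightarrow> p = 0 \<longleftrightarrow> q = 0"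
  by (simp add: poly_eq_iff prel_nonzero)

text \<open>Both divisions run in parallel. The leading coefficient of \<open>g'\<close> is the
  image of a nonzero element, hence a unit, so the target may have zero divisors.\<close>

lemma prel_division:
  assumes G: "phom \<Gamma>" and "prel \<Gamma> p p'" and g: "prel \<Gamma> g g'" "g \<noteq> 0"
  shows "\<exists>q q' r r'. prel \<Gamma> q q' \<and> prel \<Gamma> r r' \<and> p = q * g + r \<and> p' = q' * g' + r' \<and>
           (r = 0 \<or> degree r < degree g)"
  using assms(2)
proof (induction "degree p" arbitrary: p p' rule: less_induct)
  case less
  note R = phom_pring[OF G]
  show ?case
  proof (cases "p = 0 \<or> degree p < degree g")
    case True
    then show ?thesis
      using less.prems by (intro exI[of _ 0] exI[of _ 0] exI[of _ p] exI[of _ p']) (auto intro: prel_0[OF R])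
  next
    case False
    define n where "n = degree p - degree g"
    have lg: "(lead_coeff g, coeff g' (degree g)) \<in> \<Gamma>" and lp: "(lead_coeff p, coeff p' (degree p)) \<in> \<Gamma>"
      using g less.prems by (auto simp: prel_def)
    obtain i where i: "coeff g' (degree g) * i = 1"
      using prehom_unit[OF phom_prehom[OF G] lg] g by auto
    define c c' where "c = lead_coeff p * inverse (lead_coeff g)" and "c' = coeff p' (degree p) * i"
    have c: "(c, c') \<in> \<Gamma>"
      unfolding c_def c'_def using lp pfield_inverse[OF phom_pfield[OF G] lg i] R by (intro pring_mult)
    define p1 p1' where "p1 = p - monom c n * g" and "p1' = p' - monom c' n * g'"
    have p1: "prel \<Gamma> p1 p1'"
      unfolding p1_def p1'_def using less.prems c g R by (intro prel_diff prel_mult prel_monom)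
    have c0: "c \<noteq> 0" unfolding c_def using False g by simp
    have deg: "p1 = 0 \<or> degree p1 < degree p"
    proof -
      have dm: "degree (monom c n * g) = degree p"
        using c0 g False by (simp add: degree_mult_eq degree_monom_eq n_def)
      have "coeff (monom c n * g) (degree p) = c * lead_coeff g"
        using dm c0 g by (metis lead_coeff_mult lead_coeff_monom)
      then have "coeff p1 (degree p) = 0" using g unfolding p1_def c_def by simp
      moreover have "degree p1 \<le> degree p" unfolding p1_def using dm by (intro degree_diff_le) auto
      ultimately show ?thesis using eq_zero_or_degree_less by blast
    qed
    obtain q q' r r' where *: "prel \<Gamma> q q'" "prel \<Gamma> r r'" "p1 = q * g + r" "p1' = q' * g' + r'"
      "r = 0 \<or> degree r < degree g"
    proof (cases "p1 = 0")
      case True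
      moreover have "p1' = 0" using prel_zero_iff[OF phom_prehom[OF G] p1] True by simp
      ultimately show ?thesis using that[of 0 0 0 0] prel_0[OF R] by simp
    next
      case False
      then show ?thesis using less.hyps[OF _ p1] deg that by blast
    qed
    show ?thesis
    proof (intro exI conjI)
      show "prel \<Gamma> (monom c n + q) (monom c' n + q')" using * c R by (intro prel_add prel_monom)
      show "prel \<Gamma> r r'" by fact
      show "p = (monom c n + q) * g + r" using *(3) p1_def by (simp add: algebra_simps)
      show "p' = (monom c' n + q') * g' + r'" using *(4) p1'_def by (simp add: algebra_simps)
      show "r = 0 \<or> degree r < degree g" by fact
    qed
  qed
qed

text \<open>A minimal polynomial of \<open>a\<close> over the domain of \<open>\<Gamma>\<close>, not
  made monic, together with its image.\<close>

definition min_rel :: "('a::field \<times> 'b::comm_ring_1) set \<Rightarrow> 'a \<Rightarrow> 'a poly \<Rightarrow> 'b poly \<Rightarrow> bool" where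
  "min_rel \<Gamma> a g g' \<longleftrightarrow> prel \<Gamma> g g' \<and> g \<noteq> 0 \<and> poly g a = 0 \<and>
     (\<forall>p q. prel \<Gamma> p q \<longrightarrow> p \<noteq> 0 \<longrightarrow> degree p < degree g \<longrightarrow> poly p a \<noteq> 0)"

lemma min_rel_ex:
  assumes "prel \<Gamma> p p'" "p \<noteq> 0" "poly p a = 0"
  shows "\<exists>g g'. min_rel \<Gamma> a g g'"
proof -
  let ?P = "\<lambda>g. g \<noteq> 0 \<and> poly g a = 0 \<and> (\<exists>g'. prel \<Gamma> g g')"
  define g where "g = arg_min degree ?P"
  have "?P g" and "\<And>q. ?P q \<Longrightarrow> degree g \<le> degree q"
    unfolding g_def using arg_min_natI[of ?P p degree] arg_min_nat_le[of ?P _ degree] assms by blast+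
  then show ?thesis unfolding min_rel_def by (meson linorder_not_less)
qed

lemma min_rel_degree:
  assumes "min_rel \<Gamma> a g g'" shows "degree g > 0"
proof (rule ccontr)
  assume "\<not> ?thesis"
  then obtain c where "g = [:c:]" by (metis degree_0_id gr_zeroI)
  then show False using assms by (auto simp: min_rel_def)
qed

text \<open>Modulo \<open>g\<close>, every element of the extension is the value of a polynomial of
  degree below that of \<open>g\<close>, and nonzero ones go to units by the Euclidean algorithm.
  Hence any root of \<open>g'\<close> is an admissible image of \<open>a\<close>.\<close>

lemma min_rel_prehom:
  assumes G: "phom \<Gamma>" and m: "min_rel \<Gamma> a g g'" and b: "poly g' b = 0"
  shows "prehom (padj \<Gamma> a b)"
proof -
  note R = phom_pring[OF G]
  have g: "prel \<Gamma> g g'" "g \<noteq> 0" "poly g a = 0"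
    and min: "\<And>p q. prel \<Gamma> p q \<Longrightarrow> p \<noteq> 0 \<Longrightarrow> degree p < degree g \<Longrightarrow> poly p a \<noteq> 0"
    using m by (auto simp: min_rel_def)
  \<comment> \<open>Evaluating \<open>g' = q' * p' + r'\<close> at \<open>b\<close> gives
    \<open>p'(b) q'(b) = - r'(b)\<close>, a unit by induction. Here \<open>r\<close> is nonzero, for
    otherwise \<open>a\<close> would be a root of the smaller polynomial \<open>q\<close>.\<close>
  have unit: "\<exists>z. poly p' b * z = 1" if "prel \<Gamma> p p'" "p \<noteq> 0" "degree p < degree g" for p p'
    using that
  proof (induction "degree p" arbitrary: p p' rule: less_induct)
    case less
    show ?case
    proof (cases "degree p = 0")
      case True
      then have "degree p' = 0" using prel_degree[OF phom_prehom[OF G] less.prems(1)] by simp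
      then have "poly p' b = coeff p' 0" by (metis degree_0_id poly_pCons poly_0 mult_zero_right add.right_neutral)
      moreover have "coeff p 0 \<noteq> 0" using True less.prems by (metis leading_coeff_0_iff)
      moreover have "(coeff p 0, coeff p' 0) \<in> \<Gamma>" using less.prems by (auto simp: prel_def)
      ultimately show ?thesis using prehom_unit[OF phom_prehom[OF G]] by metis
    next
      case False
      obtain q q' r r' where *: "prel \<Gamma> q q'" "prel \<Gamma> r r'" "g = q * p + r" "g' = q' * p' + r'"
        "r = 0 \<or> degree r < degree p"
        using prel_division[OF G g(1) less.prems(1,2)] by blast
      have "r \<noteq> 0"
      proof
        assume "r = 0"
        then have "poly q a = 0" using *(3) g(3) min[OF less.prems] by simp
        moreover have "q \<noteq> 0" using *(3) \<open>r = 0\<close> g by auto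
        moreover have "degree g = degree q + degree p"
          using *(3) \<open>r = 0\<close> \<open>q \<noteq> 0\<close> less.prems by (simp add: degree_mult_eq)
        ultimately show False using min[OF *(1)] False by auto
      qed
      then obtain z where z: "poly r' b * z = 1" using less.hyps[OF _ *(2)] * less.prems by auto
      have "poly q' b * poly p' b + poly r' b = 0" using *(4) b by simp
      then have "poly p' b * (- poly q' b) = poly r' b" by (simp add: algebra_simps add_eq_0_iff)
      then have "poly p' b * (- poly q' b * z) = 1" using z by (metis mult.assoc)
      then show ?thesis by blast
    qed
  qed
  have key: "(poly p a = 0 \<longrightarrow> poly p' b = 0) \<and> (poly p a \<noteq> 0 \<longrightarrow> (\<exists>z. poly p' b * z = 1))"
    if pp: "prel \<Gamma> p p'" for p p'
  proof -
    obtain q q' r r' where *: "prel \<Gamma> q q'" "prel \<Gamma> r r'" "p = q * g + r" "p' = q' * g' + r'"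
      "r = 0 \<or> degree r < degree g"
      using prel_division[OF G pp g(1,2)] by blast
    have e: "poly p a = poly r a" "poly p' b = poly r' b" using * g b by simp_all
    show ?thesis
    proof (cases "r = 0")
      case True
      then have "r' = 0" using prel_zero_iff[OF phom_prehom[OF G] *(2)] by simp
      then show ?thesis using e True by simp
    next
      case False
      then show ?thesis using e min[OF *(2)] unit[OF *(2)] *(5) by auto
    qed
  qed
  show ?thesis
    unfolding prehom_def padj_def
    using key padj_pring[OF R, of a b] by (auto simp: padj_def)
qed

text \<open>The rules for sums, products and inverses have the same form on both sides. Together
  with \<open>pfrac_least\<close> this reduces compatibility of two derivations to
  generators.\<close>

lemma pfield_derivation:
  assumes G: "phom \<Gamma>" and d: "derivation d" "derivation d'"
  shows "pfield {(a, b). (a, b) \<in> \<Gamma> \<and> (d a, d' b) \<in> \<Gamma>}"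
proof -
  note R = phom_pring[OF G]
  note inv = pfield_inverse[OF phom_pfield[OF G]]
  have "(d (inverse a), d' b') \<in> \<Gamma>" if "(a, b) \<in> \<Gamma>" "(d a, d' b) \<in> \<Gamma>" "b * b' = 1" for a b b'
  proof -
    have "a \<noteq> 0" using prehom_zero[OF phom_prehom[OF G], of b] that by auto
    then have "d (inverse a) = - d a * inverse a * inverse a"
      by (intro derivation_inverse d) simp
    moreover have "d' b' = - d' b * b' * b'" using that by (intro derivation_inverse d)
    ultimately show ?thesis using that inv R by (auto intro!: pring_mult pring_minus)
  qed
  then show ?thesis
    unfolding pfield_def pring_def
    using inv R d by (auto simp: derivation_add derivation_mult derivation_minus
        intro: pring_1 pring_0 pring_add pring_mult pring_minus)
qed

lemma pext_derivation:
  assumes G': "phom \<Gamma>'" and d: "derivation d" "derivation d'" and sub: "\<Gamma> \<subseteq> \<Gamma>'"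
    and pre: "prehom (padj \<Gamma> a b)" "(a, b) \<in> \<Gamma>'"
    and "\<And>x y. (x, y) \<in> \<Gamma> \<Longrightarrow> (d x, d' y) \<in> \<Gamma>'" "(d a, d' b) \<in> \<Gamma>'"
    and "(x, y) \<in> pext \<Gamma> a b"
  shows "(d x, d' y) \<in> \<Gamma>'"
  using pext_least[OF pre(1) pfield_derivation[OF G' d]] assms by blast

text \<open>Implicit differentiation of \<open>g(a) = 0\<close> and \<open>g'(b) = 0\<close>
  expresses \<open>d a\<close> and \<open>d' b\<close> by the same formula. The denominator does not
  vanish: in characteristic 0 \<open>pderiv g\<close> is nonzero, and its degree is below that of
  the minimal \<open>g\<close>.\<close>

lemma min_rel_derivation:
  fixes \<Gamma> :: "('a::field_char_0 \<times> 'b::idom) set"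
  assumes G: "phom \<Gamma>" and m: "min_rel \<Gamma> a g g'" and b: "poly g' b = 0"
    and d: "derivation d" "derivation d'"
    and cl: "\<And>x y. (x, y) \<in> \<Gamma> \<Longrightarrow> (d x, d' y) \<in> pext \<Gamma> a b"
  shows "(d a, d' b) \<in> pext \<Gamma> a b"
proof -
  note R = phom_pring[OF G]
  have E: "phom (pext \<Gamma> a b)" by (rule pext_phom[OF min_rel_prehom[OF G m b]])
  note ER = phom_pring[OF E]
  have g: "prel \<Gamma> g g'" "poly g a = 0" using m by (auto simp: min_rel_def)
  have "pderiv g \<noteq> 0" using min_rel_degree[OF m] by (simp add: pderiv_eq_0_iff)
  moreover have "degree (pderiv g) < degree g" using min_rel_degree[OF m] by (simp add: degree_pderiv)
  ultimately have nz: "poly (pderiv g) a \<noteq> 0"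
    using m prel_pderiv[OF R g(1)] unfolding min_rel_def by blast
  have s: "(poly (pderiv g) a, poly (pderiv g') b) \<in> pext \<Gamma> a b"
    by (intro prel_poly ER pext_mem R prel_mono[OF pext_subset[OF R] prel_pderiv[OF R g(1)]])
  obtain i where i: "poly (pderiv g') b * i = 1"
    using prehom_unit[OF phom_prehom[OF E] s nz] by blast
  have t: "(poly (map_poly d g) a, poly (map_poly d' g') b) \<in> pext \<Gamma> a b"
    using d cl by (intro prel_poly ER pext_mem R prel_map_poly[OF R g(1)]) auto
  have "poly (map_poly d g) a + poly (pderiv g) a * d a = 0"
    using derivation_poly[OF d(1), of g a] g d by simp
  then have 1: "d a = - poly (map_poly d g) a * inverse (poly (pderiv g) a)"
    using nz by (simp add: field_simps add_eq_0_iff)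
  have "poly (map_poly d' g') b + poly (pderiv g') b * d' b = 0"
    using derivation_poly[OF d(2), of g' b] b d by simp
  then have "i * (poly (map_poly d' g') b + poly (pderiv g') b * d' b) = 0" by simp
  then have "poly (map_poly d' g') b * i + (poly (pderiv g') b * i) * d' b = 0"
    by (simp add: algebra_simps)
  then have 2: "d' b = - poly (map_poly d' g') b * i"
    using i by (simp add: eq_neg_iff_add_eq_0 add.commute)
  show ?thesis
    unfolding 1 2
    using pfield_inverse[OF phom_pfield[OF E] s i] t ER by (intro pring_mult pring_minus)
qed

text \<open>
  A derivation \<open>d\<close> amounts to the homomorphism \<open>a \<mapsto> a + d a \<epsilon>\<close> into the dual numbers, so that
  extending derivations is a case of extending partial homomorphisms.
\<close>

datatype 'a dual = Dual (re: 'a) (im: 'a)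

instantiation dual :: (comm_ring_1) comm_ring_1
begin

definition "0 = Dual 0 0"
definition "1 = Dual 1 0"
definition "x + y = Dual (re x + re y) (im x + im y)"
definition "x - y = Dual (re x - re y) (im x - im y)"
definition "- x = Dual (- re x) (- im x)"
definition "x * y = Dual (re x * re y) (re x * im y + im x * re y)"

instance
  by standard (auto simp: zero_dual_def one_dual_def plus_dual_def minus_dual_def uminus_dual_def
      times_dual_def algebra_simps)

end

lemma dual_simps [simp]:
  "re 0 = 0" "im 0 = 0" "re 1 = 1" "im 1 = 0"
  "re (x + y) = re x + re y" "im (x + y) = im x + im y"
  "re (- x) = - re x" "im (- x) = - im x"
  "re (x * y) = re x * re y" "im (x * y) = re x * im y + im x * re y"
  by (auto simp: zero_dual_def one_dual_def plus_dual_def uminus_dual_def times_dual_def)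

lemma dual_unit:
  fixes w :: "'a::field dual"
  assumes "re w \<noteq> 0" shows "\<exists>w'. w * w' = 1"
  using assms
  by (intro exI[of _ "Dual (inverse (re w)) (- im w * inverse (re w) * inverse (re w))"])
     (auto intro!: dual.expand simp: field_simps)

text \<open>Taylor's formula stops after the linear term because \<epsilon> squares to 0. Finding a
  root above a given \<open>a\<close> thus means solving a linear equation for
  \<open>b\<close>.\<close>

lemma poly_dual:
  fixes a :: "'a::field_char_0"
  shows "poly q (Dual a b) = Dual (poly (map_poly re q) a)
    (poly (map_poly im q) a + poly (pderiv (map_poly re q)) a * b)"
proof (induction q)
  case (pCons c q)
  then show ?case
    by (intro dual.expand) (auto simp: map_poly_pCons pderiv_pCons algebra_simps)
qed (auto simp: zero_dual_def)

section \<open>Subfields, algebraic elements and derivations\<close>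

definition field_set :: "'a::field set \<Rightarrow> bool" where
  "field_set E \<longleftrightarrow> 1 \<in> E \<and> (\<forall>a\<in>E. \<forall>b\<in>E. a + b \<in> E \<and> a * b \<in> E) \<and> (\<forall>a\<in>E. - a \<in> E \<and> inverse a \<in> E)"

definition alg :: "'a::field set \<Rightarrow> 'a \<Rightarrow> bool" where
  "alg E z \<longleftrightarrow> (\<exists>p. p \<noteq> 0 \<and> (\<forall>i. coeff p i \<in> E) \<and> poly p z = 0)"

text \<open>Through the identity graph, results on partial homomorphisms become results on
  subfields, such as minimal polynomials and the extensions \<open>fext\<close>.\<close>

lemma Id_on_phom:
  assumes "field_set E" shows "phom (Id_on E)"
proof -
  have r: "pring (Id_on E)" using assms by (auto simp: pring_def field_set_def)
  then have "prehom (Id_on E)" by (intro prehom_fieldI) auto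
  moreover have "(inverse a, b') \<in> Id_on E" if "(a, b) \<in> Id_on E" "b * b' = 1" for a b b'
  proof -
    have "a \<in> E" "b = a" "a \<noteq> 0" using that by auto
    then have "b' = inverse a" using that by (simp add: inverse_unique)
    then show ?thesis using \<open>a \<in> E\<close> assms by (auto simp: field_set_def)
  qed
  ultimately show ?thesis using r by (auto simp: phom_def pfield_def)
qed

lemma field_set_Domain:
  assumes "phom G" shows "field_set (Domain G)"
proof -
  note r = phom_pring[OF assms]
  have "inverse a \<in> Domain G" if a: "a \<in> Domain G" for a
  proof (cases "a = 0")
    case False
    obtain b where b: "(a, b) \<in> G" using a by blast
    obtain b' where "b * b' = 1" using prehom_unit[OF phom_prehom[OF assms] b False] by blast
    then show ?thesis using pfield_inverse[OF phom_pfield[OF assms] b] by blast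
  qed (use a in simp)
  then show ?thesis unfolding field_set_def
    by (meson Domain.simps r pring_1 pring_add pring_mult pring_minus)
qed

lemma field_set_0: "field_set E \<Longrightarrow> 0 \<in> E"
  using pring_0[OF phom_pring[OF Id_on_phom]] by blast

lemma field_set_diff: "field_set E \<Longrightarrow> a \<in> E \<Longrightarrow> b \<in> E \<Longrightarrow> a - b \<in> E"
  unfolding field_set_def by (metis add_uminus_conv_diff)

lemma field_set_poly:
  assumes "field_set E" "\<And>i. coeff p i \<in> E" "z \<in> E" shows "poly p z \<in> E"
proof -
  have "prel (Id_on E) p p" using assms(2) by (auto simp: prel_def)
  then have "(poly p z, poly p z) \<in> Id_on E"
    using assms by (intro prel_poly phom_pring[OF Id_on_phom]) auto
  then show ?thesis by blast
qed

lemma field_set_kernel: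
  assumes "derivation d" shows "field_set {z. d z = 0}"
proof -
  have "d (inverse a) = 0" if "d a = 0" for a
    using that derivation_inverse[OF assms, of a "inverse a"] assms by (cases "a = 0") auto
  then show ?thesis using assms
    by (auto simp: field_set_def derivation_add derivation_mult derivation_minus)
qed

lemma alg_min_poly:
  assumes "field_set E" "alg E z"
  obtains p where "p \<noteq> 0" "\<And>i. coeff p i \<in> E" "poly p z = 0"
    "\<And>q. (\<And>i. coeff q i \<in> E) \<Longrightarrow> q \<noteq> 0 \<Longrightarrow> degree q < degree p \<Longrightarrow> poly q z \<noteq> 0" "degree p > 0"
proof -
  obtain p where "p \<noteq> 0" "\<And>i. coeff p i \<in> E" "poly p z = 0" using assms by (auto simp: alg_def)
  then have "prel (Id_on E) p p" by (auto simp: prel_def)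
  then obtain g g' where g: "min_rel (Id_on E) z g g'"
    using min_rel_ex \<open>p \<noteq> 0\<close> \<open>poly p z = 0\<close> by blast
  show ?thesis
  proof
    show "g \<noteq> 0" "\<And>i. coeff g i \<in> E" "poly g z = 0" using g by (auto simp: min_rel_def prel_def)
    show "poly q z \<noteq> 0" if "\<And>i. coeff q i \<in> E" "q \<noteq> 0" "degree q < degree g" for q
    proof -
      have "prel (Id_on E) q q" using that(1) by (auto simp: prel_def)
      then show ?thesis using g that unfolding min_rel_def by blast
    qed
    show "degree g > 0" by (rule min_rel_degree[OF g])
  qed
qed

lemma field_set_of_nat_mult: "field_set E \<Longrightarrow> a \<in> E \<Longrightarrow> of_nat n * a \<in> E"
  using pring_of_nat[OF phom_pring[OF Id_on_phom], of E n] by (auto simp: field_set_def)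

lemma alg_separable:
  fixes E :: "'a::field_char_0 set"
  assumes "field_set E" "alg E z"
  obtains p where "p \<noteq> 0" "\<And>i. coeff p i \<in> E" "poly p z = 0" "poly (pderiv p) z \<noteq> 0"
proof -
  obtain p where p: "p \<noteq> 0" "\<And>i. coeff p i \<in> E" "poly p z = 0"
    "\<And>q. (\<And>i. coeff q i \<in> E) \<Longrightarrow> q \<noteq> 0 \<Longrightarrow> degree q < degree p \<Longrightarrow> poly q z \<noteq> 0" "degree p > 0"
    using alg_min_poly[OF assms] by metis
  have "poly (pderiv p) z \<noteq> 0"
  proof (rule p(4))
    show "coeff (pderiv p) i \<in> E" for i
      unfolding coeff_pderiv by (intro field_set_of_nat_mult assms p)
    show "pderiv p \<noteq> 0" "degree (pderiv p) < degree p"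
      using p(5) by (auto simp: pderiv_eq_0_iff degree_pderiv)
  qed
  then show ?thesis using that p by blast
qed

lemma derivation_alg:
  fixes d :: "'a::field_char_0 \<Rightarrow> 'a"
  assumes "derivation d" "field_set E" "\<And>a. a \<in> E \<Longrightarrow> d a = 0" "alg E z"
  shows "d z = 0"
proof -
  obtain p where p: "p \<noteq> 0" "\<And>i. coeff p i \<in> E" "poly p z = 0" "poly (pderiv p) z \<noteq> 0"
    using alg_separable[OF assms(2,4)] by metis
  have "map_poly d p = 0" using p assms by (simp add: poly_eq_iff coeff_map_poly)
  then show ?thesis using derivation_poly[OF assms(1), of p z] p assms(1) by simp
qed

lemma pfield_dual_re: "pfield {(a :: 'a::field, w). re w = a}"
proof -
  have "inverse (re w) = re w'" if "w * w' = 1" for w w' :: "'a dual"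
    using arg_cong[OF that, of re] by (simp add: inverse_unique)
  then show ?thesis by (auto simp: pfield_def pring_def)
qed

lemma prel_dual_re:
  assumes "G \<subseteq> {(a :: 'a::field, w). re w = a}" "prel G p q"
  shows "map_poly re q = p"
  using assms by (intro poly_eqI) (auto simp: coeff_map_poly prel_def)

text \<open>For transcendental \<open>z\<close> there are no relations to respect, so the
  infinitesimal part \<open>c\<close> is arbitrary; values with nonzero real part are units.\<close>

lemma transcendental_dual_prehom:
  fixes G :: "('a::field_char_0 \<times> 'a dual) set"
  assumes G: "phom G" "G \<subseteq> {(a, w). re w = a}"
    and "\<And>p q. prel G p q \<Longrightarrow> p \<noteq> 0 \<Longrightarrow> poly p z \<noteq> 0"
  shows "prehom (padj G z (Dual z c))"
  unfolding prehom_def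
proof (intro conjI allI impI)
  show "pring (padj G z (Dual z c))" by (intro padj_pring phom_pring G)
  fix a w assume "(a, w) \<in> padj G z (Dual z c)"
  then obtain p q where *: "a = poly p z" "w = poly q (Dual z c)" "prel G p q" by (auto simp: padj_def)
  have re: "re w = a" using * prel_dual_re[OF G(2) *(3)] by (simp add: poly_dual)
  then show "a \<noteq> 0 \<Longrightarrow> \<exists>b'. w * b' = 1" using dual_unit by blast
next
  fix w assume "(0, w) \<in> padj G z (Dual z c)"
  then obtain p q where *: "0 = poly p z" "w = poly q (Dual z c)" "prel G p q" by (auto simp: padj_def)
  then have "p = 0" using assms(3) by metis
  then have "q = 0" using prel_zero_iff[OF phom_prehom[OF G(1)] *(3)] by simp
  then show "w = 0" using * by simp
qed

lemma phom_Union_chain: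
  assumes "C \<noteq> {}" "\<And>G. G \<in> C \<Longrightarrow> phom G" "\<And>G H. G \<in> C \<Longrightarrow> H \<in> C \<Longrightarrow> G \<subseteq> H \<or> H \<subseteq> G"
  shows "phom (\<Union>C)"
proof -
  have two: "\<exists>G\<in>C. x \<in> G \<and> y \<in> G" if "x \<in> \<Union>C" "y \<in> \<Union>C" for x y using assms(3) that by blast
  have "(1, 1) \<in> \<Union>C" using assms pring_1[OF phom_pring] by blast
  moreover have "(a + a', b + b') \<in> \<Union>C" "(a * a', b * b') \<in> \<Union>C"
    if "(a, b) \<in> \<Union>C" "(a', b') \<in> \<Union>C" for a b a' b'
    using two[OF that] assms(2) pring_add[OF phom_pring] pring_mult[OF phom_pring] by blast+
  moreover have "(- a, - b) \<in> \<Union>C" if "(a, b) \<in> \<Union>C" for a b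
    using that assms(2) pring_minus[OF phom_pring] by blast
  ultimately have r: "pring (\<Union>C)" unfolding pring_def by blast
  show ?thesis
    unfolding phom_def prehom_def pfield_def
  proof (intro conjI r allI impI)
    show "b = 0" if "(0, b) \<in> \<Union>C" for b
      using that assms(2) prehom_zero[OF phom_prehom] by blast
    show "\<exists>b'. b * b' = 1" if "(a, b) \<in> \<Union>C" "a \<noteq> 0" for a b
      using that assms(2) prehom_unit[OF phom_prehom] by blast
    show "(inverse a, b') \<in> \<Union>C" if "(a, b) \<in> \<Union>C" "b * b' = 1" for a b b'
      using that assms(2) pfield_inverse[OF phom_pfield] by blast
  qed
qed

text \<open>Zorn's lemma on lifts of the identity to dual numbers. A maximal lift is total: a
  transcendental \<open>z\<close> may get any derivative, an algebraic one gets the value forced by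
  its minimal polynomial.\<close>

lemma dual_total_extension:
  fixes G0 :: "('a::field_char_0 \<times> 'a dual) set"
  assumes G0: "phom G0" "G0 \<subseteq> {(a, w). re w = a}"
  shows "\<exists>M. phom M \<and> M \<subseteq> {(a, w). re w = a} \<and> G0 \<subseteq> M \<and> Domain M = UNIV"
proof -
  let ?A = "{G. phom G \<and> G \<subseteq> {(a, w). re w = a} \<and> G0 \<subseteq> G}"
  have "\<exists>M\<in>?A. \<forall>X\<in>?A. M \<subseteq> X \<longrightarrow> X = M"
  proof (rule subset_Zorn_nonempty)
    show "?A \<noteq> {}" using G0 by blast
    fix C assume C: "C \<noteq> {}" "subset.chain ?A C"
    have CA: "C \<subseteq> ?A" and cmp: "\<And>G H. G \<in> C \<Longrightarrow> H \<in> C \<Longrightarrow> G \<subseteq> H \<or> H \<subseteq> G"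
      using C(2) by (auto simp only: subset_chain_def)
    have "phom G" if "G \<in> C" for G using subsetD[OF CA that] by simp
    then have "phom (\<Union>C)" by (rule phom_Union_chain[OF C(1) _ cmp])
    moreover have "\<Union>C \<subseteq> {(a, w). re w = a}" using CA by blast
    moreover have "G0 \<subseteq> \<Union>C" using CA C(1) by blast
    ultimately show "\<Union>C \<in> ?A" by simp
  qed
  then obtain M where MA: "M \<in> ?A" and max0: "\<forall>X\<in>?A. M \<subseteq> X \<longrightarrow> X = M" by (rule bexE)
  have M: "phom M" "M \<subseteq> {(a, w). re w = a}" "G0 \<subseteq> M" using MA by simp_all
  have max: "X = M" if "phom X" "X \<subseteq> {(a, w). re w = a}" "M \<subseteq> X" for X
    using max0 that M(3) by simp
  have "z \<in> Domain M" for z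
  proof -
    have ext: "z \<in> Domain M" if "prehom (padj M z (Dual z c))" for c
    proof -
      have sub: "M \<subseteq> pext M z (Dual z c)" by (intro pext_subset phom_pring M)
      have "pext M z (Dual z c) \<subseteq> {(a, w). re w = a}"
        by (intro pext_least that pfield_dual_re M) auto
      then have "pext M z (Dual z c) = M" using max[OF pext_phom[OF that]] sub M by blast
      then show ?thesis using pext_mem[OF phom_pring[OF M(1)]] by blast
    qed
    show ?thesis
    proof (cases "\<exists>p q. prel M p q \<and> p \<noteq> 0 \<and> poly p z = 0")
      case False
      then show ?thesis using ext[of 0] transcendental_dual_prehom[OF M(1,2)] by blast
    next
      case True
      then obtain g g' where g: "min_rel M z g g'" using min_rel_ex by metis
      have "alg (Domain M) z" using True unfolding alg_def prel_def by blast
      have pg: "prel M g g'" "poly g z = 0" using g by (auto simp: min_rel_def)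
      have dg: "degree g > 0" by (rule min_rel_degree[OF g])
      have "\<exists>q. prel M (pderiv g) q"
      proof (rule prel_ex[OF phom_pring[OF M(1)]])
        fix i
        have "coeff g (Suc i) \<in> Domain M" using pg by (auto simp: prel_def)
        then show "coeff (pderiv g) i \<in> Domain M"
          unfolding coeff_pderiv by (intro field_set_of_nat_mult field_set_Domain M)
      qed
      moreover have "pderiv g \<noteq> 0" "degree (pderiv g) < degree g"
        using dg by (auto simp: pderiv_eq_0_iff degree_pderiv)
      ultimately have nz: "poly (pderiv g) z \<noteq> 0" using g unfolding min_rel_def by blast
      \<comment> \<open>Implicit differentiation: this is the \<open>c\<close> for which
        \<open>Dual z c\<close> is a root of \<open>g'\<close>.\<close>
      define c where "c = - poly (map_poly im g') z / poly (pderiv g) z"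
      have "poly g' (Dual z c) = 0"
        unfolding poly_dual prel_dual_re[OF M(2) pg(1)] using nz pg
        by (simp add: c_def zero_dual_def)
      then show ?thesis using ext min_rel_prehom[OF M(1) g] by blast
    qed
  qed
  then show ?thesis using M by blast
qed

text \<open>Start from the zero derivation on \<open>E\<close>, give the transcendental
  \<open>z\<close> derivative 1, and extend to the whole field; the infinitesimal part of the total
  lift is the derivation.\<close>

lemma derivation_ex:
  fixes E :: "'a::field_char_0 set"
  assumes E: "field_set E" and z: "\<not> alg E z"
  shows "\<exists>d. derivation d \<and> (\<forall>a\<in>E. d a = 0) \<and> d z = 1"
proof -
  define G where "G = (\<lambda>a. (a, Dual a 0)) ` E"
  have r: "pring G"
    using E unfolding G_def pring_def field_set_def
    by (auto simp: image_iff one_dual_def plus_dual_def times_dual_def uminus_dual_def)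
  have "(inverse a, w') \<in> G" if "(a, w) \<in> G" "w * w' = 1" for a w w'
  proof -
    have w: "w = Dual a 0" "a \<in> E" using that by (auto simp: G_def)
    have "a * re w' = 1" "a * im w' = 0"
      using arg_cong[OF that(2), of re] arg_cong[OF that(2), of im] w by auto
    then have "re w' = inverse a" "im w' = 0" by (auto simp: inverse_unique)
    then have "w' = Dual (inverse a) 0" by (intro dual.expand) simp
    then show ?thesis using w E by (auto simp: G_def field_set_def)
  qed
  then have G: "phom G" using r
    unfolding phom_def pfield_def prehom_def
    by (auto simp: G_def zero_dual_def intro!: dual_unit)
  have Gre: "G \<subseteq> {(a, w). re w = a}" by (auto simp: G_def)
  have "poly p z \<noteq> 0" if "prel G p q" "p \<noteq> 0" for p q
    using that z unfolding alg_def prel_def G_def by blast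
  then have pre: "prehom (padj G z (Dual z 1))" by (rule transcendental_dual_prehom[OF G Gre])
  have "pext G z (Dual z 1) \<subseteq> {(a, w). re w = a}"
    by (intro pext_least pre pfield_dual_re Gre) auto
  then obtain M where M: "phom M" "M \<subseteq> {(a, w). re w = a}" "pext G z (Dual z 1) \<subseteq> M" "Domain M = UNIV"
    using dual_total_extension[OF pext_phom[OF pre]] by blast
  have "\<forall>a. \<exists>w. (a, w) \<in> M" using M(4) by blast
  then obtain f where f: "\<And>a. (a, f a) \<in> M" by metis
  have feq: "f a = w" if "(a, w) \<in> M" for a w by (rule prehom_unique[OF phom_prehom[OF M(1)] f that])
  have fre: "re (f a) = a" for a using f M(2) by blast
  have "derivation (\<lambda>a. im (f a))"
  proof (rule derivationI)
    fix x y
    have "f (x + y) = f x + f y" "f (x * y) = f x * f y"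
      by (intro feq pring_add pring_mult phom_pring M f)+
    then show "im (f (x + y)) = im (f x) + im (f y)" "im (f (x * y)) = im (f x) * y + x * im (f y)"
      by (simp_all add: fre)
  qed
  moreover have "im (f a) = 0" if "a \<in> E" for a
  proof -
    have "(a, Dual a 0) \<in> G" using that by (simp add: G_def)
    then have "(a, Dual a 0) \<in> M" by (intro subsetD[OF M(3)] subsetD[OF pext_subset[OF r]])
    then show ?thesis using feq by simp
  qed
  moreover have "im (f z) = 1"
    using feq[OF subsetD[OF M(3) pext_mem[OF r]]] by simp
  ultimately show ?thesis by blast
qed

text \<open>In characteristic 0 derivations detect algebraic dependence. Closure properties of
  algebraic elements then become short computations with derivations.\<close>

lemma alg_iff_derivation:
  fixes E :: "'a::field_char_0 set"
  assumes "field_set E"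
  shows "alg E z \<longleftrightarrow> (\<forall>d. derivation d \<longrightarrow> (\<forall>a\<in>E. d a = 0) \<longrightarrow> d z = 0)"
  using derivation_alg[OF _ assms] derivation_ex[OF assms] by (metis zero_neq_one)

text \<open>By implicit differentiation \<open>d z\<close> is a rational expression in
  \<open>z\<close> over \<open>E\<close>, so a derivation trivial on \<open>E\<close> that kills
  \<open>z\<close> kills \<open>d z\<close> as well.\<close>

lemma alg_derivation:
  fixes E :: "'a::field_char_0 set"
  assumes E: "field_set E" and d: "derivation d" "\<And>a. a \<in> E \<Longrightarrow> d a \<in> E" and z: "alg E z"
  shows "alg E (d z)"
  unfolding alg_iff_derivation[OF E]
proof (intro allI impI)
  fix e assume e: "derivation e" "\<forall>a\<in>E. e a = 0"
  let ?F = "{a. e a = 0}"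
  have F: "field_set ?F" "E \<subseteq> ?F" using field_set_kernel[OF e(1)] e by auto
  have zF: "z \<in> ?F" using derivation_alg[OF e(1) E _ z] e by auto
  obtain p where p: "p \<noteq> 0" "\<And>i. coeff p i \<in> E" "poly p z = 0" "poly (pderiv p) z \<noteq> 0"
    using alg_separable[OF E z] by metis
  have "poly (map_poly d p) z + poly (pderiv p) z * d z = 0"
    using derivation_poly[OF d(1), of p z] p(3) d by simp
  then have "d z = - poly (map_poly d p) z * inverse (poly (pderiv p) z)"
    using p(4) by (simp add: field_simps add_eq_0_iff)
  moreover have "poly (map_poly d p) z \<in> ?F"
    using F p d zF by (intro field_set_poly) (auto simp: coeff_map_poly)
  moreover have "poly (pderiv p) z \<in> ?F"
  proof (intro field_set_poly F zF)
    show "coeff (pderiv p) i \<in> ?F" for i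
      unfolding coeff_pderiv using p(2) F(2) by (intro field_set_of_nat_mult F) auto
  qed
  ultimately have "d z \<in> ?F" using F(1) unfolding field_set_def by metis
  then show "e (d z) = 0" by simp
qed

section \<open>Darboux polynomials of the first Painleve equation\<close>

text \<open>Like every field, \<open>'a fls\<close> is trivially Euclidean. Declaring it so gives
  contents, primitive parts and gcds for polynomials over \<open>'a fls\<close>.\<close>

instantiation fls ::
  (field) "{unique_euclidean_ring, normalization_euclidean_semiring, normalization_semidom_multiplicative}"
begin

definition [simp]: "normalize_fls = (normalize_field :: 'a fls \<Rightarrow> _)"
definition [simp]: "unit_factor_fls = (unit_factor_field :: 'a fls \<Rightarrow> _)"
definition [simp]: "modulo_fls = (mod_field :: 'a fls \<Rightarrow> _)"
definition [simp]: "euclidean_size_fls = (euclidean_size_field :: 'a fls \<Rightarrow> _)"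
definition [simp]: "division_segment (x :: 'a fls) = 1"

instance
  by standard (simp_all add: dvd_field_iff field_split_simps split: if_splits)

end

instantiation fls :: (field) euclidean_ring_gcd
begin

definition gcd_fls :: "'a fls \<Rightarrow> 'a fls \<Rightarrow> 'a fls" where "gcd_fls = Euclidean_Algorithm.gcd"
definition lcm_fls :: "'a fls \<Rightarrow> 'a fls \<Rightarrow> 'a fls" where "lcm_fls = Euclidean_Algorithm.lcm"
definition Gcd_fls :: "'a fls set \<Rightarrow> 'a fls" where "Gcd_fls = Euclidean_Algorithm.Gcd"
definition Lcm_fls :: "'a fls set \<Rightarrow> 'a fls" where "Lcm_fls = Euclidean_Algorithm.Lcm"

instance by standard (simp_all add: gcd_fls_def lcm_fls_def Gcd_fls_def Lcm_fls_def)

end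

instance fls :: (field) field_gcd ..

lemma derivation_map_poly:
  assumes "derivation (d :: 'a::comm_ring_1 \<Rightarrow> 'a)"
  shows "derivation (map_poly d)"
  using assms
  by (intro derivationI poly_eqI)
     (simp_all add: coeff_map_poly derivation_add coeff_mult derivation_sum derivation_mult sum.distrib)

lemma derivation_pderiv: "derivation (pderiv :: 'a::idom poly \<Rightarrow> _)"
  by (intro derivationI) (simp_all add: pderiv_add pderiv_mult algebra_simps)

text \<open>
  In \<open>'k poly poly\<close> the inner variable \<open>vX\<close> stands for \<open>x\<close> and the outer variable \<open>vU\<close> for \<open>x'\<close>.
  They get the weights 2 and 3, for which \<open>D0\<close> is the part of top weight of the derivation \<open>DI\<close>.
\<close>

definition vX :: "'k::idom poly poly" where "vX = [:[:0, 1:]:]"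
definition vU :: "'k::idom poly poly" where "vU = [:0, 1:]"
definition dX :: "'k::idom poly poly \<Rightarrow> 'k poly poly" where "dX = map_poly pderiv"
definition dU :: "'k::idom poly poly \<Rightarrow> 'k poly poly" where "dU = pderiv"
definition dC :: "('k::idom \<Rightarrow> 'k) \<Rightarrow> 'k poly poly \<Rightarrow> 'k poly poly" where "dC d = map_poly (map_poly d)"

definition D0 :: "'k::idom poly poly \<Rightarrow> 'k poly poly" where "D0 P = vU * dX P + 6 * vX ^ 2 * dU P"
text \<open>The derivative of a polynomial in \<open>x\<close> and \<open>x'\<close> along solutions
  of \<open>x'' = 6 x^2 + t\<close>. The three summands shift the weight by 0, +1 and -3.\<close>

definition DI :: "('k::idom \<Rightarrow> 'k) \<Rightarrow> 'k \<Rightarrow> 'k poly poly \<Rightarrow> 'k poly poly" where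
  "DI d t P = dC d P + D0 P + [:[:t:]:] * dU P"

lemma derivation_dX: "derivation dX" unfolding dX_def by (intro derivation_map_poly derivation_pderiv)
lemma derivation_dU: "derivation dU" unfolding dU_def by (rule derivation_pderiv)
lemma derivation_dC: "derivation d \<Longrightarrow> derivation (dC d)" unfolding dC_def by (intro derivation_map_poly)
lemma derivation_D0: "derivation D0"
  unfolding D0_def by (rule derivation_lincomb[OF derivation_dX derivation_dU])

lemma derivation_DI:
  assumes "derivation d" shows "derivation (DI d t)"
  unfolding DI_def
  by (intro derivationI)
     (simp_all add: derivation_add[OF derivation_dC[OF assms]] derivation_mult[OF derivation_dC[OF assms]]
       derivation_add[OF derivation_D0] derivation_mult[OF derivation_D0]
       derivation_add[OF derivation_dU] derivation_mult[OF derivation_dU] algebra_simps smult_add_right)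

section \<open>Weighted homogeneous components\<close>

abbreviation cf :: "'k::zero poly poly \<Rightarrow> nat \<Rightarrow> nat \<Rightarrow> 'k" where "cf P j i \<equiv> coeff (coeff P j) i"

lemma cf_eqI: "(\<And>j i. cf P j i = cf Q j i) \<Longrightarrow> P = Q"
  by (intro poly_eqI) auto

lemma cf_const_mult: "cf ([:[:c:]:] * P) j i = c * cf P j i"
  by simp

lemma cf_vU: "cf (vU * P) j i = (if j = 0 then 0 else cf P (j - 1) i)"
  by (auto simp: vU_def coeff_pCons split: nat.split)

lemma vX_power: "vX ^ n = [:monom 1 n:]"
  by (induction n) (simp_all add: vX_def monom_Suc one_pCons)

lemma cf_vX: "cf (vX * P) j i = (if i = 0 then 0 else cf P j (i - 1))"
  by (auto simp: vX_def coeff_pCons split: nat.split)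

lemma cf_vX2: "cf (vX ^ 2 * P) j i = (if i < 2 then 0 else cf P j (i - 2))"
  by (auto simp: power2_eq_square mult.assoc cf_vX numeral_2_eq_2)

lemma cf_dX: "cf (dX P) j i = of_nat (Suc i) * cf P j (Suc i)"
  by (simp add: dX_def coeff_map_poly coeff_pderiv)

lemma cf_dU: "cf (dU P) j i = of_nat (Suc j) * cf P (Suc j) i"
  by (simp add: dU_def coeff_pderiv of_nat_poly del: of_nat_Suc)

lemma cf_dC: "d 0 = 0 \<Longrightarrow> cf (dC d P) j i = d (cf P j i)"
  by (simp add: dC_def coeff_map_poly)

lemma six_const: "(6 :: 'k::idom poly poly) = [:[:6:]:]"
  by (metis numeral_poly)

lemma cf_D0: "cf (D0 P) j i = (if j = 0 then 0 else of_nat (Suc i) * cf P (j - 1) (Suc i))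
    + (if i < 2 then 0 else 6 * of_nat (Suc j) * cf P (Suc j) (i - 2))"
  by (simp add: D0_def mult.assoc six_const cf_vU cf_vX2 cf_dX cf_dU del: of_nat_Suc)

text \<open>The component of weight \<open>w\<close>: for each exponent \<open>j\<close> of
  \<open>vU\<close>, only the exponent \<open>(w - 3 * j) div 2\<close> of \<open>vX\<close> can
  give this weight.\<close>

definition cmp :: "nat \<Rightarrow> 'k::idom poly poly \<Rightarrow> 'k poly poly" where
  "cmp w P = (\<Sum>j\<le>w. if 3 * j \<le> w \<and> even (w - 3 * j)
      then monom (monom (cf P j ((w - 3 * j) div 2)) ((w - 3 * j) div 2)) j else 0)"

lemma cf_cmp: "cf (cmp w P) j i = (if 2 * i + 3 * j = w then cf P j i else 0)"
proof -
  have "cf (cmp w P) j i = (\<Sum>j'\<le>w. if j' = j then if 3 * j \<le> w \<and> even (w - 3 * j) \<and> (w - 3 * j) div 2 = i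
      then cf P j i else 0 else 0)"
    unfolding cmp_def coeff_sum by (intro sum.cong) (auto simp: coeff_monom)
  also have "\<dots> = (if 2 * i + 3 * j = w then cf P j i else 0)"
  proof -
    have "(3 * j \<le> w \<and> even (w - 3 * j) \<and> (w - 3 * j) div 2 = i) \<longleftrightarrow> 2 * i + 3 * j = w" by auto
    then show ?thesis by auto
  qed
  finally show ?thesis .
qed

definition hom_wt :: "nat \<Rightarrow> 'k::idom poly poly \<Rightarrow> bool" where
  "hom_wt w A \<longleftrightarrow> (\<forall>j i. cf A j i \<noteq> 0 \<longrightarrow> 2 * i + 3 * j = w)"

lemma hom_wt_cmp [simp]: "hom_wt w (cmp w P)"
  by (auto simp: hom_wt_def cf_cmp)

lemma hom_wt_diff: "hom_wt w A \<Longrightarrow> hom_wt w B \<Longrightarrow> hom_wt w (A - B)"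
  unfolding hom_wt_def by (metis coeff_diff diff_self)

lemma hom_wt_const_mult: "hom_wt w A \<Longrightarrow> hom_wt w ([:[:c:]:] * A)"
  unfolding hom_wt_def cf_const_mult by (metis mult_zero_right)

lemma cmp_hom_wt: "hom_wt a A \<Longrightarrow> cmp w A = (if w = a then A else 0)"
  by (rule cf_eqI) (auto simp: cf_cmp hom_wt_def)

lemma cmp_add: "cmp w (P + Q) = cmp w P + cmp w Q"
  and cmp_diff: "cmp w (P - Q) = cmp w P - cmp w Q"
  and cmp_const: "cmp w ([:[:c:]:] * P) = [:[:c:]:] * cmp w P"
  and cmp_0 [simp]: "cmp w 0 = 0"
  by (rule cf_eqI; simp add: cf_cmp)+

lemma cmp_sum: "cmp w (sum f A) = (\<Sum>i\<in>A. cmp w (f i))"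
  by (induction A rule: infinite_finite_induct) (auto simp: cmp_add)

lemma cmp_D0: "cmp (Suc w) (D0 P) = D0 (cmp w P)"
  by (rule cf_eqI) (auto simp: cf_cmp cf_D0)

lemma cmp_dC: "d 0 = 0 \<Longrightarrow> cmp w (dC d P) = dC d (cmp w P)"
  by (rule cf_eqI) (auto simp: cf_cmp cf_dC)

lemma cmp_dU: "cmp w (dU P) = dU (cmp (w + 3) P)"
  by (rule cf_eqI) (auto simp: cf_cmp cf_dU)

lemma cmp_sum_self:
  assumes "\<And>w. w > n \<Longrightarrow> cmp w P = 0" shows "(\<Sum>w\<le>n. cmp w P) = P"
proof (rule cf_eqI)
  fix j i
  have "cf (\<Sum>w\<le>n. cmp w P) j i = (\<Sum>w\<le>n. if w = 2 * i + 3 * j then cf P j i else 0)"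
    unfolding coeff_sum cf_cmp by (intro sum.cong) auto
  also have "\<dots> = cf P j i"
    using assms[of "2 * i + 3 * j"] cf_cmp[of "2 * i + 3 * j" P j i] by (auto simp: not_le)
  finally show "cf (\<Sum>w\<le>n. cmp w P) j i = cf P j i" .
qed

lemma cmp_bound: "\<exists>n. \<forall>w>n. cmp w P = 0"
proof -
  define m where "m = Max (insert 0 ((\<lambda>j. degree (coeff P j)) ` {..degree P}))"
  have "cmp w P = 0" if w: "w > 2 * m + 3 * degree P" for w
  proof (rule cf_eqI)
    fix j i
    have "cf P j i = 0" if e: "2 * i + 3 * j = w"
    proof (cases "j \<le> degree P")
      case True
      then have "degree (coeff P j) \<le> m" unfolding m_def by (intro Max_ge) auto
      then have "degree (coeff P j) < i" using w e True by linarith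
      then show ?thesis by (rule coeff_eq_0)
    qed (simp add: coeff_eq_0)
    then show "cf (cmp w P) j i = cf 0 j i" by (simp add: cf_cmp)
  qed
  then show ?thesis by blast
qed

lemma top_weight:
  assumes "P \<noteq> 0"
  obtains n where "cmp n P \<noteq> 0" "\<And>w. w > n \<Longrightarrow> cmp w P = 0"
proof -
  have "\<exists>w. cmp w P \<noteq> 0"
  proof (rule ccontr)
    assume *: "\<nexists>w. cmp w P \<noteq> 0"
    then have "(\<Sum>w\<le>0. cmp w P) = P" by (intro cmp_sum_self) auto
    then show False using * assms by simp
  qed
  moreover obtain b where "\<And>w. cmp w P \<noteq> 0 \<Longrightarrow> w \<le> b" using cmp_bound[of P] by (metis not_le)
  ultimately have "cmp (GREATEST w. cmp w P \<noteq> 0) P \<noteq> 0"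
    "\<And>w. cmp w P \<noteq> 0 \<Longrightarrow> w \<le> (GREATEST w. cmp w P \<noteq> 0)"
    by (metis (mono_tags, lifting) GreatestI_ex_nat) (metis (mono_tags, lifting) Greatest_le_nat \<open>\<And>w. cmp w P \<noteq> 0 \<Longrightarrow> w \<le> b\<close>)
  then show ?thesis using that by (metis not_le)
qed

lemma hom_wt_mult: "hom_wt a A \<Longrightarrow> hom_wt b B \<Longrightarrow> hom_wt (a + b) (A * B)"
proof -
  assume A: "hom_wt a A" and B: "hom_wt b B"
  show ?thesis
    unfolding hom_wt_def
  proof (intro allI impI)
    fix j i assume "cf (A * B) j i \<noteq> 0"
    then obtain k where k: "k \<le> j" "coeff (coeff A k * coeff B (j - k)) i \<noteq> 0"
      by (auto simp: coeff_mult coeff_sum elim: sum.not_neutral_contains_not_neutral)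
    then obtain l where l: "l \<le> i" "cf A k l * cf B (j - k) (i - l) \<noteq> 0"
      unfolding coeff_mult[of "coeff A k"] by (auto elim: sum.not_neutral_contains_not_neutral)
    then have "2 * l + 3 * k = a" "2 * (i - l) + 3 * (j - k) = b"
      using A B unfolding hom_wt_def by auto
    then show "2 * i + 3 * j = a + b" using k(1) l(1) by auto
  qed
qed

lemma cmp_mult_top:
  assumes "\<And>w. w > m \<Longrightarrow> cmp w P = 0" "\<And>w. w > n \<Longrightarrow> cmp w Q = 0"
  shows "cmp (m + n) (P * Q) = cmp m P * cmp n Q"
proof -
  have "P * Q = (\<Sum>a\<le>m. \<Sum>b\<le>n. cmp a P * cmp b Q)"
    using cmp_sum_self[OF assms(1)] cmp_sum_self[OF assms(2)] by (metis sum_product)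
  then have "cmp (m + n) (P * Q) = (\<Sum>a\<le>m. \<Sum>b\<le>n. cmp (m + n) (cmp a P * cmp b Q))"
    by (simp add: cmp_sum)
  also have "\<dots> = (\<Sum>a\<le>m. \<Sum>b\<le>n. if b = n then if a = m then cmp m P * cmp n Q else 0 else 0)"
    by (intro sum.cong refl)
       (auto simp: cmp_hom_wt[OF hom_wt_mult[OF hom_wt_cmp hom_wt_cmp]])
  also have "\<dots> = cmp m P * cmp n Q" by simp
  finally show ?thesis .
qed

text \<open>Twice the Hamiltonian \<open>u^2 / 2 - 2 x^3\<close> of the leading part
  \<open>x'' = 6 x^2\<close>, hence a first integral of \<open>D0\<close>.\<close>

definition H0 :: "'k::idom poly poly" where "H0 = vU ^ 2 - 4 * vX ^ 3"

lemma derivs_var [simp]: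
  "dX vX = 1" "dX vU = 0" "dU vX = 0" "dU vU = (1 :: 'k::idom poly poly)"
  by (simp_all add: dX_def dU_def vX_def vU_def map_poly_pCons pderiv_pCons one_pCons)

lemma dC_var [simp]: "derivation d \<Longrightarrow> dC d vX = 0" "derivation d \<Longrightarrow> dC d vU = 0"
  by (simp_all add: dC_def vX_def vU_def map_poly_pCons one_pCons)

lemma derivation_power: "derivation d \<Longrightarrow> d (x ^ Suc n) = of_nat (Suc n) * x ^ n * d x"
  by (induction n) (auto simp: derivation_mult algebra_simps)

lemma derivation_power_zero: "derivation d \<Longrightarrow> d x = 0 \<Longrightarrow> d (x ^ n) = 0"
  by (cases n) (auto simp: derivation_power simp del: power_Suc)

lemma D0_var [simp]: "D0 vX = vU" "D0 vU = 6 * vX ^ 2"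
  by (simp_all add: D0_def)

lemma derivation_square: "derivation d \<Longrightarrow> d (x ^ 2) = 2 * x * d x"
  and derivation_cube: "derivation d \<Longrightarrow> d (x ^ 3) = 3 * x ^ 2 * d x"
  by (simp_all add: power2_eq_square power3_eq_cube derivation_mult algebra_simps)

lemma D0_H0: "D0 (H0 :: 'k::idom poly poly) = 0"
  by (simp add: H0_def derivation_diff[OF derivation_D0] derivation_mult[OF derivation_D0]
      derivation_square[OF derivation_D0] derivation_cube[OF derivation_D0] derivation_numeral[OF derivation_D0]
      algebra_simps power2_eq_square)

lemma dC_H0: "derivation d \<Longrightarrow> dC d H0 = 0"
  using derivation_dC[of d]
  by (simp add: H0_def derivation_diff derivation_mult derivation_square derivation_cube algebra_simps)

lemma dU_H0: "dU (H0 :: 'k::idom poly poly) = 2 * vU"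
  by (simp add: H0_def derivation_diff[OF derivation_dU] derivation_mult[OF derivation_dU]
      derivation_square[OF derivation_dU] derivation_cube[OF derivation_dU] derivation_numeral[OF derivation_dU]
      algebra_simps power2_eq_square)

lemma const_derivs [simp]:
  "dX [:[:c:]:] = 0" "dU [:[:c:]:] = 0" "D0 [:[:c:]:] = 0" "d 0 = 0 \<Longrightarrow> dC d [:[:c:]:] = [:[:d c:]:]"
  by (simp_all add: D0_def dX_def dU_def dC_def map_poly_pCons pderiv_pCons)

lemma D0_mult_H0_power: "D0 (A * H0 ^ m) = D0 A * H0 ^ m"
  by (simp add: derivation_mult[OF derivation_D0] derivation_power_zero[OF derivation_D0] D0_H0)

lemma D0_const_mult: "D0 ([:[:c:]:] * A) = [:[:c:]:] * D0 A"
  using derivation_mult[OF derivation_D0, of "[:[:c:]:]" A] by simp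

lemma H0_coeffs: "H0 = ([:[:0, 0, 0, - 4:], 0, 1:] :: 'k::idom poly poly)"
proof -
  have "(4 :: 'k poly poly) * vX ^ 3 = [:monom 4 3:]"
    by (simp add: vX_power numeral_poly smult_monom)
  then show ?thesis
    by (simp add: H0_def vU_def power2_eq_square monom_altdef numeral_3_eq_3 one_pCons)
qed

lemma hom_wt_H0: "hom_wt 6 H0"
  unfolding hom_wt_def H0_coeffs
  by (auto simp: coeff_pCons one_pCons split: nat.splits)

text \<open>Evaluation at the point \<open>(1, 2)\<close> of the curve \<open>H0 = 0\<close>, where \<open>D0\<close> agrees with the Euler field.\<close>

definition ev12 :: "'k::idom poly poly \<Rightarrow> 'k" where "ev12 P = poly (poly P [:2:]) 1"

lemma ev12_simps [simp]:
  "ev12 (P + Q) = ev12 P + ev12 Q" "ev12 (P * Q) = ev12 P * ev12 Q" "ev12 (P ^ n) = ev12 P ^ n"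
  "ev12 (smult [:c:] P) = c * ev12 P" "ev12 vX = 1" "ev12 vU = 2" "ev12 [:[:c:]:] = c" "ev12 0 = 0"
  by (simp_all add: ev12_def vX_def vU_def)

lemma ev12_H0 [simp]: "ev12 H0 = 0"
  by (simp add: H0_coeffs ev12_def)

text \<open>Euler's identity multiplies a form of weight \<open>w\<close> by \<open>w\<close>. At
  \<open>(1, 2)\<close> both \<open>D0\<close> and the Euler field 2x d/dx + 3u d/du equal 2 d/dx +
  6 d/du.\<close>

lemma ev12_D0:
  assumes "hom_wt w A" shows "ev12 (D0 A) = of_nat w * ev12 A"
proof -
  have euler: "[:[:2:]:] * (vX * dX A) + [:[:3:]:] * (vU * dU A) = [:[:of_nat w:]:] * A"
  proof (rule cf_eqI)
    fix j i
    have "cf ([:[:2:]:] * (vX * dX A) + [:[:3:]:] * (vU * dU A)) j i = of_nat (2 * i + 3 * j) * cf A j i"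
      unfolding coeff_add cf_const_mult cf_vX cf_vU cf_dX cf_dU
      by (cases i; cases j) (simp_all add: algebra_simps)
    also have "\<dots> = of_nat w * cf A j i" using assms unfolding hom_wt_def by (cases "cf A j i = 0") auto
    finally show "cf ([:[:2:]:] * (vX * dX A) + [:[:3:]:] * (vU * dU A)) j i = cf ([:[:of_nat w:]:] * A) j i"
      by simp
  qed
  have "ev12 (D0 A) = 2 * ev12 (dX A) + 6 * ev12 (dU A)" by (simp add: D0_def six_const)
  also have "\<dots> = ev12 ([:[:2:]:] * (vX * dX A) + [:[:3:]:] * (vU * dU A))"
    by (simp only: ev12_simps) simp
  also have "\<dots> = of_nat w * ev12 A" by (simp only: euler ev12_simps)
  finally show ?thesis .
qed

text \<open>The weighted scalings move \<open>(1, 2)\<close> along the whole cuspidal curve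
  \<open>H0 = 0\<close>, so a homogeneous form vanishing at this point is divisible by
  \<open>H0\<close>. The proof divides by \<open>H0\<close>, which is monic in \<open>vU\<close>,
  and examines the part of weight \<open>w\<close> of the remainder.\<close>

lemma hom_ev12_factor:
  fixes A :: "'k::field_char_0 poly poly"
  assumes A: "hom_wt w A" "ev12 A = 0" "A \<noteq> 0"
  shows "\<exists>w' B. w = w' + 6 \<and> hom_wt w' B \<and> A = H0 * B"
proof -
  have H: "H0 \<noteq> (0 :: 'k poly poly)" "degree (H0 :: 'k poly poly) = 2" "coeff (H0 :: 'k poly poly) 2 = 1"
    by (simp_all add: H0_coeffs numeral_2_eq_2)
  obtain q r where qr: "pseudo_divmod A H0 = (q, r)" by fastforce
  have Aq: "A = H0 * q + r" "r = 0 \<or> degree r < 2"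
    using pseudo_divmod[OF H(1) qr] H by auto
  have qsum: "\<exists>n. (\<Sum>a\<le>n. cmp a q) = q \<and> w \<le> n"
  proof -
    obtain n where "\<forall>w>n. cmp w q = 0" using cmp_bound by blast
    then show ?thesis by (intro exI[of _ "max n w"] conjI cmp_sum_self) auto
  qed
  then obtain n where n: "(\<Sum>a\<le>n. cmp a q) = q" "w \<le> n" by blast
  have "cmp w (H0 * q) = (\<Sum>a\<le>n. cmp w (H0 * cmp a q))"
    by (subst n(1)[symmetric]) (simp add: sum_distrib_left cmp_sum)
  also have "\<dots> = (\<Sum>a\<le>n. if w = a + 6 then H0 * cmp a q else 0)"
    by (intro sum.cong refl) (auto simp: cmp_hom_wt[OF hom_wt_mult[OF hom_wt_H0 hom_wt_cmp]])
  finally have c: "cmp w (H0 * q) = (\<Sum>a\<le>n. if w = a + 6 then H0 * cmp a q else 0)" .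
  have Aw: "A = cmp w (H0 * q) + cmp w r"
    using cmp_hom_wt[OF A(1), of w] Aq(1) by (simp add: cmp_add)
  have r0: "cmp w r = 0"
  proof -
    have "ev12 (cmp w (H0 * q)) = 0"
    proof (cases "w \<ge> 6")
      case True
      then have "cmp w (H0 * q) = H0 * cmp (w - 6) q"
        using n(2) unfolding c by (subst sum.cong[OF refl, of _ _ "\<lambda>a. if a = w - 6 then H0 * cmp (w - 6) q else 0"]) auto
      then show ?thesis by simp
    next
      case False
      then have "cmp w (H0 * q) = 0" unfolding c by (intro sum.neutral) auto
      then show ?thesis by simp
    qed
    then have ev: "ev12 (cmp w r) = 0" using Aw A(2) by simp
    have cr: "cf r j i = 0" if "j \<ge> 2" for j i using Aq(2) that by (auto simp: coeff_eq_0)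
    \<comment> \<open>The remainder has degree below 2 in \<open>vU\<close>, so its part of weight
      \<open>w\<close> is a single term: a power of \<open>vX\<close> for even \<open>w\<close>,
      \<open>vU\<close> times such a power for odd \<open>w\<close>. Neither monomial vanishes at
      \<open>(1, 2)\<close>.\<close>
    show ?thesis
    proof (cases "even w")
      case True
      define i0 where "i0 = w div 2"
      have *: "cmp w r = [:monom (cf r 0 i0) i0:]"
      proof (rule cf_eqI)
        fix j i :: nat
        consider "j = 0" | "j = 1" | "j \<ge> 2" by linarith
        then show "cf (cmp w r) j i = cf [:monom (cf r 0 i0) i0:] j i"
          using cr True by cases (auto simp: cf_cmp i0_def coeff_pCons split: nat.split)
      qed
      have "ev12 (cmp w r) = cf r 0 i0" unfolding * by (simp add: ev12_def poly_monom)
      then show ?thesis using * ev by simp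
    next
      case False
      define i0 where "i0 = (w - 3) div 2"
      have *: "cmp w r = monom (monom (if w \<ge> 3 then cf r 1 i0 else 0) i0) 1"
      proof (rule cf_eqI)
        fix j i :: nat
        consider "j = 0" | "j = 1" | "j \<ge> 2" by linarith
        then show "cf (cmp w r) j i = cf (monom (monom (if w \<ge> 3 then cf r 1 i0 else 0) i0) 1) j i"
          using cr False by cases (auto simp: cf_cmp i0_def)
      qed
      have "ev12 (cmp w r) = 2 * (if w \<ge> 3 then cf r 1 i0 else 0)"
        unfolding * by (simp add: ev12_def poly_monom)
      then show ?thesis using * ev by simp
    qed
  qed
  then have "cmp w (H0 * q) = A" using Aw by simp
  have w6: "w \<ge> 6"
  proof (rule ccontr)
    assume "\<not> 6 \<le> w"
    then have "cmp w (H0 * q) = 0" unfolding c by (intro sum.neutral) auto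
    then show False using \<open>cmp w (H0 * q) = A\<close> A(3) by simp
  qed
  then have "cmp w (H0 * q) = H0 * cmp (w - 6) q"
    using n(2) unfolding c by (subst sum.cong[OF refl, of _ _ "\<lambda>a. if a = w - 6 then H0 * cmp (w - 6) q else 0"]) auto
  then show ?thesis using \<open>cmp w (H0 * q) = A\<close> w6
    by (intro exI[of _ "w - 6"] exI[of _ "cmp (w - 6) q"]) auto
qed

lemma H0_nonzero [simp]: "H0 \<noteq> (0 :: 'k::idom poly poly)"
  by (simp add: H0_coeffs)

lemma D0_H0_mult: "D0 (H0 * B) = H0 * D0 B"
  using D0_mult_H0_power[of B 1] by (simp add: mult.commute)

text \<open>If \<open>H0\<close> divides \<open>D0 A\<close>, then \<open>w\<close> times the value
  of \<open>A\<close> at \<open>(1, 2)\<close> is 0, so \<open>H0\<close> divides \<open>A\<close>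
  and can be cancelled because \<open>D0 H0 = 0\<close>. Each round lowers the weight by 6, and it
  never becomes 0 as 6 does not divide it.\<close>

lemma D0_divisible:
  fixes A :: "'k::field_char_0 poly poly"
  assumes "hom_wt w A" "A \<noteq> 0" "\<not> 6 dvd w" "D0 A = B * H0 ^ m"
  shows "\<exists>w' A1. w = w' + 6 * m \<and> hom_wt w' A1 \<and> A1 \<noteq> 0 \<and> D0 A1 = B"
  using assms
proof (induction m arbitrary: w A)
  case (Suc m)
  have "of_nat w * ev12 A = 0" using ev12_D0[OF Suc.prems(1)] Suc.prems(4) by simp
  moreover have "w \<noteq> 0" using Suc.prems(3) by (metis dvd_0_right)
  ultimately have "ev12 A = 0" by simp
  then obtain w' A' where w': "w = w' + 6" "hom_wt w' A'" "A = H0 * A'"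
    using hom_ev12_factor[OF Suc.prems(1)] Suc.prems(2) by blast
  have "H0 * D0 A' = H0 * (B * H0 ^ m)"
    using Suc.prems(4) unfolding w'(3) D0_H0_mult by (simp add: ac_simps)
  then have "D0 A' = B * H0 ^ m" by simp
  moreover have "\<not> 6 dvd w'" using Suc.prems(3) w'(1) by simp
  moreover have "A' \<noteq> 0" using Suc.prems(2) w'(3) by auto
  ultimately obtain w'' A1 where "w' = w'' + 6 * m" "hom_wt w'' A1" "A1 \<noteq> 0" "D0 A1 = B"
    using Suc.IH[OF w'(2)] by blast
  then show ?case using w'(1) by auto
qed auto

lemma D0_kernel_nonmult:
  fixes A :: "'k::field_char_0 poly poly"
  assumes "hom_wt w A" "\<not> 6 dvd w" "D0 A = 0"
  shows "A = 0"
proof (rule ccontr)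
  assume "A \<noteq> 0"
  \<comment> \<open>With right-hand side 0 any number of factors \<open>H0\<close> can be split off;
    \<open>Suc w\<close> of them weigh more than \<open>A\<close>.\<close>
  then obtain w' where "w = w' + 6 * Suc w" using D0_divisible[OF assms(1) _ assms(2), of 0 "Suc w"] assms(3) by auto
  then show False by simp
qed

text \<open>The same descent in steps of 6 now ends in weight 0, where only constants are
  left.\<close>

lemma D0_kernel_mult:
  fixes A :: "'k::field_char_0 poly poly"
  assumes "hom_wt (6 * m) A" "D0 A = 0"
  shows "\<exists>c. A = [:[:c:]:] * H0 ^ m"
  using assms
proof (induction m arbitrary: A)
  case 0
  have "A = [:[:cf A 0 0:]:]"
    using 0(1) unfolding hom_wt_def by (intro cf_eqI) (auto simp: coeff_pCons split: nat.split)
  then show ?case by (intro exI[of _ "cf A 0 0"]) simp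
next
  case (Suc m)
  show ?case
  proof (cases "A = 0")
    case False
    have "of_nat (6 * Suc m) * ev12 A = 0" using ev12_D0[OF Suc.prems(1)] Suc.prems(2) by simp
    moreover have "of_nat (6 * Suc m) \<noteq> (0 :: 'k)" by (simp only: of_nat_eq_0_iff) simp
    ultimately have "ev12 A = 0" by simp
    then obtain w' A' where w': "6 * Suc m = w' + 6" "hom_wt w' A'" "A = H0 * A'"
      using hom_ev12_factor[OF Suc.prems(1)] False by blast
    then have "hom_wt (6 * m) A'" "D0 A' = 0" using Suc.prems(2) by (auto simp: D0_H0_mult)
    then obtain c where "A' = [:[:c:]:] * H0 ^ m" using Suc.IH by blast
    then show ?thesis using w'(3) by (intro exI[of _ c]) simp
  qed (intro exI[of _ 0], simp)
qed

text \<open>\<open>DI\<close> raises the weight by at most 1, so the cofactor has weight at most 1.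
  The variables have weights 2 and 3, so it is constant.\<close>

lemma darboux_cofactor_const:
  assumes P: "P \<noteq> 0" and d: "derivation d" and eq: "DI d t P = Q * P"
  shows "\<exists>c. Q = [:[:c:]:]"
proof (cases "Q = 0")
  case True
  then show ?thesis by (intro exI[of _ 0]) simp
next
  case False
  obtain n where n: "cmp n P \<noteq> 0" "\<And>w. w > n \<Longrightarrow> cmp w P = 0" using top_weight[OF P] by blast
  obtain m where m: "cmp m Q \<noteq> 0" "\<And>w. w > m \<Longrightarrow> cmp w Q = 0" using top_weight[OF False] by blast
  have "m \<le> 1"
  proof (rule ccontr)
    assume "\<not> m \<le> 1"
    then obtain k where k: "m + n = Suc k" "k > n" by (cases "m + n") auto
    have "cmp (m + n) (DI d t P) = D0 (cmp k P) + dC d (cmp (m + n) P) + [:[:t:]:] * dU (cmp (m + n + 3) P)"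
      unfolding DI_def cmp_add cmp_const cmp_dU k(1) cmp_D0
      by (simp only: cmp_dC[where d = d, OF derivation_0[OF d]] add.commute)
    also have "\<dots> = 0"
      using k n(2) by (simp add: derivation_0[OF derivation_D0] derivation_0[OF derivation_dC[OF d]]
          derivation_0[OF derivation_dU])
    finally show False using cmp_mult_top[OF m(2) n(2)] m(1) n(1) eq by auto
  qed
  have "cf Q j i = 0" if "j > 0 \<or> i > 0" for j i
  proof -
    have "2 * i + 3 * j > m" using that \<open>m \<le> 1\<close> by auto
    then have "cf (cmp (2 * i + 3 * j) Q) j i = 0" using m(2) by simp
    then show ?thesis by (simp add: cf_cmp)
  qed
  then have "Q = [:[:cf Q 0 0:]:]"
    by (intro cf_eqI) (auto simp: coeff_pCons split: nat.split)
  then show ?thesis by blast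
qed

text \<open>
  The top weight part of a Darboux polynomial is \<open>k H0\<^sup>m\<close>.  Comparing the parts of the next five
  weights leads to \<open>D0 A = 2 m k X H0\<^bsup>m-1\<^esup>\<close>, which has no solution of weight \<open>6 m - 5\<close>.
\<close>

lemma darboux_const:
  fixes P :: "'k::field_char_0 poly poly"
  assumes P: "P \<noteq> 0" and d: "derivation d" and t: "d t = 1" and eq: "DI d t P = Q * P"
  shows "\<exists>c. P = [:[:c:]:]"
proof -
  obtain q where q: "Q = [:[:q:]:]" using darboux_cofactor_const[OF P d eq] by blast
  obtain n where n: "cmp n P \<noteq> 0" "\<And>w. w > n \<Longrightarrow> cmp w P = 0" using top_weight[OF P] by blast
  have z: "D0 0 = (0 :: 'k poly poly)" "dC d 0 = 0" "dU 0 = (0 :: 'k poly poly)"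
    using derivation_0[OF derivation_D0] derivation_0[OF derivation_dC[OF d]] derivation_0[OF derivation_dU]
    by auto
  \<comment> \<open>The part of weight \<open>w + 1\<close> of the Darboux equation, with one
    summand for each weight shift of \<open>DI\<close>.\<close>
  have lev: "D0 (cmp w P) + dC d (cmp (Suc w) P) + [:[:t:]:] * dU (cmp (w + 4) P) = [:[:q:]:] * cmp (Suc w) P" for w
  proof -
    have "cmp (Suc w) (DI d t P) = [:[:q:]:] * cmp (Suc w) P" by (simp only: eq q cmp_const)
    then show ?thesis
      unfolding DI_def cmp_add cmp_const cmp_dU cmp_D0
      by (simp only: cmp_dC[where d = d, OF derivation_0[OF d]]) (simp add: eval_nat_numeral add.commute)
  qed
  have "n = 0"
  proof (rule ccontr)
    assume n0: "n \<noteq> 0"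
    have top: "D0 (cmp n P) = 0" using lev[of n] n(2) by (simp add: z)
    have "6 dvd n" using D0_kernel_nonmult[OF hom_wt_cmp _ top] n(1) by blast
    then obtain m' where "n = 6 * m'" by blast
    \<comment> \<open>The top part is written as \<open>k\<close> times \<open>H0^(m + 1)\<close>,
      so that the powers further down are \<open>H0^m\<close>.\<close>
    then obtain m where m: "n = 6 * Suc m" using n0 by (cases m') auto
    obtain k where k: "cmp n P = [:[:k:]:] * H0 ^ Suc m"
      using D0_kernel_mult[of "Suc m" "cmp n P"] top m by auto
    have k0: "k \<noteq> 0" using k n(1) by auto
    have dCH: "dC d ([:[:c:]:] * H0 ^ i) = [:[:d c:]:] * H0 ^ i" for c i
      using derivation_mult[OF derivation_dC[OF d], of "[:[:c:]:]" "H0 ^ i"] d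
      by (simp add: derivation_power_zero[OF derivation_dC[OF d]] dC_H0)
    have nd: "\<not> 6 dvd (n - i)" if "i > 0" "i < 6" for i
    proof -
      have "n - i = 6 * m + (6 - i)" using m that by auto
      then have "6 dvd n - i \<longleftrightarrow> 6 dvd 6 - i" by (simp only: dvd_add_right_iff dvd_triv_left)
      then show ?thesis using that by (auto dest: dvd_imp_le)
    qed
    have e1: "D0 (cmp (n - 1) P) = [:[:q * k - d k:]:] * H0 ^ Suc m"
    proof -
      have i: "Suc (n - 1) = n" "cmp (n - 1 + 4) P = 0" using n0 n(2) by auto
      have "D0 (cmp (n - 1) P) + dC d (cmp n P) = [:[:q:]:] * cmp n P"
        using lev[of "n - 1"] unfolding i by (simp add: z)
      then have "D0 (cmp (n - 1) P) = [:[:q:]:] * ([:[:k:]:] * H0 ^ Suc m) - [:[:d k:]:] * H0 ^ Suc m"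
        unfolding k dCH by (simp only: eq_diff_eq)
      also have "\<dots> = [:[:q * k - d k:]:] * H0 ^ Suc m"
        by (rule cf_eqI) (simp add: algebra_simps del: power_Suc)
      finally show ?thesis .
    qed
    \<comment> \<open>A nonzero solution would contain the factor \<open>H0^(m + 1)\<close>, of
      weight \<open>n\<close>, although its own weight is \<open>n - 1\<close>. So this part
      vanishes and the equation leaves \<open>d k = q k\<close>.\<close>
    have p1: "cmp (n - 1) P = 0"
    proof (rule ccontr)
      assume "cmp (n - 1) P \<noteq> 0"
      then obtain w' where "n - 1 = w' + 6 * Suc m"
        using D0_divisible[OF hom_wt_cmp _ nd e1] by auto
      then show False using m by simp
    qed
    then have dk: "d k = q * k" using e1 by (simp add: z)
    have p2: "cmp (n - 2) P = 0"
    proof (rule D0_kernel_nonmult[OF hom_wt_cmp])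
      have "Suc (n - 2) = n - 1" "n - 2 + 4 > n" using m by auto
      then show "D0 (cmp (n - 2) P) = 0" using lev[of "n - 2"] p1 n(2) by (simp add: z)
    qed (rule nd; simp)
    have p3: "cmp (n - 3) P = 0"
    proof (rule D0_kernel_nonmult[OF hom_wt_cmp])
      have "Suc (n - 3) = n - 2" "n - 3 + 4 > n" using m by auto
      then show "D0 (cmp (n - 3) P) = 0" using lev[of "n - 3"] p2 n(2) by (simp add: z)
    qed (rule nd; simp)
    \<comment> \<open>From \<open>dU (H0^(m + 1)) = 2 (m + 1) vU H0^m\<close> and
      \<open>D0 (vX H0^m) = vU H0^m\<close>: this is the coefficient for which
      \<open>s vX H0^m\<close> satisfies the equation for the part of weight
      \<open>n - 4\<close>.\<close>
    define s where "s = - 2 * of_nat (Suc m) * k * t"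
    have p4: "cmp (n - 4) P = [:[:s:]:] * (vX * H0 ^ m)"
    proof -
      have i: "Suc (n - 4) = n - 3" "n - 4 + 4 = n" using m by auto
      have "D0 (cmp (n - 4) P) + [:[:t:]:] * dU (cmp n P) = 0"
        using lev[of "n - 4"] p3 unfolding i by (simp add: z)
      then have "D0 (cmp (n - 4) P) = - ([:[:t:]:] * dU (cmp n P))" by (simp only: eq_neg_iff_add_eq_0)
      also have "dU (cmp n P) = [:[:k * (2 * of_nat (Suc m)):]:] * (vU * H0 ^ m)"
      proof -
        have "dU (cmp n P) = [:[:k:]:] * dU (H0 ^ Suc m)"
          unfolding k derivation_mult[OF derivation_dU] const_derivs by simp
        also have "dU (H0 ^ Suc m) = of_nat (Suc m) * H0 ^ m * (2 * vU :: 'k poly poly)"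
          by (simp only: derivation_power[OF derivation_dU] dU_H0)
        finally show ?thesis by (simp add: of_nat_poly numeral_poly algebra_simps)
      qed
      also have "- ([:[:t:]:] * ([:[:k * (2 * of_nat (Suc m)):]:] * (vU * H0 ^ m))) = [:[:s:]:] * (vU * H0 ^ m)"
        by (rule cf_eqI) (simp add: s_def algebra_simps del: of_nat_Suc)
      finally have "D0 (cmp (n - 4) P) = [:[:s:]:] * (vU * H0 ^ m)" .
      moreover have "D0 ([:[:s:]:] * (vX * H0 ^ m)) = [:[:s:]:] * (vU * H0 ^ m)"
        by (simp only: D0_const_mult D0_mult_H0_power D0_var)
      ultimately have "D0 (cmp (n - 4) P - [:[:s:]:] * (vX * H0 ^ m)) = 0"
        by (simp only: derivation_diff[OF derivation_D0]) simp
      moreover have "hom_wt (n - 4) (cmp (n - 4) P - [:[:s:]:] * (vX * H0 ^ m))"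
      proof -
        have hH: "hom_wt (6 * m) (H0 ^ m :: 'k poly poly)" for m
        proof (induction m)
          case 0
          show ?case by (auto simp: hom_wt_def one_pCons coeff_pCons split: nat.split_asm)
        next
          case (Suc m)
          show ?case using hom_wt_mult[OF hom_wt_H0 Suc] by simp
        qed
        have hX: "hom_wt 2 (vX :: 'k poly poly)"
          by (auto simp: hom_wt_def vX_def one_pCons coeff_pCons split: nat.split_asm)
        have "hom_wt (n - 4) (vX * H0 ^ m :: 'k poly poly)"
          using hom_wt_mult[OF hX hH[of m]] m by simp
        then show ?thesis by (intro hom_wt_diff hom_wt_const_mult hom_wt_cmp)
      qed
      moreover have "\<not> 6 dvd n - 4" by (rule nd) auto
      ultimately have "cmp (n - 4) P - [:[:s:]:] * (vX * H0 ^ m) = 0" using D0_kernel_nonmult by blast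
      then show ?thesis by (simp only: right_minus_eq)
    qed
    have "D0 (cmp (n - 5) P) = [:[:2 * of_nat (Suc m) * k:]:] * vX * H0 ^ m"
    proof -
      have i: "Suc (n - 5) = n - 4" "n - 5 + 4 = n - 1" using m by auto
      have "dC d (cmp (n - 4) P) = [:[:d s:]:] * (vX * H0 ^ m)"
        unfolding p4 derivation_mult[OF derivation_dC[OF d]] dC_var[OF d]
        by (simp add: d derivation_power_zero[OF derivation_dC[OF d]] dC_H0)
      then have "D0 (cmp (n - 5) P) + [:[:d s:]:] * (vX * H0 ^ m) = [:[:q * s:]:] * (vX * H0 ^ m)"
        using lev[of "n - 5"] p1 p4 unfolding i by (simp add: z)
      \<comment> \<open>Here \<open>d t = 1\<close> enters. Together with \<open>d k = q k\<close>
        it makes \<open>q s - d s\<close> equal to \<open>2 (m + 1) k\<close>; for a constant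
        \<open>t\<close> the difference would be 0.\<close>
      moreover have "d s = - 2 * of_nat (Suc m) * (q * k * t + k)"
      proof -
        have "d s = d (- 2 * of_nat (Suc m)) * (k * t) + (- 2 * of_nat (Suc m)) * d (k * t)"
          unfolding s_def mult.assoc[of _ k t] by (rule derivation_mult[OF d])
        also have "d (- 2 * of_nat (Suc m)) = 0"
          using derivation_mult[OF d, of "- 2" "of_nat (Suc m)"] derivation_minus[OF d, of 2] d
          by (simp del: of_nat_Suc)
        finally show ?thesis using derivation_mult[OF d, of k t] dk t by simp
      qed
      ultimately have "D0 (cmp (n - 5) P) = [:[:q * s:]:] * (vX * H0 ^ m) - [:[:d s:]:] * (vX * H0 ^ m)"
        by (simp add: eq_diff_eq)
      also have "\<dots> = [:[:q * s - d s:]:] * (vX * H0 ^ m)"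
        by (rule cf_eqI) (simp add: algebra_simps)
      also have "q * s - d s = 2 * of_nat (Suc m) * k"
        unfolding \<open>d s = _\<close> by (simp add: s_def algebra_simps)
      finally show ?thesis by (simp only: mult.assoc)
    qed
    then have e5: "D0 (cmp (n - 5) P) = ([:[:2 * of_nat (Suc m) * k:]:] * vX) * H0 ^ m" .
    have nz: "[:[:2 * of_nat (Suc m) * k:]:] * vX \<noteq> (0 :: 'k poly poly)"
      using k0 by (simp add: vX_def del: of_nat_Suc)
    then have "cmp (n - 5) P \<noteq> 0" using e5 by (auto simp: z)
    moreover have "\<not> 6 dvd n - 5" by (rule nd) auto
    \<comment> \<open>Cancelling \<open>H0^m\<close> from weight \<open>n - 5 = 6 m + 1\<close>
      leaves weight 1, and no monomial has this weight.\<close>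
    ultimately have "\<exists>w' A1. n - 5 = w' + 6 * m \<and> hom_wt w' A1 \<and> A1 \<noteq> 0 \<and>
        D0 A1 = [:[:2 * of_nat (Suc m) * k:]:] * vX"
      by (rule D0_divisible[OF hom_wt_cmp _ _ e5])
    then obtain w' and A :: "'k poly poly" where A: "n - 5 = w' + 6 * m" "hom_wt w' A" "A \<noteq> 0"
      by blast
    then have "w' = 1" using m by simp
    have "A = 0"
    proof (rule cf_eqI)
      fix j i show "cf A j i = cf 0 j i"
      proof (rule ccontr)
        assume "cf A j i \<noteq> cf 0 j i"
        then have "2 * i + 3 * j = 1" using A(2) \<open>w' = 1\<close> unfolding hom_wt_def by simp
        then show False by presburger
      qed
    qed
    then show False using A(3) by simp
  qed
  have "P = [:[:cf P 0 0:]:]"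
  proof (rule cf_eqI)
    fix j i
    show "cf P j i = cf [:[:cf P 0 0:]:] j i"
    proof (cases "j = 0 \<and> i = 0")
      case False
      then have "2 * i + 3 * j > n" using \<open>n = 0\<close> by auto
      then have "cf (cmp (2 * i + 3 * j) P) j i = 0" using n(2) by simp
      then show ?thesis using False by (auto simp: cf_cmp coeff_pCons split: nat.split)
    qed auto
  qed
  then show ?thesis by blast
qed

unbundle Formal_Power_Series.fps_syntax
unbundle Formal_Laurent_Series.fps_syntax

text \<open>Gauss's lemma: over the fraction field \<open>c\<close> is a unit, and divisibility by a
  primitive polynomial descends from there.\<close>

lemma primitive_dvd_smult:
  fixes g :: "'a :: {factorial_semiring,semiring_Gcd,ring_gcd,idom_divide,semiring_gcd_mult_normalize} poly"
  assumes "content g = 1" "c \<noteq> 0" "g dvd smult c q"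
  shows "g dvd q"
proof (rule fract_poly_dvdD[OF _ assms(1)])
  have "fract_poly g dvd fract_poly (smult c q)" using assms(3) by (rule fract_poly_dvd)
  then show "fract_poly g dvd fract_poly q" using assms(2) by (simp add: dvd_smult_iff)
qed

text \<open>A relation of \<open>u\<close> over \<open>K(x)\<close> gives a Darboux equation only up
  to a factor \<open>c\<close> in \<open>x\<close>. By Gauss's lemma the primitive part of
  \<open>P\<close> is a true Darboux polynomial, hence constant.\<close>

lemma darboux_degree_gcd:
  fixes P :: "'k::{field_char_0,field_gcd} poly poly"
  assumes P: "P \<noteq> 0" and d: "derivation d" and t: "d t = 1" and c: "c \<noteq> 0"
    and eq: "[:c:] * DI d t P = S * P"
  shows "degree P = 0"
proof -
  note D = derivation_DI[OF d, of t]
  define g where "g = primitive_part P"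
  have Pg: "P = [:content P:] * g" by (simp add: g_def)
  have g: "content g = 1" "g \<noteq> 0" using P by (simp_all add: g_def)
  have "[:c:] * (DI d t [:content P:] * g + [:content P:] * DI d t g) = S * ([:content P:] * g)"
    using eq unfolding derivation_mult[OF D, of "[:content P:]" g, folded Pg] Pg[symmetric] .
  then have "smult (c * content P) (DI d t g) = g * (S * [:content P:] - [:c:] * DI d t [:content P:])"
    by (simp add: algebra_simps smult_add_right)
  then have "g dvd smult (c * content P) (DI d t g)" by simp
  moreover have "c * content P \<noteq> 0" using c P by simp
  ultimately have "g dvd DI d t g" using primitive_dvd_smult[OF g(1)] by blast
  then obtain Q where "DI d t g = Q * g" by (auto simp: dvd_def mult.commute)
  then obtain e where "g = [:[:e:]:]" using darboux_const[OF g(2) d t] by blast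
  then have "degree g = 0" by simp
  then show ?thesis by (simp add: g_def)
qed

text \<open>The equation says that \<open>A / B\<close> has derivative 0. In lowest terms numerator
  and denominator divide their own derivatives, so both are Darboux polynomials and therefore
  constant.\<close>

lemma DI_constant_ratio_gcd:
  fixes A B :: "'k::{field_char_0,field_gcd} poly poly"
  assumes B: "B \<noteq> 0" and d: "derivation d" and t: "d t = 1"
    and eq: "DI d t A * B = A * DI d t B"
  shows "\<exists>l. A = [:[:l:]:] * B"
proof (cases "A = 0")
  case True
  then show ?thesis by (intro exI[of _ 0]) simp
next
  case False
  note D = derivation_DI[OF d, of t]
  let ?g = "gcd A B"
  have g0: "?g \<noteq> 0" using B by simp
  obtain A1 B1 where AB: "A = A1 * ?g" "B = B1 * ?g" "coprime A1 B1"
    using gcd_coprime_exists[OF g0] by blast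
  have nz: "A1 \<noteq> 0" "B1 \<noteq> 0" using AB B False by auto
  have "?g ^ 2 * (DI d t A1 * B1 - A1 * DI d t B1) = DI d t (A1 * ?g) * (B1 * ?g) - (A1 * ?g) * DI d t (B1 * ?g)"
    by (simp add: derivation_mult[OF D] algebra_simps power2_eq_square)
  also have "\<dots> = 0" using eq unfolding AB(1)[symmetric] AB(2)[symmetric] by simp
  finally have e: "DI d t A1 * B1 = A1 * DI d t B1" using B by auto
  have "B1 dvd A1 * DI d t B1" using e by (metis dvd_triv_right)
  then have "B1 dvd DI d t B1" using AB(3) by (simp add: coprime_commute coprime_dvd_mult_right_iff)
  then obtain Q where "DI d t B1 = Q * B1" by (auto simp: dvd_def mult.commute)
  then obtain b where b: "B1 = [:[:b:]:]" using darboux_const[OF nz(2) d t] by blast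
  have "A1 dvd DI d t A1 * B1" using e by simp
  then have "A1 dvd DI d t A1" using AB(3) by (simp add: coprime_dvd_mult_left_iff)
  then obtain Q where "DI d t A1 = Q * A1" by (auto simp: dvd_def mult.commute)
  then obtain a where a: "A1 = [:[:a:]:]" using darboux_const[OF nz(1) d t] by blast
  have "A1 = [:[:a / b:]:] * B1" using nz(2) unfolding a b by simp
  then have "A = [:[:a / b:]:] * B" using AB(1,2) by (metis mult.assoc)
  then show ?thesis by blast
qed

section \<open>Extending the coefficients to Laurent series\<close>

definition fls_map :: "('a::zero \<Rightarrow> 'b::zero) \<Rightarrow> 'a fls \<Rightarrow> 'b fls" where
  "fls_map h f = Abs_fls (\<lambda>n. h (f $$ n))"

lemma fls_map_nth: "h 0 = 0 \<Longrightarrow> fls_map h f $$ n = h (f $$ n)"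
proof -
  assume h: "h 0 = 0"
  have "\<forall>\<^sub>\<infinity>n. h (f $$ - int n) = 0"
    using MOST_mono[OF fls_nth[of f, simplified mem_Collect_eq]] h by auto
  then show ?thesis unfolding fls_map_def by simp
qed

lemma fls_normal_form:
  assumes "N \<le> fls_subdegree f \<or> f = 0"
  shows "\<exists>F. f = fls_shift (- N) (fps_to_fls F)"
proof -
  have "fls_subdegree (fls_shift N f) \<ge> 0 \<or> f = 0" using assms by (auto simp: fls_shift_subdegree)
  then have "fps_to_fls (fls_regpart (fls_shift N f)) = fls_shift N f"
    by (cases "f = 0") (simp_all add: fls_regpart_to_fls_trivial)
  then have "f = fls_shift (- N) (fps_to_fls (fls_regpart (fls_shift N f)))" by simp
  then show ?thesis by blast
qed

lemma derivation_fls_map: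
  assumes d: "derivation (d :: 'a::field \<Rightarrow> 'a)"
  shows "derivation (fls_map d)"
proof (rule derivationI)
  note n = fls_map_nth[of d, OF derivation_0[OF d]]
  fix f g :: "'a fls"
  show "fls_map d (f + g) = fls_map d f + fls_map d g"
    by (rule fls_eqI) (simp add: n derivation_add[OF d])
  \<comment> \<open>A common shift turns both factors into power series, for which the coefficients
    of the product are sums over an explicit range.\<close>
  define N where "N = min (fls_subdegree f) (fls_subdegree g)"
  obtain F G where F: "f = fls_shift (- N) (fps_to_fls F)" and G: "g = fls_shift (- N) (fps_to_fls G)"
    using fls_normal_form[of N f] fls_normal_form[of N g] unfolding N_def by auto
  have m: "fls_map d (fls_shift k (fps_to_fls H)) = fls_shift k (fps_to_fls (Abs_fps (\<lambda>i. d (H $ i))))" for k H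
    by (rule fls_eqI) (simp add: n d)
  have "Abs_fps (\<lambda>i. d ((F * G) $ i)) = Abs_fps (\<lambda>i. d (F $ i)) * G + F * Abs_fps (\<lambda>i. d (G $ i))"
    by (rule fps_ext) (simp add: fps_mult_nth derivation_sum[OF d] derivation_mult[OF d] sum.distrib)
  moreover have "f * g = fls_shift (- N - N) (fps_to_fls (F * G))"
    unfolding F G by (simp add: fls_times_both_shifted_simp fls_times_fps_to_fls)
  ultimately show "fls_map d (f * g) = fls_map d f * g + f * fls_map d g"
    unfolding \<open>f * g = _\<close> m
    by (simp add: F G m fls_times_both_shifted_simp fls_times_fps_to_fls)
qed

lemma map_poly_hom:
  fixes h :: "'a::comm_ring_1 \<Rightarrow> 'b::comm_ring_1"
  assumes "\<And>x y. h (x + y) = h x + h y" "\<And>x y. h (x * y) = h x * h y"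
  shows "map_poly h (p + q) = map_poly h p + map_poly h q"
    "map_poly h (p * q) = map_poly h p * map_poly h q"
proof -
  have h0: "h 0 = 0" using assms(1)[of 0 0] by simp
  have hs: "h (sum f A) = (\<Sum>i\<in>A. h (f i))" for f :: "nat \<Rightarrow> 'a" and A
    by (induction A rule: infinite_finite_induct) (auto simp: h0 assms)
  show "map_poly h (p + q) = map_poly h p + map_poly h q"
    "map_poly h (p * q) = map_poly h p * map_poly h q"
    by (rule poly_eqI; simp add: coeff_map_poly h0 assms coeff_mult hs)+
qed

text \<open>Unique factorization is not available for polynomials over an arbitrary field type, but it is
  for polynomials over \<open>'a fls\<close>, whose class instances contain a gcd.\<close>

definition fc :: "'a::field_char_0 poly poly \<Rightarrow> 'a fls poly poly" where
  "fc = map_poly (map_poly fls_const)"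

lemma cf_fc: "cf (fc P) j i = fls_const (cf P j i)"
  by (simp add: fc_def coeff_map_poly)

lemma fc_mult: "fc (P * Q) = fc P * fc Q"
proof -
  have h1: "map_poly fls_const (p + q) = map_poly fls_const p + map_poly fls_const q" for p q :: "'a poly"
    by (rule map_poly_hom(1)) (simp_all add: fls_plus_const)
  have h2: "map_poly fls_const (p * q) = map_poly fls_const p * map_poly fls_const q" for p q :: "'a poly"
    by (rule map_poly_hom(2)) (simp_all add: fls_plus_const)
  show ?thesis unfolding fc_def by (rule map_poly_hom(2)[OF h1 h2])
qed

lemma fc_eq_iff: "fc P = fc Q \<longleftrightarrow> P = Q"
proof
  assume "fc P = fc Q"
  then have "fls_const (cf P j i) $$ 0 = fls_const (cf Q j i) $$ 0" for j i by (simp flip: cf_fc)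
  then show "P = Q" by (intro cf_eqI) simp
qed simp

lemma fc_0_iff: "fc P = 0 \<longleftrightarrow> P = 0"
  using fc_eq_iff[of P 0] by (simp add: fc_def)

lemma fc_coeff_0_iff: "coeff (fc P) j = 0 \<longleftrightarrow> coeff P j = 0"
  by (simp add: fc_def coeff_map_poly map_poly_eq_0_iff)

lemma degree_fc: "degree (fc P) = degree P"
  unfolding degree_def fc_coeff_0_iff ..

text \<open>Constant series embed the coefficients compatibly with the derivations, so a Darboux
  equation over \<open>'a\<close> becomes one over \<open>'a fls\<close>, where gcds are at
  hand.\<close>

lemma fc_DI:
  assumes d: "d 0 = 0"
  shows "fc (DI d t P) = DI (fls_map d) (fls_const t) (fc P)"
proof (rule cf_eqI)
  fix j i
  have c: "fls_map d (fls_const x) = fls_const (d x)" for x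
    by (rule fls_eqI) (simp add: fls_map_nth d)
  have z: "fls_map d 0 = 0" using c[of 0] d by simp
  have h: "fls_const (x + y) = fls_const x + fls_const y" "fls_const (x * y) = fls_const x * fls_const y"
    for x y :: 'a by (simp_all add: fls_plus_const)
  have o: "fls_const (of_nat k) = (of_nat k :: 'a fls)" for k by (simp add: fls_of_nat)
  show "cf (fc (DI d t P)) j i = cf (DI (fls_map d) (fls_const t) (fc P)) j i"
    by (simp add: cf_fc DI_def cf_D0 cf_dC cf_dU d z c h o del: of_nat_Suc fls_const_mult_const)
qed

lemma darboux_degree:
  fixes P :: "'a::field_char_0 poly poly"
  assumes P: "P \<noteq> 0" and d: "derivation d" and t: "d t = 1" and c: "c \<noteq> 0"
    and eq: "[:c:] * DI d t P = S * P"
  shows "degree P = 0"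
proof -
  have "[:map_poly fls_const c:] * DI (fls_map d) (fls_const t) (fc P) = fc S * fc P"
    using arg_cong[OF eq, of fc] c unfolding fc_mult fc_DI[where d = d, OF derivation_0[OF d]]
    by (simp add: fc_def map_poly_pCons)
  moreover have "map_poly fls_const c \<noteq> 0" using c by (simp add: map_poly_eq_0_iff)
  moreover have "fls_map d (fls_const t) = 1"
    by (rule fls_eqI) (simp add: fls_map_nth d t)
  ultimately have "degree (fc P) = 0"
    using darboux_degree_gcd[OF _ derivation_fls_map[OF d]] P fc_0_iff by blast
  then show ?thesis by (simp add: degree_fc)
qed

lemma DI_constant_ratio:
  fixes A B :: "'a::field_char_0 poly poly"
  assumes B: "B \<noteq> 0" and d: "derivation d" and t: "d t = 1"
    and eq: "DI d t A * B = A * DI d t B"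
  shows "\<exists>l. A = [:[:l:]:] * B"
proof -
  have "DI (fls_map d) (fls_const t) (fc A) * fc B = fc A * DI (fls_map d) (fls_const t) (fc B)"
    using arg_cong[OF eq, of fc] unfolding fc_mult fc_DI[where d = d, OF derivation_0[OF d]] .
  moreover have "fls_map d (fls_const t) = 1"
    by (rule fls_eqI) (simp add: fls_map_nth d t)
  ultimately obtain l where l: "fc A = [:[:l:]:] * fc B"
    using DI_constant_ratio_gcd[OF _ derivation_fls_map[OF d]] B fc_0_iff by blast
  have cfl: "fls_const (cf A j i) = l * fls_const (cf B j i)" for j i
    using arg_cong[OF l, of "\<lambda>P. cf P j i"] by (simp only: cf_const_mult cf_fc)
  \<comment> \<open>The ratio is so far only a Laurent series. As the coefficients of
    \<open>fc A\<close> and \<open>fc B\<close> are constant series, its constant coefficient serves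
    as well.\<close>
  have "A = [:[:l $$ 0:]:] * B"
  proof (rule cf_eqI)
    fix j i
    have "cf A j i = (l * fls_const (cf B j i)) $$ 0" by (simp flip: cfl)
    then show "cf A j i = cf ([:[:l $$ 0:]:] * B) j i" by simp
  qed
  then show ?thesis by blast
qed

section \<open>Constants and Jacobian determinants\<close>

definition eval2 :: "'a::comm_ring_1 poly poly \<Rightarrow> 'a \<Rightarrow> 'a \<Rightarrow> 'a" where
  "eval2 P x u = poly (poly P [:u:]) x"

lemma eval2_simps [simp]:
  "eval2 (P + Q) x u = eval2 P x u + eval2 Q x u" "eval2 (P - Q) x u = eval2 P x u - eval2 Q x u"
  "eval2 (P * Q) x u = eval2 P x u * eval2 Q x u" "eval2 [:p:] x u = poly p x" "eval2 0 x u = 0"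
  by (simp_all add: eval2_def)

lemma eval2_smult [simp]: "eval2 (smult p Q) x u = poly p x * eval2 Q x u"
  by (simp add: eval2_def)

lemma eval2_vX [simp]: "eval2 vX x u = x" and eval2_vU [simp]: "eval2 vU x u = u"
  by (simp_all add: eval2_def vX_def vU_def)

lemma eval2_monom: "eval2 (monom p j) x u = poly p x * u ^ j"
  by (simp add: eval2_def poly_monom poly_power)

lemma eval2_sum: "eval2 (sum f A) x u = (\<Sum>i\<in>A. eval2 (f i) x u)"
  by (induction A rule: infinite_finite_induct) auto

lemma eval2_altdef:
  assumes "degree P \<le> n" shows "eval2 P x u = (\<Sum>j\<le>n. poly (coeff P j) x * u ^ j)"
proof -
  have "P = (\<Sum>j\<le>n. monom (coeff P j) j)" by (rule poly_as_sum_of_monoms'[OF assms, symmetric])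
  then have "eval2 P x u = eval2 (\<Sum>j\<le>n. monom (coeff P j) j) x u" by simp
  then show ?thesis by (simp add: eval2_sum eval2_monom)
qed

lemma eval2_derivation:
  fixes d :: "'a::field_char_0 \<Rightarrow> 'a"
  assumes d: "derivation d"
  shows "d (eval2 P x u) = eval2 (dC d P) x u + eval2 (dX P) x u * d x + eval2 (dU P) x u * d u"
proof -
  have 1: "map_poly d (poly P [:u:]) = poly (dC d P) [:u:] + poly (dU P) [:u:] * [:d u:]"
    using derivation_poly[OF derivation_map_poly[OF d], of P "[:u:]"] d
    by (simp add: dC_def dU_def map_poly_pCons)
  have 2: "pderiv (poly P [:u:]) = poly (dX P) [:u:]"
    using derivation_poly[OF derivation_pderiv, of P "[:u:]"] by (simp add: dX_def pderiv_pCons)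
  show ?thesis unfolding eval2_def derivation_poly[OF d] 1 2 by (simp add: algebra_simps)
qed

text \<open>The chain rule along a solution: evaluation at \<open>(x, u)\<close> turns the formal
  derivation \<open>DI\<close> into the derivation of the field.\<close>

lemma eval2_DI:
  fixes d :: "'a::field_char_0 \<Rightarrow> 'a"
  assumes d: "derivation d" and x: "d x = u" and u: "d u = 6 * x ^ 2 + t"
  shows "d (eval2 P x u) = eval2 (DI d t P) x u"
  unfolding eval2_derivation[OF d] DI_def D0_def x u
  by (simp add: six_const power2_eq_square algebra_simps)

section \<open>Polynomials over a subfield and simple extensions\<close>

definition over :: "'a::zero set \<Rightarrow> 'a poly poly \<Rightarrow> bool" where
  "over K P \<longleftrightarrow> (\<forall>j i. cf P j i \<in> K)"

lemma field_set_sum: "field_set E \<Longrightarrow> (\<And>i. i \<in> A \<Longrightarrow> f i \<in> E) \<Longrightarrow> sum f A \<in> E"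
  by (induction A rule: infinite_finite_induct) (auto simp: field_set_0 field_set_def)

lemma field_set_numeral: "field_set E \<Longrightarrow> numeral n \<in> E"
  using pring_numeral[OF phom_pring[OF Id_on_phom]] by blast

lemma field_set_of_nat: "field_set E \<Longrightarrow> of_nat n \<in> E"
  using pring_of_nat[OF phom_pring[OF Id_on_phom]] by blast

lemma field_setD:
  assumes "field_set E"
  shows "a \<in> E \<Longrightarrow> b \<in> E \<Longrightarrow> a + b \<in> E" "a \<in> E \<Longrightarrow> b \<in> E \<Longrightarrow> a * b \<in> E"
    "a \<in> E \<Longrightarrow> - a \<in> E" "a \<in> E \<Longrightarrow> inverse a \<in> E" "1 \<in> E"
    "a \<in> E \<Longrightarrow> b \<in> E \<Longrightarrow> a - b \<in> E" "a \<in> E \<Longrightarrow> b \<in> E \<Longrightarrow> a / b \<in> E" "a \<in> E \<Longrightarrow> a ^ n \<in> E"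
proof -
  show *: "a \<in> E \<Longrightarrow> b \<in> E \<Longrightarrow> a + b \<in> E" "a \<in> E \<Longrightarrow> b \<in> E \<Longrightarrow> a * b \<in> E"
    "a \<in> E \<Longrightarrow> - a \<in> E" "a \<in> E \<Longrightarrow> inverse a \<in> E" "1 \<in> E" for a b
    using assms by (auto simp: field_set_def)
  show "a \<in> E \<Longrightarrow> b \<in> E \<Longrightarrow> a - b \<in> E" "a \<in> E \<Longrightarrow> b \<in> E \<Longrightarrow> a / b \<in> E"
    using * by (auto simp: field_set_diff[OF assms] divide_inverse)
  show "a \<in> E \<Longrightarrow> a ^ n \<in> E" by (induction n) (auto simp: *)
qed

lemma over_mult: "field_set K \<Longrightarrow> over K P \<Longrightarrow> over K Q \<Longrightarrow> over K (P * Q)"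
  by (auto simp: over_def coeff_mult coeff_sum intro!: field_set_sum field_setD)

lemma over_diff: "field_set K \<Longrightarrow> over K P \<Longrightarrow> over K Q \<Longrightarrow> over K (P - Q)"
  by (auto simp: over_def intro!: field_setD)

lemma over_add: "field_set K \<Longrightarrow> over K P \<Longrightarrow> over K Q \<Longrightarrow> over K (P + Q)"
  by (auto simp: over_def intro!: field_setD)

lemma over_const: "field_set K \<Longrightarrow> (\<And>i. coeff p i \<in> K) \<Longrightarrow> over K [:p:]"
  by (auto simp: over_def coeff_pCons field_set_0 split: nat.split)

lemma over_vU: "field_set K \<Longrightarrow> over K vU"
  by (auto simp: over_def vU_def coeff_pCons one_pCons field_set_0 field_setD split: nat.split)

lemma over_DI:
  assumes K: "field_set K" and "d 0 = 0" "\<And>a. a \<in> K \<Longrightarrow> d a \<in> K" "t \<in> K" "over K P"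
  shows "over K (DI d t P)"
  using assms unfolding over_def DI_def coeff_add cf_D0 cf_dC[where d = d, OF assms(2)] cf_const_mult cf_dU
  by (auto intro!: field_setD[OF K] field_set_0 field_set_numeral field_set_of_nat simp del: of_nat_Suc)

text \<open>The field \<open>E(a)\<close>, obtained by adjoining \<open>a\<close> to the identity
  map of \<open>E\<close>, so that the lemmas on \<open>pext\<close> apply.\<close>

definition fext :: "'a::field_char_0 set \<Rightarrow> 'a \<Rightarrow> 'a set" where
  "fext E a = Domain (pext (Id_on E) a a)"

lemma prel_Id_on_iff: "prel (Id_on E) p q \<longleftrightarrow> p = q \<and> (\<forall>i. coeff p i \<in> E)"
proof
  assume *: "prel (Id_on E) p q"
  then have "coeff p i = coeff q i" for i unfolding prel_def Id_on_iff by blast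
  then have "p = q" by (intro poly_eqI)
  then show "p = q \<and> (\<forall>i. coeff p i \<in> E)" using * by (auto simp: prel_def)
qed (auto simp: prel_def)

lemma padj_Id_prehom:
  assumes "field_set E" shows "prehom (padj (Id_on E) a a)"
proof (rule prehom_fieldI)
  show "pring (padj (Id_on E) a a)" by (intro padj_pring phom_pring Id_on_phom assms)
  fix x y assume "(x, y) \<in> padj (Id_on E) a a"
  then obtain p q where pq: "x = poly p a" "y = poly q a" "prel (Id_on E) p q" by (auto simp: padj_def)
  then have "p = q" by (simp add: prel_Id_on_iff)
  then show "x = 0 \<longleftrightarrow> y = 0" using pq by simp
qed

lemma Id_on_pfield: "field_set E \<Longrightarrow> pfield (Id_on E)"
  by (intro phom_pfield Id_on_phom)

lemma pext_Id: 
  assumes "field_set E" shows "pext (Id_on E) a a \<subseteq> Id"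
proof -
  have "field_set (UNIV :: 'a set)" by (simp add: field_set_def)
  then have "pext (Id_on E) a a \<subseteq> Id_on UNIV"
    by (intro pext_least padj_Id_prehom assms Id_on_pfield) auto
  then show ?thesis by auto
qed

lemma pext_Id_on: "field_set E \<Longrightarrow> pext (Id_on E) a a = Id_on (fext E a)"
  using pext_Id[of E a] unfolding fext_def by auto

lemma fext_field: "field_set E \<Longrightarrow> field_set (fext E a)"
  unfolding fext_def by (intro field_set_Domain pext_phom padj_Id_prehom)

lemma fext_subset: "field_set E \<Longrightarrow> E \<subseteq> fext E a"
  using pext_subset[OF phom_pring[OF Id_on_phom], of E a a] unfolding fext_def by blast

lemma fext_mem: "field_set E \<Longrightarrow> a \<in> fext E a"
  using pext_mem[OF phom_pring[OF Id_on_phom], of E a a] unfolding fext_def by blast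

lemma fext_least:
  assumes "field_set E" "field_set Z" "E \<subseteq> Z" "a \<in> Z" shows "fext E a \<subseteq> Z"
proof -
  have "pext (Id_on E) a a \<subseteq> Id_on Z"
    using assms by (intro pext_least padj_Id_prehom Id_on_pfield) auto
  then show ?thesis unfolding fext_def by auto
qed

lemma fext_elem:
  assumes "field_set E" "z \<in> fext E a"
  obtains p q where "\<And>i. coeff p i \<in> E" "\<And>i. coeff q i \<in> E" "poly q a \<noteq> 0" "z = poly p a / poly q a"
proof -
  obtain p q p' q' where "prel (Id_on E) p p'" "prel (Id_on E) q q'" "poly q a \<noteq> 0" "z = poly p a / poly q a"
    using assms(2) unfolding fext_def pext_def pfrac_def padj_def by auto
  then show ?thesis using that[of p q] by (auto simp: prel_def)
qed

lemma common_denominator: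
  assumes R: "prehom R" and pq: "prel (pfrac R) p q"
  shows "\<exists>s s'. (s, s') \<in> R \<and> s \<noteq> 0 \<and> prel R (smult s p) (smult s' q)"
proof -
  note r = prehom_pring[OF R]
  have "\<exists>s s'. (s, s') \<in> R \<and> s \<noteq> 0 \<and> (\<forall>i<n. (s * coeff p i, s' * coeff q i) \<in> R)" for n
  proof (induction n)
    case 0
    show ?case using pring_1[OF r] by (intro exI[of _ 1]) auto
  next
    case (Suc n)
    then obtain s s' where s: "(s, s') \<in> R" "s \<noteq> 0" "\<And>i. i < n \<Longrightarrow> (s * coeff p i, s' * coeff q i) \<in> R" by blast
    have "(coeff p n, coeff q n) \<in> pfrac R" using pq by (simp add: prel_def)
    then obtain a a' b b' where ab: "coeff p n = a / b" "(a, a') \<in> R" "(b, b') \<in> R" "b \<noteq> 0" "b' * coeff q n = a'"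
      unfolding pfrac_def by blast
    have "((b * s) * coeff p i, (b' * s') * coeff q i) \<in> R" if "i < Suc n" for i
    proof (cases "i < n")
      case True
      have "(b * (s * coeff p i), b' * (s' * coeff q i)) \<in> R" by (intro pring_mult r ab s True)
      then show ?thesis by (simp add: mult.assoc)
    next
      case False
      then have "i = n" using that by simp
      have "(s * a, s' * a') \<in> R" by (intro pring_mult r ab s)
      moreover have "(b * s) * coeff p n = s * a" using ab(1,4) by simp
      moreover have "(b' * s') * coeff q n = s' * (b' * coeff q n)" by (simp only: ac_simps)
      then have "(b' * s') * coeff q n = s' * a'" by (simp only: ab(5))
      ultimately show ?thesis unfolding \<open>i = n\<close> by (simp only:)
    qed
    then show ?case using ab(3,4) s(1,2) r by (intro exI[of _ "b * s"] exI[of _ "b' * s'"]) (auto intro: pring_mult)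
  qed
  then obtain s s' where s: "(s, s') \<in> R" "s \<noteq> 0"
    "\<And>i. i < Suc (max (degree p) (degree q)) \<Longrightarrow> (s * coeff p i, s' * coeff q i) \<in> R" by blast
  have "(s * coeff p i, s' * coeff q i) \<in> R" for i
  proof (cases "i < Suc (max (degree p) (degree q))")
    case False
    then show ?thesis using pring_0[OF r] by (simp add: coeff_eq_0)
  qed (rule s(3))
  then show ?thesis using s by (intro exI[of _ s] exI[of _ s']) (auto simp: prel_def)
qed

lemma prel_padj_lift:
  assumes G: "pring G" and pq: "prel (padj G a b) p q"
  shows "\<exists>P P'. (\<forall>j. prel G (coeff P j) (coeff P' j)) \<and> (\<forall>z. eval2 P a z = poly p z) \<and>
    (\<forall>z. eval2 P' b z = poly q z)"
proof -
  define n where "n = max (degree p) (degree q)"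
  have "\<forall>j. \<exists>f g. prel G f g \<and> coeff p j = poly f a \<and> coeff q j = poly g b"
    using pq unfolding prel_def padj_def by blast
  then obtain f g where fg: "\<And>j. prel G (f j) (g j)" "\<And>j. coeff p j = poly (f j) a" "\<And>j. coeff q j = poly (g j) b"
    by metis
  have "prel G (coeff (\<Sum>j\<le>n. monom (f j) j) i) (coeff (\<Sum>j\<le>n. monom (g j) j) i)" for i
    unfolding coeff_sum by (intro prel_sum G) (auto simp: fg prel_0[OF G])
  moreover have "eval2 (\<Sum>j\<le>n. monom (f j) j) a z = poly p z" for z
    unfolding eval2_sum eval2_monom fg(2)[symmetric] poly_altdef[of p] n_def
    by (rule sum.mono_neutral_right) (auto simp: coeff_eq_0)
  moreover have "eval2 (\<Sum>j\<le>n. monom (g j) j) b z = poly q z" for z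
    unfolding eval2_sum eval2_monom fg(3)[symmetric] poly_altdef[of q] n_def
    by (rule sum.mono_neutral_right) (auto simp: coeff_eq_0)
  ultimately show ?thesis by blast
qed

text \<open>Denominators are cleared on both sides of the graph at once, with corresponding factors
  \<open>s\<close> and \<open>s'\<close>. This reduces relations over an extended field to bivariate
  polynomials over the base.\<close>

lemma prel_pext_clear:
  assumes G: "pring G" "prehom (padj G a b)" and pq: "prel (pext G a b) p q"
  shows "\<exists>s s' P P'. (s, s') \<in> padj G a b \<and> s \<noteq> 0 \<and> (\<forall>j. prel G (coeff P j) (coeff P' j)) \<and>
    (\<forall>z. eval2 P a z = s * poly p z) \<and> (\<forall>z. eval2 P' b z = s' * poly q z)"
proof -
  obtain s s' where s: "(s, s') \<in> padj G a b" "s \<noteq> 0" "prel (padj G a b) (smult s p) (smult s' q)"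
    using common_denominator[OF G(2)] pq unfolding pext_def by blast
  then show ?thesis using prel_padj_lift[OF G(1) s(3)] by auto
qed

lemma fext_poly_clear:
  assumes E: "field_set E" and p: "\<And>i. coeff p i \<in> fext E a"
  shows "\<exists>f P. (\<forall>i. coeff f i \<in> E) \<and> poly f a \<noteq> 0 \<and> over E P \<and>
    (\<forall>z. eval2 P a z = poly f a * poly p z)"
proof -
  have "prel (pext (Id_on E) a a) p p" using p by (auto simp: prel_def pext_Id_on[OF E])
  then obtain s s' P P' where s: "(s, s') \<in> padj (Id_on E) a a" "s \<noteq> 0"
    "\<forall>j. prel (Id_on E) (coeff P j) (coeff P' j)" "\<forall>z. eval2 P a z = s * poly p z"
    using prel_pext_clear[OF phom_pring[OF Id_on_phom[OF E]] padj_Id_prehom[OF E]] by metis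
  obtain f f' where f: "s = poly f a" "prel (Id_on E) f f'" using s(1) unfolding padj_def by blast
  have "over E P" using s(3) unfolding over_def prel_Id_on_iff by blast
  then show ?thesis
    using s f by (intro exI[of _ f] exI[of _ P]) (auto simp: prel_Id_on_iff)
qed

text \<open>
  The first Painleve equation has no solution of lower order: reducing \<open>DI P\<close> modulo a polynomial
  relation \<open>P\<close> of minimal degree would produce a Darboux polynomial.
\<close>

lemma PI_independent:
  fixes d :: "'a::field_char_0 \<Rightarrow> 'a"
  assumes K: "field_set K" and d: "derivation d" "\<And>a. a \<in> K \<Longrightarrow> d a \<in> K" and t: "t \<in> K" "d t = 1"
    and x: "\<not> alg K x" and u: "d x = u" "d u = 6 * x ^ 2 + t"
    and P: "over K P" "P \<noteq> 0"
  shows "eval2 P x u \<noteq> 0"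
proof
  assume P0: "eval2 P x u = 0"
  let ?S = "\<lambda>P. over K P \<and> P \<noteq> 0 \<and> eval2 P x u = 0"
  define M where "M = arg_min degree ?S"
  have M: "over K M" "M \<noteq> 0" "eval2 M x u = 0" and min: "\<And>Q. ?S Q \<Longrightarrow> degree M \<le> degree Q"
    unfolding M_def using arg_min_natI[of ?S P degree] arg_min_nat_le[of ?S _ degree] P P0 by blast+
  define n where "n = degree M"
  have n0: "n > 0"
  proof (rule ccontr)
    assume "\<not> n > 0"
    then obtain p where p: "M = [:p:]" unfolding n_def using degree_eq_zeroE by blast
    have "coeff p i \<in> K" for i using M(1) p unfolding over_def by (metis coeff_pCons_0)
    then have "alg K x" using M p unfolding alg_def by auto
    then show False using x by simp
  qed
  define D where "D = DI d t M"
  define m where "m = coeff M n"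
  have m0: "m \<noteq> 0" using M(2) by (simp add: m_def n_def)
  \<comment> \<open>\<open>D\<close> has degree at most \<open>n + 1\<close> in \<open>vU\<close>.
    Two steps of pseudo-division by \<open>M\<close>, whose leading coefficient is \<open>m\<close>,
    produce the multiplier \<open>m^2\<close> and the quotient \<open>m a vU + w\<close>.\<close>
  define a where "a = coeff D (Suc n)"
  define w where "w = m * coeff D n - a * coeff M (n - 1)"
  define R where "R = [:m ^ 2:] * D - ([:m * a:] * vU + [:w:]) * M"
  have cD: "coeff D j = 0" if "j > Suc n" for j
  proof (rule poly_eqI)
    fix i
    have "coeff M (j - 1) = 0" "coeff M j = 0" "coeff M (Suc j) = 0"
      using that by (auto intro!: coeff_eq_0 simp: n_def)
    then show "coeff (coeff D j) i = coeff 0 i"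
      using d(1) unfolding D_def DI_def coeff_add cf_D0 cf_const_mult cf_dU by (simp add: cf_dC)
  qed
  have KD: "over K D" unfolding D_def using K d t M(1) by (intro over_DI) auto
  have KR: "over K R"
  proof -
    have c: "coeff (coeff Q j) i \<in> K" if "over K Q" for Q j i using that by (simp add: over_def)
    have Kp: "\<And>i. coeff (p * q) i \<in> K" if "\<And>i. coeff p i \<in> K" "\<And>i. coeff q i \<in> K" for p q
      using that by (auto simp: coeff_mult intro!: field_set_sum[OF K] field_setD[OF K])
    show ?thesis unfolding R_def w_def power2_eq_square
      using c[OF KD] c[OF M(1)] KD M(1) K
      by (intro over_diff over_mult over_add over_const over_vU Kp)
         (auto simp: m_def a_def intro!: field_setD[OF K] Kp)
  qed
  have R0: "eval2 R x u = 0"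
    unfolding R_def using M(3) eval2_DI[OF d(1) u, of M] d(1) by (simp add: D_def)
  have cR: "coeff R j = 0" if "j \<ge> n" for j
  proof -
    have e: "coeff R j = m ^ 2 * coeff D j - (m * a * (if j = 0 then 0 else coeff M (j - 1)) + w * coeff M j)" for j
      unfolding R_def by (auto simp: vU_def algebra_simps coeff_pCons split: nat.split)
    consider "j = n" | "j = Suc n" | "j > Suc n" using \<open>j \<ge> n\<close> by linarith
    then show ?thesis
    proof cases
      case 1
      then show ?thesis using n0 unfolding e w_def by (simp add: m_def power2_eq_square algebra_simps)
    next
      case 2
      have "coeff M (Suc n) = 0" by (intro coeff_eq_0) (simp add: n_def)
      then show ?thesis unfolding e 2 by (simp add: m_def a_def power2_eq_square)
    next
      case 3
      then have "coeff M (j - 1) = 0" "coeff M j = 0" by (auto intro!: coeff_eq_0 simp: n_def)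
      then show ?thesis unfolding e using cD[OF 3] by simp
    qed
  qed
  \<comment> \<open>The remainder is a relation of smaller degree, so minimality of \<open>M\<close>
    kills it: \<open>M\<close> is a Darboux polynomial up to the factor \<open>m^2\<close>, which
    involves \<open>x\<close> alone.\<close>
  have "R = 0"
  proof (rule ccontr)
    assume "R \<noteq> 0"
    then have "degree R < n" using cR by (metis leading_coeff_0_iff not_less)
    then show False using min[of R] KR R0 \<open>R \<noteq> 0\<close> by (auto simp: n_def)
  qed
  then have eq: "[:m ^ 2:] * DI d t M = ([:m * a:] * vU + [:w:]) * M"
    unfolding R_def D_def by (simp only: right_minus_eq)
  have "degree M = 0" by (rule darboux_degree[OF M(2) d(1) t(2) _ eq]) (use m0 in simp)
  then show False using n0 by (simp add: n_def)
qed

lemma fext2_elem: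
  assumes K: "field_set K" and z: "z \<in> fext (fext K x) u"
  obtains A B where "over K A" "over K B" "eval2 B x u \<noteq> 0" "z = eval2 A x u / eval2 B x u"
proof -
  note Kx = fext_field[OF K, of x]
  obtain p q where pq: "\<And>i. coeff p i \<in> fext K x" "\<And>i. coeff q i \<in> fext K x" "poly q u \<noteq> 0" "z = poly p u / poly q u"
    using fext_elem[OF Kx z] by metis
  obtain r A where A: "\<And>i. coeff r i \<in> K" "poly r x \<noteq> 0" "over K A" "\<And>z. eval2 A x z = poly r x * poly p z"
    using fext_poly_clear[OF K pq(1)] by metis
  obtain s B where B: "\<And>i. coeff s i \<in> K" "poly s x \<noteq> 0" "over K B" "\<And>z. eval2 B x z = poly s x * poly q z"
    using fext_poly_clear[OF K pq(2)] by metis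
  show ?thesis
  proof
    show "over K ([:s:] * A)" "over K ([:r:] * B)" by (intro over_mult over_const K A B)+
    show "eval2 ([:r:] * B) x u \<noteq> 0" "z = eval2 ([:s:] * A) x u / eval2 ([:r:] * B) x u"
      unfolding eval2_simps A(4) B(4) pq(4) using A(2) B(2) pq(3) by simp_all
  qed
qed

text \<open>For \<open>z = A / B\<close> with derivative 0, independence of \<open>x\<close> and
  \<open>u\<close> gives an identity between polynomials, and \<open>A\<close> is a scalar multiple
  of \<open>B\<close>. The scalar is a quotient of coefficients, hence in \<open>K\<close>.\<close>

lemma fext2_constants:
  fixes d :: "'a::field_char_0 \<Rightarrow> 'a"
  assumes K: "field_set K" and d: "derivation d" "\<And>a. a \<in> K \<Longrightarrow> d a \<in> K" and t: "t \<in> K" "d t = 1"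
    and x: "\<not> alg K x" and u: "d x = u" "d u = 6 * x ^ 2 + t"
    and z: "z \<in> fext (fext K x) u" "d z = 0"
  shows "z \<in> K"
proof -
  obtain A B where AB: "over K A" "over K B" "eval2 B x u \<noteq> 0" "z = eval2 A x u / eval2 B x u"
    using fext2_elem[OF K z(1)] by metis
  have zB: "z * eval2 B x u = eval2 A x u" using AB by simp
  have B0: "B \<noteq> 0" using AB by auto
  have "d (z * eval2 B x u) = z * eval2 (DI d t B) x u"
    using z(2) by (simp add: derivation_mult[OF d(1)] eval2_DI[OF d(1) u])
  then have "z * eval2 (DI d t B) x u = eval2 (DI d t A) x u"
    unfolding zB eval2_DI[OF d(1) u] by simp
  then have "eval2 (DI d t A * B - A * DI d t B) x u = 0"
    by (simp add: algebra_simps flip: zB)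
  moreover have "over K (DI d t A * B - A * DI d t B)"
    using K d t AB by (intro over_diff over_mult over_DI) auto
  ultimately have "DI d t A * B = A * DI d t B"
    using PI_independent[OF K d t x u] by (metis right_minus_eq)
  then obtain l where l: "A = [:[:l:]:] * B" using DI_constant_ratio[OF B0 d(1) t(2)] by blast
  have "eval2 A x u = l * eval2 B x u" unfolding l by simp
  then have zl: "z = l" using AB by simp
  obtain j i where ji: "cf B j i \<noteq> 0" using B0 by (metis cf_eqI coeff_0)
  have "l = cf A j i / cf B j i" using ji unfolding l cf_const_mult by simp
  then show ?thesis using AB(1,2) field_setD(7)[OF K] unfolding zl over_def by metis
qed

lemma PI_not_alg:
  fixes d :: "'a::field_char_0 \<Rightarrow> 'a"
  assumes K: "field_set K" and d: "derivation d" "\<And>a. a \<in> K \<Longrightarrow> d a \<in> K" and t: "t \<in> K" "d t = 1"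
    and x: "\<not> alg K x" and u: "d x = u" "d u = 6 * x ^ 2 + t"
  shows "\<not> alg (fext K x) u"
proof
  assume "alg (fext K x) u"
  then obtain p where p: "p \<noteq> 0" "\<And>i. coeff p i \<in> fext K x" "poly p u = 0" by (auto simp: alg_def)
  obtain f P where P: "poly f x \<noteq> 0" "over K P" "\<And>z. eval2 P x z = poly f x * poly p z"
    using fext_poly_clear[OF K p(2)] by metis
  have "P \<noteq> 0"
  proof
    assume "P = 0"
    then have "poly p z = 0" for z using P(1) P(3)[of z] by auto
    then show False using p(1) poly_all_0_iff_0 by blast
  qed
  then show False using PI_independent[OF K d t x u P(2)] P(3) p(3) by simp
qed

text \<open>The partial derivatives with respect to \<open>x\<close> and \<open>u\<close>, extended
  to the whole field.\<close>

lemma coordinate_derivations: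
  fixes K :: "'a::field_char_0 set"
  assumes K: "field_set K" and x: "\<not> alg K x" and u: "\<not> alg (fext K x) u"
  obtains P Q where "derivation P" "derivation Q" "\<And>a. a \<in> K \<Longrightarrow> P a = 0" "\<And>a. a \<in> K \<Longrightarrow> Q a = 0"
    "P x = 1" "P u = 0" "Q x = 0" "Q u = 1"
proof -
  obtain P0 where P0: "derivation P0" "\<forall>a\<in>K. P0 a = 0" "P0 x = 1" using derivation_ex[OF K x] by blast
  obtain Q where Q: "derivation Q" "\<forall>a\<in>fext K x. Q a = 0" "Q u = 1"
    using derivation_ex[OF fext_field[OF K] u] by blast
  have QK: "Q a = 0" if "a \<in> K" for a using Q(2) fext_subset[OF K] that by blast
  have Qx: "Q x = 0" using Q(2) fext_mem[OF K] by blast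
  \<comment> \<open>\<open>P0\<close> may take any value at \<open>u\<close>. Subtracting
    \<open>P0 u\<close> times \<open>Q\<close> makes it 0 without changing the values on
    \<open>K\<close> and at \<open>x\<close>.\<close>
  have "derivation (\<lambda>z. 1 * P0 z + (- P0 u) * Q z)" by (rule derivation_lincomb[OF P0(1) Q(1)])
  then show ?thesis by (rule that[OF _ Q(1)]) (use P0 Q QK Qx in auto)
qed

lemma fext2_stable:
  assumes K: "field_set K" and e: "derivation e" "\<And>a. a \<in> K \<Longrightarrow> e a \<in> fext (fext K x) u"
    "e x \<in> fext (fext K x) u" "e u \<in> fext (fext K x) u" and z: "z \<in> fext (fext K x) u"
  shows "e z \<in> fext (fext K x) u"
proof -
  define F where "F = fext (fext K x) u"
  note Kx = fext_field[OF K, of x]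
  have F: "field_set F" unfolding F_def by (rule fext_field[OF Kx])
  let ?Z = "{(a, b). (a, b) \<in> Id_on F \<and> (e a, e b) \<in> Id_on F}"
  have "pfield ?Z" by (rule pfield_derivation[OF Id_on_phom[OF F] e(1) e(1)])
  moreover from this have "prehom ?Z" by (intro prehom_fieldI pfield_pring) auto
  ultimately have "field_set (Domain ?Z)" by (intro field_set_Domain) (simp add: phom_def)
  moreover have "Domain ?Z = {a \<in> F. e a \<in> F}" by auto
  moreover have "K \<subseteq> F" "x \<in> F" "u \<in> F"
    unfolding F_def using fext_subset[OF K] fext_subset[OF Kx] fext_mem[OF K] fext_mem[OF Kx] by blast+
  ultimately have "F \<subseteq> {a \<in> F. e a \<in> F}"
    using e unfolding F_def[symmetric] by (subst F_def, intro fext_least Kx K) auto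
  then show ?thesis using z unfolding F_def by blast
qed

text \<open>
  The flows of both equations preserve the area forms \<open>dx \<and> du\<close> and \<open>dy \<and> dv\<close>, so the Jacobian
  determinant of an algebraic correspondence is a constant.
\<close>

lemma jacobian_algebraic:
  fixes d :: "'a::field_char_0 \<Rightarrow> 'a"
  assumes K: "field_set K" and d: "derivation d" "\<And>a. a \<in> K \<Longrightarrow> d a \<in> K" and t: "t \<in> K" "d t = 1"
    and x: "\<not> alg K x" and u: "d x = u" "d u = 6 * x ^ 2 + t"
    and y: "alg (fext (fext K x) u) y" and v: "d y = v" "d v = 2 * y ^ 3 + t * y + c" and c: "c \<in> K"
    and P: "derivation P" "\<And>a. a \<in> K \<Longrightarrow> P a = 0" "P x = 1" "P u = 0"
    and Q: "derivation Q" "\<And>a. a \<in> K \<Longrightarrow> Q a = 0" "Q x = 0" "Q u = 1"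
  shows "alg K (P y * Q v - Q y * P v)"
proof -
  define F where "F = fext (fext K x) u"
  define J where "J = P y * Q v - Q y * P v"
  note Kx = fext_field[OF K, of x]
  have F: "field_set F" unfolding F_def by (rule fext_field[OF Kx])
  have KF: "K \<subseteq> F" "x \<in> F" "u \<in> F"
    unfolding F_def using fext_subset[OF K] fext_subset[OF Kx] fext_mem[OF K] fext_mem[OF Kx] by blast+
  have Fleast: "F \<subseteq> Z" if "field_set Z" "K \<subseteq> Z" "x \<in> Z" "u \<in> Z" for Z
    unfolding F_def by (intro fext_least Kx K that)
  note stable = fext2_stable[OF K, of _ x u, folded F_def]
  have dF: "d z \<in> F" if "z \<in> F" for z
  proof (rule stable[OF d(1) _ _ _ that])
    show "d a \<in> F" if "a \<in> K" for a using d(2) KF(1) that by blast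
    show "d x \<in> F" "d u \<in> F"
      unfolding u using KF t by (auto intro!: field_setD(1,2,8)[OF F] field_set_numeral[OF F])
  qed
  have PF: "P z \<in> F" if "z \<in> F" for z
    by (rule stable[OF P(1) _ _ _ that]) (use P field_set_0[OF F] field_setD(5)[OF F] in auto)
  have QF: "Q z \<in> F" if "z \<in> F" for z
    by (rule stable[OF Q(1) _ _ _ that]) (use Q field_set_0[OF F] field_setD(5)[OF F] in auto)
  have yF: "alg F y" using y by (simp add: F_def)
  have vF: "alg F v" using alg_derivation[OF F d(1) dF yF] v by simp
  have vanish: "e z = 0" if "derivation e" "\<And>a. a \<in> K \<Longrightarrow> e a = 0" "e x = 0" "e u = 0" "alg F z" for e z
  proof (rule derivation_alg[OF that(1) F _ that(5)])
    have "F \<subseteq> {a. e a = 0}" using that by (intro Fleast field_set_kernel) auto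
    then show "e a = 0" if "a \<in> F" for a using that by blast
  qed
  have d0: "P (d a) = 0" "Q (d a) = 0" "d (P a) = 0" "d (Q a) = 0" if "a \<in> K" for a
    using P Q d that by auto
  have dd: "P t = 0" "Q t = 0" "P c = 0" "Q c = 0" using P Q t c by auto
  \<comment> \<open>The commutator and \<open>12 x Q\<close> are derivations that agree on
    \<open>K\<close>, \<open>x\<close> and \<open>u\<close>, hence on everything algebraic over
    \<open>F\<close>. The factor is the derivative of \<open>6 x^2 + t\<close> in \<open>x\<close>;
    the next commutator is found in the same way.\<close>
  have cP: "P (d z) - d (P z) = 12 * x * Q z" if "alg F z" for z
  proof -
    have "derivation (\<lambda>z. 1 * (P (d z) - d (P z)) + (- 12 * x) * Q z)"
      by (intro derivation_lincomb derivation_commutator P Q d)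
    then have "1 * (P (d z) - d (P z)) + (- 12 * x) * Q z = 0"
      by (rule vanish[OF _ _ _ _ that])
         (use P Q d d0 dd u in \<open>auto simp: derivation_add derivation_mult derivation_square\<close>)
    then show ?thesis by simp
  qed
  have cQ: "Q (d z) - d (Q z) = P z" if "alg F z" for z
  proof -
    have "derivation (\<lambda>z. 1 * (Q (d z) - d (Q z)) + (- 1) * P z)"
      by (intro derivation_lincomb derivation_commutator P Q d)
    then have "1 * (Q (d z) - d (Q z)) + (- 1) * P z = 0"
      by (rule vanish[OF _ _ _ _ that])
         (use P Q d d0 dd u in \<open>auto simp: derivation_add derivation_mult derivation_square\<close>)
    then show ?thesis by simp
  qed
  have e: "P (d v) = (6 * y ^ 2 + t) * P y" "Q (d v) = (6 * y ^ 2 + t) * Q y"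
    unfolding v using P(1) Q(1) dd
    by (simp_all add: derivation_add derivation_mult derivation_cube algebra_simps)
  have 1: "d (P y) = P v - 12 * x * Q y" "d (Q y) = Q v - P y"
    using cP[OF yF] cQ[OF yF] v by (simp_all add: algebra_simps)
  have 2: "d (P v) = (6 * y ^ 2 + t) * P y - 12 * x * Q v" "d (Q v) = (6 * y ^ 2 + t) * Q y - P v"
    using cP[OF vF] cQ[OF vF] e by (simp_all add: algebra_simps)
  \<comment> \<open>The factors \<open>6 y^2 + t\<close> and \<open>12 x\<close> enter symmetrically
    and cancel, since neither equation has a first-order term.\<close>
  have dJ: "d J = 0"
    unfolding J_def derivation_diff[OF d(1)] derivation_mult[OF d(1)] 1 2 by (simp add: algebra_simps)
  have JF: "alg F J"
    unfolding alg_iff_derivation[OF F]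
  proof (intro allI impI)
    fix e assume e: "derivation e" "\<forall>a\<in>F. e a = 0"
    have ev: "e w = 0" if "alg F w" for w using derivation_alg[OF e(1) F _ that] e(2) by blast
    have "e (P y) = 0" "e (Q v) = 0" "e (Q y) = 0" "e (P v) = 0"
      by (intro ev alg_derivation[OF F P(1) PF] alg_derivation[OF F Q(1) QF] yF vF; assumption)+
    then show "e J = 0" unfolding J_def by (simp add: derivation_diff[OF e(1)] derivation_mult[OF e(1)])
  qed
  obtain p where p: "p \<noteq> 0" "\<And>i. coeff p i \<in> F" "poly p J = 0"
    "\<And>q. (\<And>i. coeff q i \<in> F) \<Longrightarrow> q \<noteq> 0 \<Longrightarrow> degree q < degree p \<Longrightarrow> poly q J \<noteq> 0" "degree p > 0"
    using alg_min_poly[OF F JF] by metis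
  define q where "q = smult (inverse (lead_coeff p)) p"
  have q: "poly q J = 0" "\<And>i. coeff q i \<in> F" "lead_coeff q = 1" "degree q = degree p" "q \<noteq> 0"
    using p field_setD[OF F] by (auto simp: q_def)
  \<comment> \<open>As \<open>d J = 0\<close>, differentiating the coefficients of the monic minimal
    polynomial gives a relation of smaller degree, which must vanish. The coefficients are therefore
    constants of \<open>F\<close> and lie in \<open>K\<close>.\<close>
  have "poly (map_poly d q) J = 0"
    using derivation_poly[OF d(1), of q J] q(1) dJ d(1) by simp
  moreover have "coeff (map_poly d q) i \<in> F" for i using q(2) dF d(1) by (simp add: coeff_map_poly)
  moreover have "map_poly d q = 0 \<or> degree (map_poly d q) < degree p"
  proof -
    have "coeff (map_poly d q) i = 0" if "i \<ge> degree p" for i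
    proof (cases "i = degree p")
      case True
      then show ?thesis using q(3,4) d(1) by (simp add: coeff_map_poly)
    next
      case False
      then have "coeff q i = 0" using that q(4) by (intro coeff_eq_0) simp
      then show ?thesis using d(1) by (simp add: coeff_map_poly)
    qed
    then show ?thesis by (metis leading_coeff_0_iff not_less)
  qed
  ultimately have "map_poly d q = 0" using p(4) by blast
  then have "d (coeff q i) = 0" for i
    using d(1) by (metis coeff_map_poly coeff_0 derivation_0)
  then have "coeff q i \<in> K" for i
    using fext2_constants[OF K d t x u] q(2) unfolding F_def by blast
  then show ?thesis using q(1,5) unfolding alg_def J_def by blast
qed

section \<open>Puiseux series\<close>

text \<open>\<open>q\<close> is coprime to powers of \<open>X - b\<close> because
  \<open>q(b)\<close> is nonzero. The induction subtracts the multiple of \<open>q\<close> that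
  makes the cofactor vanish at \<open>b\<close>; the degree bound on \<open>u\<close> is what
  Hensel's lemma relies on.\<close>

lemma bezout_linear_power:
  fixes q :: "'a::field poly"
  assumes "poly q b \<noteq> 0"
  shows "\<exists>u v. h = [:- b, 1:] ^ m * v + q * u \<and> (u = 0 \<or> degree u < m)"
proof (induction m)
  case 0
  show ?case by (intro exI[of _ 0] exI[of _ h]) simp
next
  case (Suc m)
  then obtain u v where uv: "h = [:- b, 1:] ^ m * v + q * u" "u = 0 \<or> degree u < m" by blast
  define c where "c = poly v b / poly q b"
  have "poly (v - smult c q) b = 0" using assms by (simp add: c_def)
  then obtain w where w: "v - smult c q = [:- b, 1:] * w" unfolding poly_eq_0_iff_dvd dvd_def by blast
  have v: "v = [:- b, 1:] * w + smult c q" using w by (metis diff_add_cancel)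
  have "h = [:- b, 1:] ^ Suc m * w + q * (u + smult c ([:- b, 1:] ^ m))"
    unfolding uv(1) v by (simp only: power_Suc distrib_left distrib_right mult_smult_left mult_smult_right) (simp only: ac_simps)
  moreover have "degree (u + smult c ([:- b, 1:] ^ m)) < Suc m"
  proof -
    have "degree (smult c ([:- b, 1:] ^ m)) \<le> m"
      using degree_smult_le[of c "[:- b, 1:] ^ m"] by (simp add: degree_power_eq)
    moreover have "degree u \<le> m" using uv(2) by auto
    ultimately show ?thesis using degree_add_le by (metis le_imp_less_Suc)
  qed
  ultimately show ?case by blast
qed

text \<open>Pairs of coefficients, with respect to the series variable, of the two Hensel factors:
  \<open>z\<close> is the initial factorization, \<open>G\<close> lists the coefficients of the
  given polynomial, and \<open>S\<close> solves the linear equation for the next pair.\<close>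

function hensel_seq ::
  "('a::comm_ring_1 poly \<Rightarrow> 'a poly \<times> 'a poly) \<Rightarrow> (nat \<Rightarrow> 'a poly) \<Rightarrow> 'a poly \<times> 'a poly \<Rightarrow> nat \<Rightarrow> 'a poly \<times> 'a poly"
where
  "hensel_seq S G z k = (if k = 0 then z else
     S (G k - (\<Sum>i\<in>{1..<k}. fst (hensel_seq S G z i) * snd (hensel_seq S G z (k - i)))))"
  by pat_completeness auto
termination by (relation "measure (\<lambda>(S, G, z, k). k)") auto

declare hensel_seq.simps [simp del]

lemma poly_of_coeffs:
  assumes "\<And>k i. i > m \<Longrightarrow> coeff (A k) i = 0"
  shows "\<exists>P :: 'a::comm_ring_1 fps poly. \<forall>i k. coeff P i $ k = coeff (A k) i"
proof -
  define P where "P = (\<Sum>i\<le>m. monom (Abs_fps (\<lambda>k. coeff (A k) i)) i)"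
  have "coeff P i $ k = coeff (A k) i" for i k
    using assms[of i k] unfolding P_def coeff_sum coeff_monom by (cases "i \<le> m") auto
  then show ?thesis by blast
qed

text \<open>At each order \<open>k\<close> the equation \<open>p * B k + q * A k = R k\<close> with
  known \<open>R k\<close> is solved by the Bezout lemma with \<open>A k\<close> of degree below
  \<open>m\<close>, so that \<open>P\<close> stays monic of degree \<open>m\<close>.\<close>

lemma hensel:
  fixes G :: "'a::field fps poly" and g q :: "'a poly"
  assumes monic: "coeff G n = 1" "degree G = n"
    and red: "\<And>i. coeff G i $ 0 = coeff ([:- b, 1:] ^ m * q) i"
    and q: "poly q b \<noteq> 0"
  shows "\<exists>P Q. G = P * Q \<and> degree P = m \<and> coeff P m = 1"
proof -
  define p where "p = [:- b, 1:] ^ m"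
  have p: "degree p = m" "coeff p m = 1" "p \<noteq> 0"
    unfolding p_def by (simp_all add: degree_power_eq coeff_linear_power)
  have "\<forall>h. \<exists>uv. h = p * snd uv + q * fst uv \<and> (fst uv = 0 \<or> degree (fst uv) < m)"
    using bezout_linear_power[OF q] unfolding p_def by (metis fst_conv snd_conv)
  then obtain S where S: "\<And>h. h = p * snd (S h) + q * fst (S h)" "\<And>h. fst (S h) = 0 \<or> degree (fst (S h)) < m"
    by metis
  obtain Gk where Gk: "\<And>k i. coeff (Gk k) i = coeff G i $ k"
  proof -
    have "\<exists>g. \<forall>i. coeff g i = coeff G i $ k" for k
    proof (intro exI allI)
      fix i show "coeff (\<Sum>j\<le>n. monom (coeff G j $ k) j) i = coeff G i $ k"
        using monic coeff_eq_0[of G i] by (cases "i \<le> n") (auto simp: coeff_sum)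
    qed
    then show ?thesis using that by metis
  qed
  have q0: "q \<noteq> 0" using q by auto
  have pq: "p * q = Gk 0" using red Gk by (intro poly_eqI) (simp add: p_def)
  have dq: "m + degree q = n"
  proof -
    have "coeff (p * q) n = 1" using red[of n] monic by (simp add: p_def)
    then have "n \<le> degree (p * q)" by (intro le_degree) simp
    moreover have "degree (p * q) \<le> n"
      using pq Gk monic by (intro degree_le) (simp add: coeff_eq_0)
    ultimately show ?thesis using p q0 by (simp add: degree_mult_eq)
  qed
  define T where "T k = hensel_seq S Gk (p, q) k" for k
  define A B where "A k = fst (T k)" and "B k = snd (T k)" for k
  have AB0: "A 0 = p" "B 0 = q" by (simp_all add: A_def B_def T_def hensel_seq.simps)
  define R where "R k = Gk k - (\<Sum>i\<in>{1..<k}. A i * B (k - i))" for k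
  have ABk: "A k = fst (S (R k))" "B k = snd (S (R k))" if "k > 0" for k
    using that unfolding A_def B_def R_def T_def by (simp_all add: hensel_seq.simps[of _ _ _ k])
  have degA: "A k = 0 \<or> degree (A k) < m" if "k > 0" for k using S(2) ABk[OF that] by simp
  have cA: "coeff (A k) i = 0" if "i \<ge> m" "k > 0" for k i using degA[OF that(2)] that(1) coeff_eq_0 by force
  \<comment> \<open>In \<open>p * B k = R k - q * A k\<close> the right side has degree below
    \<open>n\<close>, which bounds the degree of \<open>B k\<close>. A bound uniform in
    \<open>k\<close> is needed to assemble the \<open>B k\<close> into one polynomial.\<close>
  have degB: "coeff (B k) i = 0" if "i \<ge> degree q" "k > 0" for k i
    using that
  proof (induction k arbitrary: i rule: less_induct)
    case (less k)
    have cR: "coeff (R k) j = 0" if j: "j \<ge> n" for j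
    proof -
      have "coeff (Gk k) j = 0"
        using j monic less.prems coeff_eq_0[of G j] by (cases "j = n") (auto simp: Gk)
      moreover have "coeff (A i * B (k - i)) j = 0" if i: "i \<in> {1..<k}" for i
        unfolding coeff_mult
      proof (rule sum.neutral, rule ballI)
        fix l assume "l \<in> {..j}"
        show "coeff (A i) l * coeff (B (k - i)) (j - l) = 0"
        proof (cases "l \<ge> m")
          case True
          then show ?thesis using cA[of l i] i by simp
        next
          case False
          then have "j - l \<ge> degree q" using j dq by simp
          then show ?thesis using less.IH[of "k - i" "j - l"] i by simp
        qed
      qed
      ultimately show ?thesis unfolding R_def by (simp add: coeff_sum)
    qed
    have "R k = p * B k + q * A k" using S(1)[of "R k"] less.prems(2) by (simp only: ABk)
    then have e: "p * B k = R k - q * A k" by simp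
    have "coeff (p * B k) j = 0" if j: "j \<ge> n" for j
    proof -
      have "coeff (q * A k) j = 0"
        unfolding coeff_mult
      proof (rule sum.neutral, rule ballI)
        fix l assume "l \<in> {..j}"
        show "coeff q l * coeff (A k) (j - l) = 0"
          using cA[of "j - l" k] less.prems coeff_eq_0[of q l] j dq by (cases "l > degree q") auto
      qed
      then show ?thesis using cR[OF j] unfolding e by simp
    qed
    then have "degree (p * B k) < n \<or> B k = 0"
      using p(3) by (metis leading_coeff_0_iff mult_eq_0_iff not_less)
    then have "B k = 0 \<or> degree (B k) < degree q"
      using p dq by (cases "B k = 0") (auto simp: degree_mult_eq)
    then show ?case using less.prems by (auto intro: coeff_eq_0)
  qed
  have conv: "(\<Sum>i\<le>k. A i * B (k - i)) = Gk k" for k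
  proof (cases "k = 0")
    case True
    then show ?thesis using AB0 pq by simp
  next
    case False
    have "{..k} = insert 0 (insert k {1..<k})" using False by auto
    then have "(\<Sum>i\<le>k. A i * B (k - i)) = A 0 * B k + (A k * B 0 + (\<Sum>i\<in>{1..<k}. A i * B (k - i)))"
      using False by simp
    also have "\<dots> = R k + (\<Sum>i\<in>{1..<k}. A i * B (k - i))"
    proof -
      have "0 < k" using False by simp
      then have "R k = p * B k + q * A k" using S(1)[of "R k"] by (simp only: ABk)
      then show ?thesis using AB0 by (simp add: mult.commute)
    qed
    also have "\<dots> = Gk k" by (simp add: R_def)
    finally show ?thesis .
  qed
  have "coeff (A k) i = 0" if "i > m" for k i
    using cA[of i k] that AB0 p coeff_eq_0[of p i] by (cases "k = 0") auto
  then obtain P where P: "\<And>i k. coeff P i $ k = coeff (A k) i" using poly_of_coeffs[of m A] by blast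
  have "coeff (B k) i = 0" if "i > degree q" for k i
    using degB[of i k] that AB0 coeff_eq_0[of q i] by (cases "k = 0") auto
  then obtain Q where Q: "\<And>i k. coeff Q i $ k = coeff (B k) i"
    using poly_of_coeffs[of "degree q" B] by blast
  have "G = P * Q"
  proof (rule poly_eqI, rule fps_ext)
    fix i k
    have "coeff (P * Q) i $ k = (\<Sum>j\<le>i. \<Sum>l\<le>k. coeff (A l) j * coeff (B (k - l)) (i - j))"
      unfolding coeff_mult fps_sum_nth fps_mult_nth P Q by (simp add: atLeast0AtMost)
    also have "\<dots> = (\<Sum>l\<le>k. \<Sum>j\<le>i. coeff (A l) j * coeff (B (k - l)) (i - j))" by (rule sum.swap)
    also have "\<dots> = coeff (\<Sum>l\<le>k. A l * B (k - l)) i" by (simp add: coeff_sum coeff_mult)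
    also have "\<dots> = coeff G i $ k" by (simp add: conv Gk)
    finally show "coeff G i $ k = coeff (P * Q) i $ k" by simp
  qed
  moreover have Pm: "coeff P m = 1"
  proof (rule fps_ext)
    fix k show "coeff P m $ k = 1 $ k" using AB0 p cA[of m k] by (cases "k = 0") (auto simp: P)
  qed
  moreover have "degree P = m"
  proof (rule antisym)
    show "degree P \<le> m"
    proof (rule degree_le, intro allI impI, rule fps_ext)
      fix i k assume "m < i"
      then show "coeff P i $ k = 0 $ k"
        using AB0 p cA[of i k] coeff_eq_0[of p i] by (cases "k = 0") (auto simp: P)
    qed
    show "m \<le> degree P" using Pm by (intro le_degree) simp
  qed
  ultimately show ?thesis by blast
qed

section \<open>Tschirnhaus shifts, ramification and the Newton-Puiseux theorem\<close>

lemma degree_map_poly_le: "f 0 = 0 \<Longrightarrow> degree (map_poly f p) \<le> degree p"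
  by (rule degree_le) (auto simp: coeff_map_poly coeff_eq_0)

lemma coeff_pcompose_top:
  fixes p :: "'a::comm_ring_1 poly"
  assumes "degree p \<le> n"
  shows "coeff (pcompose p [:c, 1:]) n = coeff p n"
  using assms
proof (induction p arbitrary: n)
  case (pCons a p)
  show ?case
  proof (cases "p = 0")
    case False
    then obtain k where k: "n = Suc k" "degree p \<le> k" using pCons.prems by (cases n) auto
    have "degree (pcompose p [:c, 1:]) \<le> degree p * degree [:c, 1:]" by (rule degree_pcompose_le)
    then have "coeff (pcompose p [:c, 1:]) (Suc k) = 0" using k by (intro coeff_eq_0) simp
    then show ?thesis using pCons.IH[OF k(2)] k(1) by (simp add: pcompose_pCons coeff_pCons)
  qed (auto simp: pcompose_pCons)
qed auto

text \<open>Choosing \<open>c\<close> well makes the second coefficient vanish (Tschirnhaus).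
  Applied to \<open>monom 1 n\<close>, the formula also gives the second coefficient of
  \<open>(X - b)^n\<close>.\<close>

lemma coeff_pcompose_subtop:
  fixes p :: "'a::comm_ring_1 poly"
  assumes "degree p \<le> Suc n"
  shows "coeff (pcompose p [:c, 1:]) n = coeff p n + of_nat (Suc n) * c * coeff p (Suc n)"
  using assms
proof (induction p arbitrary: n)
  case (pCons a p)
  have d: "degree p \<le> n" using pCons.prems by (cases "p = 0") auto
  note t = coeff_pcompose_top[OF d, of c]
  show ?case
  proof (cases n)
    case 0
    then show ?thesis using t by (simp add: pcompose_pCons)
  next
    case (Suc k)
    then show ?thesis using t pCons.IH[of k] d
      by (simp add: pcompose_pCons coeff_pCons algebra_simps)
  qed
qed auto

text \<open>The substitution of \<open>X^e\<close> for \<open>X\<close>. Puiseux series are not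
  formed as a type: exponents with denominator \<open>e\<close> are expressed by ramifying the given
  series instead.\<close>

definition cpow :: "nat \<Rightarrow> 'a::zero fls \<Rightarrow> 'a fls" where "cpow e f = fls_compose_power f e"

lemma cpow_simps [simp]:
  fixes f g :: "'a::field_char_0 fls"
  shows "cpow e (f + g) = cpow e f + cpow e g" "cpow e (f - g) = cpow e f - cpow e g"
    "cpow e (f * g) = cpow e f * cpow e g" "cpow e 0 = (0 :: 'a fls)"
    "e > 0 \<Longrightarrow> cpow e 1 = (1 :: 'a fls)" "e > 0 \<Longrightarrow> cpow e (fls_X_intpow n) = (fls_X_intpow (int e * n) :: 'a fls)"
  by (simp_all add: cpow_def)

lemma cpow_nth: "e > 0 \<Longrightarrow> cpow e f $$ n = (if int e dvd n then f $$ (n div int e) else 0)"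
  by (simp add: cpow_def fls_nth_compose_power)

lemma cpow_cpow:
  assumes "e > 0" "e' > 0"
  shows "cpow e (cpow e' f) = cpow (e * e') f"
proof (rule fls_eqI)
  fix n
  have "int e dvd n \<and> int e' dvd n div int e \<longleftrightarrow> int (e * e') dvd n"
    using assms by (auto simp: dvd_def)
  moreover have "n div int e div int e' = n div int (e * e')"
    using assms by (simp add: zdiv_zmult2_eq)
  ultimately show "cpow e (cpow e' f) $$ n = cpow (e * e') f $$ n"
    using assms by (auto simp: cpow_nth)
qed

lemma cpow_one [simp]: "cpow (Suc 0) f = f"
  by (rule fls_eqI) (simp add: cpow_nth)

lemma poly_cpow_pcompose:
  fixes p :: "'a::field_char_0 fls poly"
  assumes "e > 0"
  shows "poly (map_poly (cpow e) (pcompose p [:c, a:])) z = poly (map_poly (cpow e) p) (cpow e c + cpow e a * z)"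
proof -
  note m = map_poly_hom[of "cpow e", OF cpow_simps(1) cpow_simps(3)]
  have sm: "map_poly (cpow e) (smult b q) = smult (cpow e b) (map_poly (cpow e) q)" for b :: "'a fls" and q
    by (rule poly_eqI) (simp add: coeff_map_poly)
  show ?thesis
    by (induction p) (simp_all add: pcompose_pCons map_poly_pCons m sm algebra_simps)
qed

lemma cpow_eq_0_iff: "e > 0 \<Longrightarrow> cpow e f = 0 \<longleftrightarrow> (f :: 'a::field_char_0 fls) = 0"
proof
  assume e: "e > 0" and f: "cpow e f = 0"
  have "f $$ n = cpow e f $$ (int e * n)" for n using e by (simp add: cpow_nth)
  then show "f = 0" using f by (intro fls_eqI) simp
qed simp

text \<open>Order at least \<open>n\<close>, where 0 has every order; bounds in terms of
  \<open>fls_subdegree\<close> would need a case distinction, as its value at 0 is 0.\<close>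

definition oge :: "int \<Rightarrow> 'a::zero fls \<Rightarrow> bool" where "oge n f \<longleftrightarrow> (\<forall>i<n. f $$ i = 0)"

lemma oge_iff: "oge n f \<longleftrightarrow> f = 0 \<or> n \<le> fls_subdegree f"
proof
  assume "oge n f"
  then show "f = 0 \<or> n \<le> fls_subdegree f" unfolding oge_def by (meson fls_subdegree_geI)
qed (auto simp: oge_def)

lemma oge_mult: "oge m f \<Longrightarrow> oge n g \<Longrightarrow> oge (m + n) (f * (g :: 'a::field fls))"
  unfolding oge_iff by (cases "f = 0 \<or> g = 0") auto

lemma oge_cpow: "e > 0 \<Longrightarrow> oge n f \<Longrightarrow> oge (int e * n) (cpow e f)"
  unfolding oge_def by (auto simp: cpow_nth dvd_def)

text \<open>Existence of a root in Puiseux series.\<close>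

definition has_root :: "'a::field_char_0 fls poly \<Rightarrow> bool" where
  "has_root G \<longleftrightarrow> (\<exists>e Y. e > 0 \<and> poly (map_poly (cpow e) G) Y = 0)"

lemma has_root_pcompose:
  assumes "has_root (pcompose G [:c, a:])" shows "has_root G"
  using assms unfolding has_root_def by (metis poly_cpow_pcompose)

lemma has_root_cpow:
  assumes "e > 0" "has_root (map_poly (cpow e) G)" shows "has_root G"
proof -
  obtain e' Y where e': "e' > 0" "poly (map_poly (cpow e') (map_poly (cpow e) G)) Y = 0"
    using assms unfolding has_root_def by blast
  have "map_poly (cpow e') (map_poly (cpow e) G) = map_poly (cpow (e' * e)) G"
    using e'(1) assms(1) by (intro poly_eqI) (simp add: coeff_map_poly cpow_cpow)
  then show ?thesis using e' assms(1) unfolding has_root_def by (metis nat_0_less_mult_iff)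
qed

lemma has_root_mult:
  assumes "has_root P" shows "has_root (P * Q)"
proof -
  obtain e Y where e: "e > 0" "poly (map_poly (cpow e) P) Y = 0"
    using assms unfolding has_root_def by blast
  have "map_poly (cpow e) (P * Q) = map_poly (cpow e) P * map_poly (cpow e) Q"
    by (rule map_poly_hom(2)) auto
  then show ?thesis using e unfolding has_root_def by (metis mult_eq_0_iff poly_mult)
qed

text \<open>
  The Newton-Puiseux theorem, following Abhyankar: after a Tschirnhaus transformation and a
  rescaling, the reduction of the polynomial has at least two distinct roots, and Hensel's lemma
  splits it into factors of smaller degree.
\<close>

lemma puiseux:
  fixes G :: "'a::field_char_0 fls poly"
  assumes AC: "\<And>p :: 'a poly. degree p > 0 \<Longrightarrow> \<exists>z. poly p z = 0"
    and "degree G > 0" "lead_coeff G = 1"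
  shows "has_root G"
  using assms(2,3)
proof (induction "degree G" arbitrary: G rule: less_induct)
  case less
  define n where "n = degree G"
  obtain k where k: "n = Suc k" using less.prems(1) unfolding n_def by (metis gr0_implies_Suc)
  \<comment> \<open>The shift that kills the coefficient of degree \<open>k = n - 1\<close>.\<close>
  define G1 where "G1 = pcompose G [:- coeff G k / of_nat n, 1:]"
  have dG1: "degree G1 = n" by (simp add: G1_def n_def degree_pcompose)
  have G1n: "coeff G1 n = 1"
    using coeff_pcompose_top[of G n] less.prems(2) by (simp add: G1_def n_def)
  have G1k: "coeff G1 k = 0"
    using coeff_pcompose_subtop[of G k] less.prems(2) k unfolding G1_def n_def
    by (simp del: of_nat_Suc)
  have "has_root G1"
  proof (cases "\<exists>j<n. coeff G1 j \<noteq> 0")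
    case False
    then have "poly G1 0 = 0" using k by (simp add: poly_0_coeff_0)
    moreover have "map_poly (cpow (Suc 0)) G1 = G1" by (rule poly_eqI) (simp add: coeff_map_poly)
    ultimately have "poly (map_poly (cpow (Suc 0)) G1) 0 = 0" by simp
    then show ?thesis unfolding has_root_def by (metis zero_less_Suc)
  next
    case True
    define v where "v j = fls_subdegree (coeff G1 j)" for j
    let ?J = "{j. j < n \<and> coeff G1 j \<noteq> 0}"
    \<comment> \<open>Up to sign, the slope of the segment from \<open>(j, v j)\<close> to
      \<open>(n, 0)\<close> in the Newton diagram. Its minimum is \<open>s / e\<close> with the
      numbers \<open>s\<close> and \<open>e\<close> below, so ramification by \<open>e\<close> turns
      it into the integer \<open>s\<close>.\<close>
    define sl where "sl j = real_of_int (v j) / real (n - j)" for j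
    have J: "finite ?J" "?J \<noteq> {}" using True by auto
    define j0 where "j0 = arg_min_on sl ?J"
    have j0: "j0 < n" "coeff G1 j0 \<noteq> 0" and min: "\<And>j. j < n \<Longrightarrow> coeff G1 j \<noteq> 0 \<Longrightarrow> sl j0 \<le> sl j"
      using arg_min_if_finite(1)[OF J, of sl] arg_min_least[OF J, of _ sl] unfolding j0_def by auto
    define e where "e = n - j0"
    define s where "s = v j0"
    have e0: "e > 0" using j0 by (simp add: e_def)
    have ord: "oge (s * int (n - j)) (cpow e (coeff G1 j))" if "j < n" for j
    proof (cases "coeff G1 j = 0")
      case True
      then show ?thesis by (simp add: oge_def)
    next
      case False
      have "sl j0 * (real (n - j) * real e) \<le> sl j * (real (n - j) * real e)"
        using min[OF that False] by (intro mult_right_mono) auto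
      moreover have "sl j0 * (real (n - j) * real e) = real_of_int (s * int (n - j))"
        using e0 unfolding sl_def e_def[symmetric] s_def by simp
      moreover have "sl j * (real (n - j) * real e) = real_of_int (int e * v j)"
        using that unfolding sl_def by simp
      ultimately have "real_of_int (s * int (n - j)) \<le> real_of_int (int e * v j)" by simp
      then have "s * int (n - j) \<le> int e * v j" by linarith
      moreover have "oge (int e * v j) (cpow e (coeff G1 j))"
        by (intro oge_cpow e0) (simp add: oge_iff v_def)
      ultimately show ?thesis unfolding oge_def by auto
    qed
    define G2 where "G2 = map_poly (cpow e) G1"
    \<comment> \<open>The unknown is rescaled by \<open>X^s\<close> and the result divided by
      \<open>X^(s n)\<close>. This keeps the polynomial monic, makes all orders nonnegative and
      gives the coefficient at \<open>j0\<close> order exactly 0.\<close>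
    define H where "H = smult (fls_X_intpow (- s * int n)) (pcompose G2 [:0, fls_X_intpow s:])"
    have cH: "coeff H j = fls_X_intpow (- s * int n + s * int j) * cpow e (coeff G1 j)" for j
    proof -
      have "coeff (pcompose p [:0, c:]) j = c ^ j * coeff p j" for c :: "'a fls" and p
        by (metis coeff_pcompose_linear)
      then have "coeff H j = fls_X_intpow (- s * int n) * (fls_X_intpow s ^ j * coeff G2 j)"
        unfolding H_def by simp
      also have "(fls_X_intpow s :: 'a fls) ^ j = fls_X_intpow (s * int j)"
        by (simp add: fls_X_intpow_power mult.commute)
      finally show ?thesis
        by (simp only: G2_def coeff_map_poly cpow_simps(4) mult.assoc[symmetric] fls_X_intpow_times_fls_X_intpow)
    qed
    have Hn: "coeff H n = 1" using G1n e0 by (simp add: cH)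
    have dH: "degree H = n"
    proof (rule antisym)
      show "degree H \<le> n" by (rule degree_le) (use dG1 in \<open>auto simp: cH coeff_eq_0\<close>)
      show "n \<le> degree H" using Hn by (intro le_degree) simp
    qed
    have oH: "oge 0 (coeff H j)" for j
    proof (cases "j < n")
      case True
      have "oge ((- s * int n + s * int j) + s * int (n - j)) (coeff H j)"
        unfolding cH by (intro oge_mult ord True) (simp add: oge_iff)
      moreover have "(- s * int n + s * int j) + s * int (n - j) = 0"
        using True by (simp add: of_nat_diff algebra_simps)
      ultimately show ?thesis by simp
    next
      case False
      then show ?thesis
        using Hn coeff_eq_0[of H j] dH by (cases "j = n") (auto simp: oge_def fls_one_nth)
    qed
    have Hj0: "coeff H j0 $$ 0 \<noteq> 0"
    proof -
      have "coeff H j0 $$ 0 = cpow e (coeff G1 j0) $$ (s * int n - s * int j0)"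
        unfolding cH fls_X_intpow_times_conv_shift(1) by simp
      also have "s * int n - s * int j0 = int e * s" using j0 by (simp add: e_def of_nat_diff algebra_simps)
      also have "cpow e (coeff G1 j0) $$ (int e * s) = coeff G1 j0 $$ s" using e0 by (simp add: cpow_nth)
      finally show ?thesis using j0 unfolding s_def v_def by simp
    qed
    define H0 where "H0 = map_poly fls_regpart H"
    have cH0: "coeff H0 j $ i = coeff H j $$ int i" for j i by (simp add: H0_def coeff_map_poly)
    have H0n: "coeff H0 n = 1" using Hn by (simp add: H0_def coeff_map_poly)
    have dH0: "degree H0 = n"
    proof (rule antisym)
      show "degree H0 \<le> n" unfolding H0_def dH[symmetric] by (rule degree_map_poly_le) simp
      show "n \<le> degree H0" using H0n by (intro le_degree) simp
    qed
    have HH0: "map_poly fps_to_fls H0 = H"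
    proof (rule poly_eqI)
      fix j
      have "coeff H j = 0 \<or> fls_subdegree (coeff H j) \<ge> 0" using oH[of j] by (simp add: oge_iff)
      then show "coeff (map_poly fps_to_fls H0) j = coeff H j"
        by (auto simp: H0_def coeff_map_poly fls_regpart_to_fls_trivial)
    qed
    define g where "g = map_poly (\<lambda>f. f $ 0) H0"
    have cg: "coeff g j = coeff H j $$ 0" for j by (simp add: g_def coeff_map_poly cH0)
    have gn: "coeff g n = 1" by (simp add: cg Hn)
    have dg: "degree g = n"
    proof (rule antisym)
      show "degree g \<le> n" unfolding g_def dH0[symmetric] by (rule degree_map_poly_le) simp
      show "n \<le> degree g" using gn by (intro le_degree) simp
    qed
    obtain b where b: "poly g b = 0" using AC[of g] dg k by auto
    have g0: "g \<noteq> 0" using gn by auto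
    define m where "m = order b g"
    obtain q where q: "g = [:- b, 1:] ^ m * q" "\<not> [:- b, 1:] dvd q"
      using order_decomp[OF g0, of b] unfolding m_def by blast
    have qb: "poly q b \<noteq> 0" using q(2) by (simp add: poly_eq_0_iff_dvd)
    have m0: "m > 0" using b g0 by (simp add: m_def order_root)
    have dgq: "n = m + degree q"
      using dg g0 unfolding q(1) by (subst (asm) degree_mult_eq) (auto simp: degree_power_eq)
    \<comment> \<open>If the reduction were \<open>(X - b)^n\<close>, its vanishing second
      coefficient \<open>- n b\<close> would force \<open>b = 0\<close>, against the nonzero
      coefficient at \<open>j0\<close>.\<close>
    have mn: "m < n"
    proof (rule ccontr)
      assume "\<not> m < n"
      then have "m = n" "degree q = 0" using dgq by auto
      then obtain c where c: "q = [:c:]" using degree_eq_zeroE by blast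
      have lin: "[:- b, 1:] ^ n = pcompose (monom 1 n) [:- b, 1:]"
        by (simp add: pcompose_altdef map_poly_monom poly_monom)
      have tp: "coeff ([:- b, 1:] ^ n) n = 1" "coeff ([:- b, 1:] ^ n) k = of_nat n * (- b)"
        unfolding lin using coeff_pcompose_top[of "monom (1::'a) n" n "- b"]
          coeff_pcompose_subtop[of "monom (1::'a) n" k "- b"] k by (simp_all add: degree_monom_eq)
      have gq: "g = smult c ([:- b, 1:] ^ n)" using q(1) c \<open>m = n\<close> by simp
      have "c = 1" using gn tp(1) unfolding gq by simp
      then have "coeff g k = of_nat n * (- b)" using tp(2) unfolding gq by simp
      moreover have "coeff g k = 0" unfolding cg cH G1k by simp
      ultimately have "b = 0" using k by (simp del: of_nat_Suc)
      then have "g = monom 1 n" using gq \<open>c = 1\<close> by (simp add: monom_altdef)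
      then have "coeff g j0 = 0" using j0 by simp
      then show False using Hj0 by (simp add: cg)
    qed
    have "coeff H0 i $ 0 = coeff ([:- b, 1:] ^ m * q) i" for i
      unfolding q(1)[symmetric] by (simp add: g_def coeff_map_poly)
    then obtain P Q where PQ: "H0 = P * Q" "degree P = m" "coeff P m = 1"
      using hensel[OF H0n dH0 _ qb] by blast
    define P' where "P' = map_poly fps_to_fls P"
    have P'm: "coeff P' m = 1" by (simp add: P'_def coeff_map_poly PQ)
    have dP': "degree P' = m"
    proof (rule antisym)
      show "degree P' \<le> m" unfolding P'_def PQ(2)[symmetric] by (rule degree_map_poly_le) simp
      show "m \<le> degree P'" using P'm by (intro le_degree) simp
    qed
    have "H = P' * map_poly fps_to_fls Q"
      unfolding HH0[symmetric] PQ(1) P'_def by (rule map_poly_hom(2)) (simp_all add: fls_times_fps_to_fls)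
    moreover have "has_root P'"
      using less.hyps[of P'] mn m0 P'm dP' by (simp add: n_def)
    ultimately have "has_root H" using has_root_mult by simp
    then obtain e' Y where Y: "e' > 0" "poly (map_poly (cpow e') H) Y = 0" unfolding has_root_def by blast
    have "map_poly (cpow e') H = smult (cpow e' (fls_X_intpow (- s * int n))) (map_poly (cpow e') (pcompose G2 [:0, fls_X_intpow s:]))"
      unfolding H_def by (rule poly_eqI) (simp add: coeff_map_poly)
    moreover have "cpow e' (fls_X_intpow (- s * int n)) \<noteq> (0 :: 'a fls)" using Y(1) by (simp only: cpow_eq_0_iff fls_X_intpow_nonzero not_False_eq_True)
    ultimately have "poly (map_poly (cpow e') (pcompose G2 [:0, fls_X_intpow s:])) Y = 0" using Y(2) by simp
    then have "has_root G2" using Y(1) has_root_pcompose unfolding has_root_def by blast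
    then show ?thesis unfolding G2_def using has_root_cpow[OF e0] by blast
  qed
  then show ?case unfolding G1_def by (rule has_root_pcompose)
qed

section \<open>Orders and derivations at infinity\<close>

lemma oge_add: "oge n f \<Longrightarrow> oge n g \<Longrightarrow> oge n (f + g :: 'a::field fls)"
  by (simp add: oge_def)

lemma oge_diff: "oge n f \<Longrightarrow> oge n g \<Longrightarrow> oge n (f - g :: 'a::field fls)"
  by (simp add: oge_def)

lemma oge_mono: "oge n f \<Longrightarrow> m \<le> n \<Longrightarrow> oge m f"
  by (auto simp: oge_def)

lemma oge_const [simp]: "oge 0 (fls_const a)"
  by (simp add: oge_def)

lemma oge_0 [simp]: "oge n 0"
  by (simp add: oge_def)

lemma oge_X_intpow [simp]: "oge n (fls_X_intpow n :: 'a::field fls)"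
  by (simp add: oge_iff)

lemma oge_mult_le: "oge m f \<Longrightarrow> oge n g \<Longrightarrow> k \<le> m + n \<Longrightarrow> oge k (f * g :: 'a::field fls)"
  by (rule oge_mono[OF oge_mult])

lemma oge_fls_map: "d 0 = 0 \<Longrightarrow> oge n f \<Longrightarrow> oge n (fls_map d f)"
  by (simp add: oge_def fls_map_nth)

lemma fls_map_const:
  fixes d :: "'a::field \<Rightarrow> 'a"
  shows "d 0 = 0 \<Longrightarrow> fls_map d (fls_const a) = fls_const (d a)"
  by (rule fls_eqI) (simp add: fls_map_nth)

lemma monom_nth: "(fls_const a * fls_X_intpow n) $$ k = (if k = n then a else (0 :: 'a::field))"
  unfolding fls_X_intpow_times_conv_shift(2) by simp

lemma fls_map_monom:
  fixes d :: "'a::field \<Rightarrow> 'a"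
  shows "d 0 = 0 \<Longrightarrow> fls_map d (fls_const a * fls_X_intpow n) = fls_const (d a) * (fls_X_intpow n :: 'a::field fls)"
  by (rule fls_eqI) (simp only: fls_map_nth monom_nth if_distrib[of d])

text \<open>Unlike d/dX, the operator X d/dX never lowers the order, since it acts on each
  coefficient by a scalar.\<close>

definition euler_fls :: "'a::field_char_0 fls \<Rightarrow> 'a fls" where
  "euler_fls f = fls_X * fls_deriv f"

lemma euler_fls_nth: "euler_fls f $$ k = of_int k * f $$ k"
  by (simp add: euler_fls_def fls_X_times_conv_shift)

lemma derivation_euler: "derivation euler_fls"
  by (intro derivationI) (simp_all add: euler_fls_def fls_deriv_add fls_deriv_mult algebra_simps)

lemma oge_euler: "oge n f \<Longrightarrow> oge n (euler_fls f)"
  by (simp add: oge_def euler_fls_nth)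

lemma euler_monom: "euler_fls (fls_const a * fls_X_intpow n) = fls_const (of_int n * a) * fls_X_intpow n"
  by (rule fls_eqI) (simp only: euler_fls_nth monom_nth mult_zero_right split: if_split, simp)

text \<open>
  The coordinates \<open>x = 1 / \<eta>\<^sup>2\<close>, \<open>u = w / \<eta>\<^sup>3\<close> at infinity, where \<open>\<eta>\<close> is the \<open>n\<close>-th power of the
  uniformizer, and the derivations \<open>\<partial>/\<partial>x\<close>, \<open>\<partial>/\<partial>u\<close> in these coordinates.
\<close>

definition Xinf :: "nat \<Rightarrow> 'a::field_char_0 fls" where "Xinf n = fls_X_intpow (- 2 * int n)"
definition Uinf :: "nat \<Rightarrow> 'a::field_char_0 \<Rightarrow> 'a fls" where "Uinf n w = fls_const w * fls_X_intpow (- 3 * int n)"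

definition Qinf :: "nat \<Rightarrow> ('a::field_char_0 \<Rightarrow> 'a) \<Rightarrow> 'a fls \<Rightarrow> 'a fls" where
  "Qinf n e f = fls_X_intpow (3 * int n) * fls_map e f"

text \<open>The chain rule: at fixed \<open>u\<close> the derivative of \<eta> in \<open>x\<close>
  is -\<eta>^3 / 2 and that of \<open>w\<close> is -(3/2) w \<eta>^2, while \<eta> d/d\<eta> is
  \<open>euler_fls\<close> divided by \<open>n\<close>. At fixed \<open>x\<close> only
  \<open>w\<close> moves, with derivative \<eta>^3 in \<open>u\<close>, whence \<open>Qinf\<close>.
  The derivation \<open>e\<close> stands for d/dw.\<close>

definition Pinf :: "nat \<Rightarrow> 'a::field_char_0 \<Rightarrow> ('a \<Rightarrow> 'a) \<Rightarrow> 'a fls \<Rightarrow> 'a fls" where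
  "Pinf n w e f = fls_const (- 1 / (2 * of_nat n)) * fls_X_intpow (2 * int n) * euler_fls f
     + fls_const (- 3 * w / 2) * fls_X_intpow (2 * int n) * fls_map e f"

text \<open>The total derivation at infinity: \<open>d\<close> on coefficients plus x' d/dx + x''
  d/du. With \<open>d w = 0\<close> it takes the right values at \<open>Xinf\<close> and
  \<open>Uinf\<close>.\<close>

definition Dinf :: "nat \<Rightarrow> 'a::field_char_0 \<Rightarrow> 'a \<Rightarrow> ('a \<Rightarrow> 'a) \<Rightarrow> ('a \<Rightarrow> 'a) \<Rightarrow> 'a fls \<Rightarrow> 'a fls" where
  "Dinf n w t d e f = fls_map d f + (Uinf n w * Pinf n w e f + (6 * Xinf n ^ 2 + fls_const t) * Qinf n e f)"

lemma derivation_scale: "derivation d \<Longrightarrow> derivation (\<lambda>x. p * d x)"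
  using derivation_lincomb[of d d p 0] by simp

lemma derivation_Qinf: "derivation e \<Longrightarrow> derivation (Qinf n e)"
  unfolding Qinf_def by (intro derivation_scale derivation_fls_map)

lemma derivation_Pinf: "derivation e \<Longrightarrow> derivation (Pinf n w e)"
  unfolding Pinf_def by (intro derivation_lincomb derivation_euler derivation_fls_map)

lemma derivation_Dinf:
  assumes "derivation d" "derivation e" shows "derivation (Dinf n w t d e)"
proof -
  note derivation_lincomb[OF derivation_Pinf[OF assms(2)] derivation_Qinf[OF assms(2)]]
  from derivation_lincomb[OF derivation_fls_map[OF assms(1)] this, of 1 1 "Uinf n w" n w "6 * Xinf n ^ 2 + fls_const t" n]
  show ?thesis unfolding Dinf_def by simp
qed

lemma monom_mult: "(fls_const a * fls_X_intpow i) * (fls_const b * fls_X_intpow j) =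
    fls_const (a * b) * (fls_X_intpow (i + j) :: 'a::field_char_0 fls)"
proof -
  have "(fls_const a * fls_X_intpow i) * (fls_const b * fls_X_intpow j) =
      (fls_const a * fls_const b) * (fls_X_intpow i * fls_X_intpow j :: 'a fls)" by (simp only: ac_simps)
  then show ?thesis by (simp only: fls_const_mult_const fls_X_intpow_times_fls_X_intpow)
qed

lemma monom_power: "(fls_const a * fls_X_intpow i) ^ k =
    fls_const (a ^ k) * (fls_X_intpow (int k * i) :: 'a::field_char_0 fls)"
proof (induction k)
  case (Suc k)
  show ?case unfolding power_Suc Suc monom_mult by (simp add: algebra_simps)
qed simp

lemma X_intpow_monom: "fls_X_intpow i * (fls_const b * fls_X_intpow j) =
    fls_const b * (fls_X_intpow (i + j) :: 'a::field_char_0 fls)"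
  using monom_mult[of 1 i b j] by simp

lemma Xinf_monom: "Xinf n = fls_const 1 * fls_X_intpow (- 2 * int n)"
  by (simp add: Xinf_def)

lemma generators_Qinf:
  assumes e: "derivation e" "e w = 1"
  shows "Qinf n e (Xinf n) = 0" "Qinf n e (Uinf n w) = 1" "e a = 0 \<Longrightarrow> Qinf n e (fls_const a) = 0"
  unfolding Qinf_def Xinf_monom Uinf_def fls_map_monom[of e, OF derivation_0[OF e(1)]]
    fls_map_const[of e, OF derivation_0[OF e(1)]]
    X_intpow_monom
  using e by simp_all

lemma generators_Pinf:
  assumes e: "derivation e" "e w = 1" and n: "n > 0"
  shows "Pinf n w e (Xinf n) = 1" "Pinf n w e (Uinf n w) = 0" "e a = 0 \<Longrightarrow> Pinf n w e (fls_const a) = 0"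
proof -
  note m = fls_map_monom[of e, OF derivation_0[OF e(1)]] fls_map_const[of e, OF derivation_0[OF e(1)]]
  show "Pinf n w e (Xinf n) = 1"
    unfolding Pinf_def Xinf_monom m euler_monom monom_mult using e n by simp
  show "Pinf n w e (Uinf n w) = 0"
    unfolding Pinf_def Uinf_def m euler_monom monom_mult using e n
    by (simp add: fls_plus_const flip: distrib_right)
  have "euler_fls (fls_const a) = 0" by (rule fls_eqI) (simp add: euler_fls_nth)
  then show "Pinf n w e (fls_const a) = 0" if "e a = 0" unfolding Pinf_def m using that by simp
qed

lemma generators_Dinf:
  assumes d: "derivation d" "d w = 0" and e: "derivation e" "e w = 1" and n: "n > 0"
  shows "Dinf n w t d e (Xinf n) = Uinf n w" "Dinf n w t d e (Uinf n w) = 6 * Xinf n ^ 2 + fls_const t"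
    "e a = 0 \<Longrightarrow> Dinf n w t d e (fls_const a) = fls_const (d a)"
proof -
  note m = fls_map_monom[of d, OF derivation_0[OF d(1)]] fls_map_const[of d, OF derivation_0[OF d(1)]]
  have "fls_map d (Xinf n) = 0" "fls_map d (Uinf n w) = 0"
    unfolding Xinf_monom Uinf_def m using d by simp_all
  then show "Dinf n w t d e (Xinf n) = Uinf n w" "Dinf n w t d e (Uinf n w) = 6 * Xinf n ^ 2 + fls_const t"
    "e a = 0 \<Longrightarrow> Dinf n w t d e (fls_const a) = fls_const (d a)"
    unfolding Dinf_def using generators_Pinf[OF e n] generators_Qinf[OF e] by (simp_all add: m)
qed

lemma oge_Qinf: "derivation e \<Longrightarrow> oge k f \<Longrightarrow> oge (k + 3 * int n) (Qinf n e f)"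
  unfolding Qinf_def by (rule oge_mult_le[OF oge_X_intpow oge_fls_map]) auto

lemma oge_Pinf:
  assumes "derivation e" "oge k f" shows "oge (k + 2 * int n) (Pinf n w e f)"
proof -
  have "oge (2 * int n) (fls_const c * (fls_X_intpow (2 * int n) :: 'a fls))" for c
    by (rule oge_mult_le[OF oge_const oge_X_intpow]) simp
  note c = this
  note o = oge_euler[OF assms(2)] oge_fls_map[where d = e, OF derivation_0[OF assms(1)] assms(2)]
  show ?thesis
    unfolding Pinf_def
    by (intro oge_add; (rule oge_mult_le[OF c o(1)] oge_mult_le[OF c o(2)]); simp)
qed

lemma oge_Xinf: "oge (- 2 * int n) (Xinf n)"
  unfolding Xinf_def by (rule oge_X_intpow)

lemma oge_Uinf: "oge (- 3 * int n) (Uinf n w)"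
  unfolding Uinf_def by (rule oge_mult_le[OF oge_const oge_X_intpow]) simp

lemma oge_numeral: "oge 0 (numeral k :: 'a::field fls)"
  by (metis fls_const_numeral oge_const)

text \<open>\<open>Uinf\<close> has order \<open>- 3 n\<close> and \<open>Pinf\<close> gains
  \<open>2 n\<close>; \<open>6 Xinf^2\<close> has order \<open>- 4 n\<close> and \<open>Qinf\<close>
  gains \<open>3 n\<close>. Either product loses at most \<open>n\<close>.\<close>

lemma oge_Dinf:
  assumes d: "derivation d" and e: "derivation e" and f: "oge k f"
  shows "oge (k - int n) (Dinf n w t d e f)"
proof -
  have "oge (k - int n) (fls_map d f)"
    by (rule oge_mono[OF oge_fls_map[where d = d, OF derivation_0[OF d] f]]) simp
  moreover have "oge (k - int n) (Uinf n w * Pinf n w e f)"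
    by (rule oge_mult_le[OF oge_Uinf oge_Pinf[OF e f]]) simp
  moreover have "oge (- 4 * int n) (6 * Xinf n ^ 2 + fls_const t)"
    unfolding power2_eq_square
    by (intro oge_add oge_mult_le[OF oge_numeral oge_mult[OF oge_Xinf oge_Xinf]] oge_mono[OF oge_const]) auto
  then have "oge (k - int n) ((6 * Xinf n ^ 2 + fls_const t) * Qinf n e f)"
    by (rule oge_mult_le[OF _ oge_Qinf[OF e f]]) simp
  ultimately show ?thesis unfolding Dinf_def by (intro oge_add)
qed

text \<open>If \<open>Y\<close> had order \<open>k < - n\<close>, then \<open>2 Y^3\<close> would
  have order \<open>3 k\<close>, which is below \<open>k - 2 n\<close>, a lower bound for the order
  of every other term.\<close>

lemma PII_pole_order:
  assumes d: "derivation d" and e: "derivation e" and n: "n > 0"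
    and Y: "Dinf n w t d e (Dinf n w t d e Y) = 2 * Y ^ 3 + fls_const t * Y + fls_const c"
  shows "oge (- int n) Y"
proof (rule ccontr)
  assume "\<not> oge (- int n) Y"
  then have Y0: "Y \<noteq> 0" "fls_subdegree Y < - int n" by (auto simp: oge_iff)
  define k where "k = fls_subdegree Y"
  have Yk: "oge k Y" by (simp add: oge_iff k_def)
  have k: "k < - int n" using Y0 k_def by simp
  have "oge (k - int n - int n) (Dinf n w t d e (Dinf n w t d e Y))" by (intro oge_Dinf d e Yk)
  moreover have "oge (k - int n - int n) (fls_const t * Y)"
    by (rule oge_mult_le[OF oge_const Yk]) simp
  moreover have "oge (k - int n - int n) (fls_const c)"
    by (rule oge_mono[OF oge_const]) (use k in simp)
  moreover have "2 * Y ^ 3 = Dinf n w t d e (Dinf n w t d e Y) - fls_const t * Y - fls_const c"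
    unfolding Y by simp
  ultimately have "oge (k - int n - int n) (2 * Y ^ 3)" by (auto intro!: oge_diff)
  moreover have "fls_subdegree (2 * Y ^ 3) = 3 * k"
  proof -
    have "(2 :: 'a fls) = fls_const 2" by (metis fls_const_numeral)
    then have "fls_subdegree (2 :: 'a fls) = 0" by simp
    then show ?thesis using Y0 by (simp add: k_def fls_subdegree_pow)
  qed
  ultimately show False using k n Y0(1) by (simp add: oge_iff)
qed

section \<open>Embedding the correspondence into Laurent series\<close>

lemma Kconst_phom:
  assumes "field_set (K :: 'a::field_char_0 set)" shows "phom ((\<lambda>a. (a, fls_const a)) ` K)"
proof -
  let ?G = "(\<lambda>a. (a, fls_const a)) ` K"
  have r: "pring ?G"
    unfolding pring_def
  proof (intro conjI allI impI)
    have "(1, fls_const 1) \<in> ?G" using field_setD(5)[OF assms] by blast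
    then show "(1, 1) \<in> ?G" by simp
  next
    fix a b a' b' assume "(a, b) \<in> ?G" "(a', b') \<in> ?G"
    then have "a \<in> K" "b = fls_const a" "a' \<in> K" "b' = fls_const a'" by auto
    then show "(a + a', b + b') \<in> ?G" "(a * a', b * b') \<in> ?G"
      using field_setD(1,2)[OF assms] by (auto simp: fls_plus_const)
  next
    fix a b assume "(a, b) \<in> ?G"
    then have "a \<in> K" "b = fls_const a" by auto
    then show "(- a, - b) \<in> ?G" using field_setD(3)[OF assms] by auto
  qed
  have p: "prehom ?G" using r by (rule prehom_fieldI) auto
  have "(inverse a, b') \<in> ?G" if "(a, b) \<in> ?G" "b * b' = 1" for a b b'
  proof -
    have a: "a \<in> K" "b = fls_const a" using that by auto
    then have "a \<noteq> 0" using that by auto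
    then have "b' = fls_const (inverse a)"
      using that(2) a(2) by (metis fls_const_mult_const fls_const_1 inverse_unique right_inverse)
    then show ?thesis using field_setD(4)[OF assms a(1)] by blast
  qed
  then show ?thesis using r p by (simp add: phom_def pfield_def)
qed

lemma prel_Kconst:
  assumes "prel ((\<lambda>a. (a, fls_const a)) ` K) p q"
  shows "q = map_poly fls_const p" "coeff p i \<in> K"
proof -
  have *: "coeff q i = fls_const (coeff p i) \<and> coeff p i \<in> K" for i
    using assms unfolding prel_def by (metis (no_types, lifting) image_iff prod.inject)
  show "q = map_poly fls_const p" "coeff p i \<in> K" using * by (auto simp: poly_eq_iff coeff_map_poly)
qed

text \<open>The monomials of weight \<open>k\<close> in \<open>P\<close> contribute to the exponent
  \<open>- k n\<close>. Their sum there is a polynomial in \<open>w\<close> over \<open>K\<close>,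
  which is nonzero at the transcendental \<open>w\<close>.\<close>

lemma infinity_independent:
  fixes K :: "'a::field_char_0 set"
  assumes K: "field_set K" and w: "\<not> alg K w" and n: "n > 0" and P: "over K P" "P \<noteq> 0"
  shows "eval2 (fc P) (Xinf n) (Uinf n w) \<noteq> 0"
proof -
  obtain j0 i0 where ji: "cf P j0 i0 \<noteq> 0" using P(2) by (metis cf_eqI coeff_0)
  define k where "k = 2 * i0 + 3 * j0"
  define N where "N = degree P + j0"
  define M where "M = Max (insert i0 ((\<lambda>j. degree (coeff P j)) ` {..N}))"
  have M: "degree (coeff P j) \<le> M" if "j \<le> N" for j unfolding M_def using that by (intro Max_ge) auto
  have "i0 \<le> M" unfolding M_def by (intro Max_ge) auto
  \<comment> \<open>Within weight \<open>k\<close> the exponent \<open>j\<close> determines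
    \<open>i\<close>, so nothing cancels: the coefficient of \<open>r\<close> at \<open>j0\<close>
    is \<open>cf P j0 i0\<close>.\<close>
  define r where "r = (\<Sum>j\<le>N. monom (\<Sum>i\<le>M. if 2 * i + 3 * j = k then cf P j i else 0) j)"
  have in_poly: "poly (coeff (fc P) j) z = (\<Sum>i\<le>M. fls_const (cf P j i) * z ^ i)" if "j \<le> N" for j z
  proof -
    have "degree (coeff (fc P) j) \<le> M"
      using M[OF that] degree_map_poly_le[of fls_const "coeff P j"]
      by (simp add: fc_def coeff_map_poly)
    then have "poly (coeff (fc P) j) z = (\<Sum>i\<le>M. cf (fc P) j i * z ^ i)"
      unfolding poly_altdef by (intro sum.mono_neutral_left) (auto simp: coeff_eq_0)
    then show ?thesis by (simp add: cf_fc)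
  qed
  have "eval2 (fc P) (Xinf n) (Uinf n w) = (\<Sum>j\<le>N. poly (coeff (fc P) j) (Xinf n) * Uinf n w ^ j)"
    by (rule eval2_altdef) (simp add: degree_fc N_def)
  also have "\<dots> = (\<Sum>j\<le>N. \<Sum>i\<le>M. fls_const (cf P j i * w ^ j) * fls_X_intpow (- int (2 * i + 3 * j) * int n))"
  proof (intro sum.cong refl)
    fix j assume "j \<in> {..N}"
    then have "poly (coeff (fc P) j) (Xinf n) * Uinf n w ^ j = (\<Sum>i\<le>M. fls_const (cf P j i) * Xinf n ^ i * Uinf n w ^ j)"
      by (simp add: in_poly sum_distrib_right)
    also have "\<dots> = (\<Sum>i\<le>M. fls_const (cf P j i * w ^ j) * fls_X_intpow (- int (2 * i + 3 * j) * int n))"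
    proof (intro sum.cong refl)
      fix i
      have "fls_const (cf P j i) * Xinf n ^ i * Uinf n w ^ j =
          (fls_const (cf P j i) * fls_X_intpow (int i * (- 2 * int n))) * (fls_const (w ^ j) * fls_X_intpow (int j * (- 3 * int n)))"
        unfolding Uinf_def monom_power Xinf_monom by simp
      also have "\<dots> = fls_const (cf P j i * w ^ j) * fls_X_intpow (- int (2 * i + 3 * j) * int n)"
        unfolding monom_mult by (simp add: algebra_simps)
      finally show "fls_const (cf P j i) * Xinf n ^ i * Uinf n w ^ j =
        fls_const (cf P j i * w ^ j) * fls_X_intpow (- int (2 * i + 3 * j) * int n)" .
    qed
    finally show "poly (coeff (fc P) j) (Xinf n) * Uinf n w ^ j =
      (\<Sum>i\<le>M. fls_const (cf P j i * w ^ j) * fls_X_intpow (- int (2 * i + 3 * j) * int n))" .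
  qed
  finally have "eval2 (fc P) (Xinf n) (Uinf n w) $$ (- int k * int n) =
    (\<Sum>j\<le>N. \<Sum>i\<le>M. if 2 * i + 3 * j = k then cf P j i * w ^ j else 0)"
    unfolding fls_nth_sum
  proof (simp only: fls_nth_sum, intro sum.cong refl)
    fix j i
    have "(fls_const c * (fls_X_intpow (- int l * int n) :: 'a fls)) $$ (- int k * int n) = (if l = k then c else 0)" for c l
      using n unfolding monom_nth by simp
    then show "(fls_const (cf P j i * w ^ j) * fls_X_intpow (- int (2 * i + 3 * j) * int n)) $$ (- int k * int n) =
      (if 2 * i + 3 * j = k then cf P j i * w ^ j else 0)" by blast
  qed
  also have "\<dots> = poly r w"
    unfolding r_def poly_sum poly_monom sum_distrib_right by (intro sum.cong refl) auto
  finally have e: "eval2 (fc P) (Xinf n) (Uinf n w) $$ (- int k * int n) = poly r w" .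
  have "coeff r j \<in> K" for j
    using P(1) unfolding r_def coeff_sum coeff_monom over_def
    by (auto intro!: field_set_sum[OF K] simp: field_set_0[OF K])
  moreover have "coeff r j0 \<noteq> 0"
  proof -
    have "coeff r j0 = (\<Sum>i\<le>M. if 2 * i + 3 * j0 = k then cf P j0 i else 0)"
      unfolding r_def coeff_sum coeff_monom by (simp add: N_def)
    also have "\<dots> = (\<Sum>i\<le>M. if i = i0 then cf P j0 i0 else 0)" by (intro sum.cong) (auto simp: k_def)
    also have "\<dots> = cf P j0 i0" using \<open>i0 \<le> M\<close> by simp
    finally show ?thesis using ji by simp
  qed
  ultimately have "poly r w \<noteq> 0" using w unfolding alg_def by (metis coeff_0)
  then show ?thesis using e by auto
qed

text \<open>Serves to compare the embedding for \<open>n = 1\<close>, followed by ramification, with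
  the embedding for general \<open>n\<close>.\<close>

lemma pfield_preimage_cpow:
  fixes G :: "('a::field_char_0 \<times> 'a fls) set"
  assumes G: "pfield G" and e: "e > 0"
  shows "pfield {(a, b). (a, cpow e b) \<in> G}"
proof -
  note r = pfield_pring[OF G]
  have m: "cpow e (- b) = - cpow e b" for b :: "'a fls"
    using cpow_simps(2)[of e 0 b] by simp
  have "(inverse a, cpow e b') \<in> G" if "(a, cpow e b) \<in> G" "b * b' = 1" for a b b'
  proof (rule pfield_inverse[OF G that(1)])
    show "cpow e b * cpow e b' = 1" using that(2) e by (metis cpow_simps(3) cpow_simps(5))
  qed
  moreover have "pring {(a, b). (a, cpow e b) \<in> G}"
    unfolding pring_def using pring_1[OF r] pring_add[OF r] pring_mult[OF r] pring_minus[OF r] e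
    by (simp add: m)
  ultimately show ?thesis unfolding pfield_def by simp
qed

lemma pfield_Domain_subset:
  assumes "field_set E" shows "pfield {(a, b). a \<in> E}"
  using field_setD[OF assms] by (auto simp: pfield_def pring_def)

text \<open>The coordinates at infinity embed \<open>K(x, u)\<close> into Laurent series, and a
  Puiseux root of the image of the minimal polynomial of \<open>y\<close> extends the embedding to
  \<open>y\<close>. The three derivations correspond on generators, hence on the whole
  graph.\<close>

lemma correspondence_at_infinity:
  fixes d :: "'a::field_char_0 \<Rightarrow> 'a"
  assumes AC: "\<And>p :: 'a poly. degree p > 0 \<Longrightarrow> \<exists>z. poly p z = 0"
    and K: "field_set K" and d: "derivation d" "\<And>a. a \<in> K \<Longrightarrow> d a \<in> K" and t: "t \<in> K" "d t = 1"
    and x: "\<not> alg K x" and u: "d x = u" "d u = 6 * x ^ 2 + t"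
    and y: "alg (fext (fext K x) u) y"
    and w: "\<not> alg K w" "d w = 0"
    and P: "derivation P" "\<And>a. a \<in> K \<Longrightarrow> P a = 0" "P x = 1" "P u = 0"
    and Q: "derivation Q" "\<And>a. a \<in> K \<Longrightarrow> Q a = 0" "Q x = 0" "Q u = 1"
    and e: "derivation e" "\<And>a. a \<in> K \<Longrightarrow> e a = 0" "e w = 1"
  shows "\<exists>n G Y. n > 0 \<and> phom G \<and> (y, Y) \<in> G \<and> (\<forall>a\<in>K. (a, fls_const a) \<in> G) \<and>
    (\<forall>f g. (f, g) \<in> G \<longrightarrow> (d f, Dinf n w t d e g) \<in> G \<and> (P f, Pinf n w e g) \<in> G \<and> (Q f, Qinf n e g) \<in> G)"
proof -
  define F where "F = fext (fext K x) u"
  note Kx = fext_field[OF K, of x]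
  have F: "field_set F" "K \<subseteq> F" "x \<in> F" "u \<in> F"
    unfolding F_def using fext_field[OF Kx] fext_subset[OF K] fext_subset[OF Kx] fext_mem[OF K] fext_mem[OF Kx]
    by blast+
  define GK where "GK = (\<lambda>a. (a, fls_const a)) ` K"
  have GK: "phom GK" unfolding GK_def by (rule Kconst_phom[OF K])
  note GKr = phom_pring[OF GK]
  \<comment> \<open>A whole family of embeddings is needed, because the ramification index
    \<open>n\<close> is known only once the root for \<open>y\<close> has been found.\<close>
  define G1 where "G1 n = pext GK x (Xinf n)" for n
  define G2 where "G2 n = pext (G1 n) u (Uinf n w)" for n
  have pre1: "prehom (padj GK x (Xinf n))" if n: "n > 0" for n
  proof (rule prehom_fieldI[OF padj_pring[OF GKr]])
    fix a b assume "(a, b) \<in> padj GK x (Xinf n)"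
    then obtain p q where pq: "a = poly p x" "b = poly q (Xinf n)" "prel GK p q" by (auto simp: padj_def)
    note pq' = prel_Kconst[OF pq(3)[unfolded GK_def]]
    show "a = 0 \<longleftrightarrow> b = 0"
    proof (cases "p = 0")
      case True
      then show ?thesis using pq pq' by simp
    next
      case False
      then have "a \<noteq> 0" using x pq'(2) unfolding pq(1) alg_def by metis
      moreover have "eval2 (fc [:p:]) (Xinf n) (Uinf n w) \<noteq> 0"
        using False pq'(2) by (intro infinity_independent[OF K w(1) n] over_const K) auto
      then have "b \<noteq> 0" using pq(2) pq'(1) by (simp add: fc_def map_poly_pCons)
      ultimately show ?thesis by simp
    qed
  qed
  have hG1: "phom (G1 n)" if "n > 0" for n unfolding G1_def by (rule pext_phom[OF pre1[OF that]])
  have pre2: "prehom (padj (G1 n) u (Uinf n w))" if n: "n > 0" for n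
  proof (rule prehom_fieldI[OF padj_pring[OF phom_pring[OF hG1[OF n]]]])
    fix a b assume "(a, b) \<in> padj (G1 n) u (Uinf n w)"
    then obtain p q where pq: "a = poly p u" "b = poly q (Uinf n w)" "prel (G1 n) p q" by (auto simp: padj_def)
    show "a = 0 \<longleftrightarrow> b = 0"
    proof (cases "p = 0")
      case True
      then have "q = 0" using prel_zero_iff[OF phom_prehom[OF hG1[OF n]] pq(3)] by simp
      then show ?thesis using True pq by simp
    next
      case False
      obtain s s' A A' where A: "(s, s') \<in> padj GK x (Xinf n)" "s \<noteq> 0" "\<forall>j. prel GK (coeff A j) (coeff A' j)"
        "\<forall>z. eval2 A x z = s * poly p z" "\<forall>z. eval2 A' (Xinf n) z = s' * poly q z"
        using prel_pext_clear[OF GKr pre1[OF n] pq(3)[unfolded G1_def]] by blast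
      have A': "A' = fc A" "over K A"
      proof -
        have "coeff A' j = map_poly fls_const (coeff A j)" "coeff (coeff A j) i \<in> K" for i j
          using prel_Kconst A(3) unfolding GK_def by blast+
        then show "A' = fc A" "over K A" by (auto simp: fc_def over_def coeff_map_poly intro!: poly_eqI)
      qed
      have "A \<noteq> 0"
      proof
        assume "A = 0"
        then have "poly p z = 0" for z using A(2) spec[OF A(4), of z] by simp
        then show False using False poly_all_0_iff_0 by blast
      qed
      then have "eval2 A x u \<noteq> 0" "eval2 A' (Xinf n) (Uinf n w) \<noteq> 0"
        using PI_independent[OF K d t x u A'(2)] infinity_independent[OF K w(1) n A'(2)] A'(1) by auto
      then show ?thesis using A(4,5) pq by auto
    qed
  qed
  have hG2: "phom (G2 n)" if "n > 0" for n unfolding G2_def by (rule pext_phom[OF pre2[OF that]])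
  have sub1: "GK \<subseteq> G1 n" "(x, Xinf n) \<in> G1 n" for n
    unfolding G1_def using pext_subset[OF GKr] pext_mem[OF GKr] by blast+
  have sub2: "G1 n \<subseteq> G2 n" "(u, Uinf n w) \<in> G2 n" if "n > 0" for n
    unfolding G2_def using pext_subset[OF phom_pring[OF hG1[OF that]]] pext_mem[OF phom_pring[OF hG1[OF that]]]
    by blast+
  have least: "G2 n \<subseteq> Z" if "n > 0" "pfield Z" "GK \<subseteq> Z" "(x, Xinf n) \<in> Z" "(u, Uinf n w) \<in> Z" for Z n
    unfolding G2_def G1_def using that
    by (intro pext_least[OF pre2[unfolded G1_def]] pext_least[OF pre1]) auto
  have dom: "Domain (G2 n) = F" if n: "n > 0" for n
  proof
    have "G2 n \<subseteq> {(a, b). a \<in> F}"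
      using F by (intro least[OF n] pfield_Domain_subset) (auto simp: GK_def)
    then show "Domain (G2 n) \<subseteq> F" by auto
    have "K \<subseteq> Domain (G2 n)" using sub1 sub2[OF n] unfolding GK_def by blast
    then show "F \<subseteq> Domain (G2 n)"
      unfolding F_def using sub1(2)[of n] sub2[OF n]
      by (intro fext_least Kx K field_set_Domain hG2[OF n]) blast+
  qed
  have der: "(d1 f, d2 g) \<in> G2 n" if n: "n > 0" and fg: "(f, g) \<in> G2 n" and d12: "derivation d1" "derivation d2"
    and "\<And>a. a \<in> K \<Longrightarrow> (d1 a, d2 (fls_const a)) \<in> G2 n" "(d1 x, d2 (Xinf n)) \<in> G2 n" "(d1 u, d2 (Uinf n w)) \<in> G2 n"
    for d1 d2 f g n
  proof -
    have "G2 n \<subseteq> {(a, b). (a, b) \<in> G2 n \<and> (d1 a, d2 b) \<in> G2 n}"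
      using that sub1[of n] sub2[OF n]
      by (intro least[OF n] pfield_derivation hG2) (auto simp: GK_def)
    then show ?thesis using fg by blast
  qed
  have yF: "alg F y" using y by (simp add: F_def)
  obtain p where p: "p \<noteq> 0" "\<And>i. coeff p i \<in> F" "poly p y = 0"
    "\<And>q. (\<And>i. coeff q i \<in> F) \<Longrightarrow> q \<noteq> 0 \<Longrightarrow> degree q < degree p \<Longrightarrow> poly q y \<noteq> 0" "degree p > 0"
    using alg_min_poly[OF F(1) yF] by metis
  have minr: "min_rel (G2 n) y p q" if "n > 0" "prel (G2 n) p q" for n q
    unfolding min_rel_def
  proof (intro conjI allI impI that p(1,3))
    fix q r assume q: "prel (G2 n) q r" "q \<noteq> 0" "degree q < degree p"
    have "coeff q i \<in> F" for i using q(1) dom[OF that(1)] unfolding prel_def by blast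
    then show "poly q y \<noteq> 0" using p(4) q by blast
  qed
  have one: "(0::nat) < 1" by simp
  \<comment> \<open>The unramified embedding supplies the polynomial to be solved; its root exists
    after the substitution of \<open>X^n\<close> for \<open>X\<close>.\<close>
  obtain p' where p': "prel (G2 1) p p'"
    using prel_ex[OF phom_pring[OF hG2[OF one]], of p] p(2) dom[OF one] by blast
  have dp': "degree p' = degree p" by (rule prel_degree[OF phom_prehom[OF hG2[OF one]] p'])
  then have "p' \<noteq> 0" using p(5) by auto
  then have lp': "lead_coeff p' \<noteq> 0" by simp
  define q where "q = smult (inverse (lead_coeff p')) p'"
  have "has_root q"
    by (rule puiseux[OF AC]) (use lp' dp' p(5) in \<open>simp_all add: q_def\<close>)
  then obtain n Y where n: "n > 0" and Y: "poly (map_poly (cpow n) q) Y = 0" unfolding has_root_def by blast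
  define g where "g = map_poly (cpow n) p'"
  have g0: "poly g Y = 0"
  proof -
    have "map_poly (cpow n) q = smult (cpow n (inverse (lead_coeff p'))) g"
      unfolding q_def g_def by (rule poly_eqI) (simp add: coeff_map_poly)
    moreover have "cpow n (inverse (lead_coeff p')) \<noteq> 0" using lp' n by (simp add: cpow_eq_0_iff)
    ultimately show ?thesis using Y by simp
  qed
  have g: "prel (G2 n) p g"
  proof -
    have "G2 1 \<subseteq> {(a, b). (a, cpow n b) \<in> G2 n}"
    proof (intro least[OF one] pfield_preimage_cpow phom_pfield hG2 n)
      have "cpow n (fls_const a) = fls_const a" for a :: 'a using n by (simp add: cpow_def)
      then show "GK \<subseteq> {(a, b). (a, cpow n b) \<in> G2 n}"
        using subset_trans[OF sub1(1) sub2(1)[OF n]] unfolding GK_def by (auto simp: image_subset_iff)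
      have X: "cpow n (Xinf 1) = (Xinf n :: 'a fls)" unfolding Xinf_def by (simp only: cpow_simps(6)[OF n]) (simp add: mult.commute)
      then show "(x, Xinf 1) \<in> {(a, b). (a, cpow n b) \<in> G2 n}" using sub1(2)[of n] sub2[OF n] by auto
      have "cpow n (Uinf 1 w) = Uinf n w"
        unfolding Uinf_def using \<open>\<And>a. cpow n (fls_const a) = fls_const a\<close>
        by (simp only: cpow_simps(3) cpow_simps(6)[OF n]) (simp add: mult.commute)
      then show "(u, Uinf 1 w) \<in> {(a, b). (a, cpow n b) \<in> G2 n}" using sub2[OF n] by auto
    qed
    then show ?thesis using p' unfolding prel_def g_def by (auto simp: coeff_map_poly)
  qed
  note m = minr[OF n g]
  define G where "G = pext (G2 n) y Y"
  have pre3: "prehom (padj (G2 n) y Y)" by (rule min_rel_prehom[OF hG2[OF n] m g0])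
  have G: "phom G" unfolding G_def by (rule pext_phom[OF pre3])
  have sub3: "G2 n \<subseteq> G" "(y, Y) \<in> G"
    unfolding G_def using pext_subset[OF phom_pring[OF hG2[OF n]]] pext_mem[OF phom_pring[OF hG2[OF n]]] by blast+
  have derG: "(d1 f, d2 h) \<in> G" if fh: "(f, h) \<in> G" and d12: "derivation d1" "derivation d2"
    and c: "\<And>a. a \<in> K \<Longrightarrow> (d1 a, d2 (fls_const a)) \<in> G2 n" "(d1 x, d2 (Xinf n)) \<in> G2 n" "(d1 u, d2 (Uinf n w)) \<in> G2 n"
    for d1 d2 f h
  proof -
    have c2: "(d1 a, d2 b) \<in> G2 n" if "(a, b) \<in> G2 n" for a b
      by (rule der[OF n that d12 c])
    then have c3: "(d1 a, d2 b) \<in> G" if "(a, b) \<in> G2 n" for a b using sub3(1) that by blast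
    have "(d1 y, d2 Y) \<in> G"
      unfolding G_def by (rule min_rel_derivation[OF hG2[OF n] m g0 d12]) (use c3 in \<open>auto simp: G_def\<close>)
    then show ?thesis
      using pext_derivation[OF G d12 sub3(1) pre3 sub3(2) c3] fh unfolding G_def by blast
  qed
  have KG2: "(a, fls_const a) \<in> G2 n" if "a \<in> K" for a
    using that sub1(1)[of n] sub2(1)[OF n] unfolding GK_def by blast
  note r2 = phom_pring[OF hG2[OF n]]
  have 0: "(0, 0) \<in> G2 n" "(1, 1) \<in> G2 n" using pring_0[OF r2] pring_1[OF r2] by auto
  have X2: "(x, Xinf n) \<in> G2 n" "(u, Uinf n w) \<in> G2 n" using sub1(2) sub2[OF n] by blast+
  have PG: "(P f, Pinf n w e h) \<in> G" if "(f, h) \<in> G" for f h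
    by (rule derG[OF that P(1) derivation_Pinf[OF e(1)]])
       (use P generators_Pinf[OF e(1,3) n] e(2) 0 in auto)
  have QG: "(Q f, Qinf n e h) \<in> G" if "(f, h) \<in> G" for f h
    by (rule derG[OF that Q(1) derivation_Qinf[OF e(1)]])
       (use Q generators_Qinf[OF e(1,3)] e(2) 0 in auto)
  have DG: "(d f, Dinf n w t d e h) \<in> G" if "(f, h) \<in> G" for f h
  proof (rule derG[OF that d(1) derivation_Dinf[OF d(1) e(1)]])
    show "(d a, Dinf n w t d e (fls_const a)) \<in> G2 n" if "a \<in> K" for a
      using generators_Dinf(3)[OF d(1) w(2) e(1,3) n e(2)[OF that]] KG2 d(2)[OF that] by simp
    show "(d x, Dinf n w t d e (Xinf n)) \<in> G2 n"
      using generators_Dinf(1)[OF d(1) w(2) e(1,3) n] X2 u by simp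
    have "(6 * x ^ 2 + t, 6 * Xinf n ^ 2 + fls_const t) \<in> G2 n"
      by (intro pring_add pring_mult pring_power pring_numeral r2 X2 KG2 t)
    then show "(d u, Dinf n w t d e (Uinf n w)) \<in> G2 n"
      using generators_Dinf(2)[OF d(1) w(2) e(1,3) n] u by simp
  qed
  have "(a, fls_const a) \<in> G" if "a \<in> K" for a using KG2[OF that] sub3(1) by blast
  then show ?thesis
    using n G sub3(2) PG QG DG by (intro exI[of _ n] exI[of _ G] exI[of _ Y]) simp
qed

text \<open>
  At infinity the form \<open>dx \<and> du\<close> has weight 5 while \<open>dy \<and> dv\<close> has weight at most 3, so the
  constant Jacobian determinant vanishes.
\<close>

theorem no_algebraic_correspondence:
  fixes d :: "'a::field_char_0 \<Rightarrow> 'a"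
  assumes AC: "\<And>p :: 'a poly. degree p > 0 \<Longrightarrow> \<exists>z. poly p z = 0"
    and K: "field_set K" and d: "derivation d" "\<And>a. a \<in> K \<Longrightarrow> d a \<in> K" and t: "t \<in> K" "d t = 1"
    and c: "c \<in> K" and x: "\<not> alg K x" and u: "d x = u" "d u = 6 * x ^ 2 + t"
    and v: "d y = v" "d v = 2 * y ^ 3 + t * y + c"
    and y: "alg (fext (fext K x) u) y" and xy: "alg (fext (fext K y) v) x"
    and w: "\<not> alg K w" "d w = 0"
  shows False
proof -
  obtain P Q where P: "derivation P" "\<And>a. a \<in> K \<Longrightarrow> P a = 0" "P x = 1" "P u = 0"
    and Q: "derivation Q" "\<And>a. a \<in> K \<Longrightarrow> Q a = 0" "Q x = 0" "Q u = 1"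
    using coordinate_derivations[OF K x PI_not_alg[OF K d t x u]] by metis
  obtain e where e: "derivation e" "\<And>a. a \<in> K \<Longrightarrow> e a = 0" "e w = 1"
    using derivation_ex[OF K w(1)] by blast
  obtain n G Y where n: "n > 0" and G: "phom G" "(y, Y) \<in> G" "\<And>a. a \<in> K \<Longrightarrow> (a, fls_const a) \<in> G"
    and D': "\<And>f g. (f, g) \<in> G \<Longrightarrow> (d f, Dinf n w t d e g) \<in> G"
    and P': "\<And>f g. (f, g) \<in> G \<Longrightarrow> (P f, Pinf n w e g) \<in> G"
    and Q': "\<And>f g. (f, g) \<in> G \<Longrightarrow> (Q f, Qinf n e g) \<in> G"
    using correspondence_at_infinity[OF AC K d t x u y w P Q e] by blast
  note r = phom_pring[OF G(1)]
  define V where "V = Dinf n w t d e Y"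
  have V: "(v, V) \<in> G" using D'[OF G(2)] by (simp add: V_def v)
  have "(2 * y ^ 3 + t * y + c, Dinf n w t d e V) \<in> G" using D'[OF V] by (simp add: v)
  moreover have "(2 * y ^ 3 + t * y + c, 2 * Y ^ 3 + fls_const t * Y + fls_const c) \<in> G"
    by (intro pring_add pring_mult pring_power pring_numeral r G t c)
  ultimately have "Dinf n w t d e V = 2 * Y ^ 3 + fls_const t * Y + fls_const c"
    by (rule prehom_unique[OF phom_prehom[OF G(1)]])
  then have oY: "oge (- int n) Y" unfolding V_def by (rule PII_pole_order[OF d(1) e(1) n])
  have oV: "oge (- int n - int n) V" unfolding V_def by (rule oge_Dinf[OF d(1) e(1) oY])
  define J where "J = P y * Q v - Q y * P v"
  define J' where "J' = Pinf n w e Y * Qinf n e V - Qinf n e Y * Pinf n w e V"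
  have JJ: "(J, J') \<in> G"
    unfolding J_def J'_def by (intro pring_diff pring_mult r P' Q' G(2) V)
  \<comment> \<open>Both products have order at least \<open>2 n\<close>, from
    \<open>(- n + 2 n) + (- 2 n + 3 n)\<close> and
    \<open>(- n + 3 n) + (- 2 n + 2 n)\<close>.\<close>
  have oJ: "oge 1 J'"
    unfolding J'_def
    using n
    by (intro oge_diff oge_mult_le[OF oge_Pinf[OF e(1) oY] oge_Qinf[OF e(1) oV]]
        oge_mult_le[OF oge_Qinf[OF e(1) oY] oge_Pinf[OF e(1) oV]]) auto
  have Jalg: "alg K J" unfolding J_def by (rule jacobian_algebraic[OF K d t x u y v c P Q])
  \<comment> \<open>For nonzero \<open>J\<close> the minimal polynomial has a nonzero constant term
    \<open>a\<close>. But \<open>a = - J q(J)\<close> is mapped to a series of positive order,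
    whereas the image of \<open>a\<close> is a constant series.\<close>
  have J0: "J = 0"
  proof (rule ccontr)
    assume J: "J \<noteq> 0"
    obtain p where p: "p \<noteq> 0" "\<And>i. coeff p i \<in> K" "poly p J = 0"
      "\<And>q. (\<And>i. coeff q i \<in> K) \<Longrightarrow> q \<noteq> 0 \<Longrightarrow> degree q < degree p \<Longrightarrow> poly q J \<noteq> 0" "degree p > 0"
      using alg_min_poly[OF K Jalg] by metis
    obtain a q where pa: "p = pCons a q" by (cases p) auto
    have q: "\<And>i. coeff q i \<in> K" "q \<noteq> 0" "degree q < degree p" and aK: "a \<in> K"
      using p(2)[of "Suc i" for i] p(2)[of 0] p(5) unfolding pa by (auto split: if_splits)
    have a0: "a \<noteq> 0" using p(3) p(4)[OF q] J unfolding pa by auto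
    have pr: "prel G q (map_poly fls_const q)" using q(1) G(3) by (simp add: prel_def coeff_map_poly)
    have "(a + J * poly q J, fls_const a + J' * poly (map_poly fls_const q) J') \<in> G"
      by (intro pring_add pring_mult r G(3) aK JJ prel_poly[OF r pr])
    moreover have "a + J * poly q J = 0" using p(3) unfolding pa by simp
    ultimately have "fls_const a + J' * poly (map_poly fls_const q) J' = 0"
      using prehom_zero[OF phom_prehom[OF G(1)]] by simp
    moreover have "oge 0 (poly (map_poly fls_const q) J')"
    proof (induction q)
      case (pCons b q)
      have "oge 0 (J' * poly (map_poly fls_const q) J')" by (rule oge_mult_le[OF oJ pCons(2)]) simp
      then show ?case by (auto simp: map_poly_pCons intro: oge_add)
    qed auto
    then have "oge 1 (J' * poly (map_poly fls_const q) J')" by (rule oge_mult_le[OF oJ]) simp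
    then have "(J' * poly (map_poly fls_const q) J') $$ 0 = 0" by (simp add: oge_def)
    ultimately have "a = 0" by (metis add.right_neutral fls_const_nth fls_plus_nth fls_zero_nth)
    then show False using a0 by simp
  qed
  define L where "L = fext (fext K y) v"
  note Ky = fext_field[OF K, of y]
  have L: "field_set L" "K \<subseteq> L" "y \<in> L" "v \<in> L"
    unfolding L_def using fext_field[OF Ky] fext_subset[OF K] fext_subset[OF Ky] fext_mem[OF K] fext_mem[OF Ky]
    by blast+
  have xL: "alg L x" using xy by (simp add: L_def)
  have dL: "d z \<in> L" if "z \<in> L" for z
    unfolding L_def
  proof (rule fext2_stable[OF K d(1)])
    show "z \<in> fext (fext K y) v" using that by (simp add: L_def)
    show "d a \<in> fext (fext K y) v" if "a \<in> K" for a using d(2)[OF that] L(2) by (auto simp: L_def)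
    show "d y \<in> fext (fext K y) v" using L(4) v by (simp add: L_def)
    have "2 * y ^ 3 + t * y + c \<in> L"
      using L t c by (auto intro!: field_setD(1,2,8)[OF L(1)] field_set_numeral[OF L(1)])
    then show "d v \<in> fext (fext K y) v" unfolding v L_def .
  qed
  have uL: "alg L u" using alg_derivation[OF L(1) d(1) dL xL] u by simp
  \<comment> \<open>A derivation \<open>p P + q Q\<close> that kills \<open>y\<close> and
    \<open>v\<close> kills \<open>K(y, v)\<close> and hence \<open>x\<close> and \<open>u\<close>,
    which are algebraic over it. Its values at \<open>x\<close> and \<open>u\<close> are
    \<open>p\<close> and \<open>q\<close>.\<close>
  have kill: "q = 0 \<and> p = 0"
    if pq: "p * P y + q * Q y = 0" "p * P v + q * Q v = 0" for p q
  proof -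
    let ?e = "\<lambda>z. p * P z + q * Q z"
    have E: "derivation ?e" by (rule derivation_lincomb[OF P(1) Q(1)])
    have "L \<subseteq> {a. ?e a = 0}"
      unfolding L_def using P(2) Q(2) pq
      by (intro fext_least Ky K field_set_kernel E) auto
    then have z: "?e a = 0" if "a \<in> L" for a using that by blast
    have "?e x = 0" "?e u = 0"
      by (rule derivation_alg[OF E L(1) z xL] derivation_alg[OF E L(1) z uL], assumption)+
    then show ?thesis using P Q by simp
  qed
  \<comment> \<open>Since the determinant vanishes, \<open>p = Q y\<close>, \<open>q = - P y\<close>
    and \<open>p = Q v\<close>, \<open>q = - P v\<close> both satisfy the two equations of
    \<open>kill\<close>.\<close>
  have "Q v = 0 \<and> Q y = 0"
  proof -
    have "- P y = 0 \<and> Q y = 0" by (rule kill) (use J0 in \<open>simp_all add: J_def algebra_simps\<close>)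
    moreover have "- P v = 0 \<and> Q v = 0" by (rule kill) (use J0 in \<open>simp_all add: J_def algebra_simps\<close>)
    ultimately show ?thesis by simp
  qed
  then show False using kill[of 0 1] by simp
qed

section \<open>Saturated differentially closed fields\<close>

abbreviation lkp :: "('c \<Rightarrow>\<^sub>0 'b::zero) \<Rightarrow> 'c \<Rightarrow> 'b" where "lkp \<equiv> Poly_Mapping.lookup"

definition mon_eval :: "('a::field_char_0 \<Rightarrow> 'a) \<Rightarrow> (nat \<Rightarrow>\<^sub>0 nat) \<Rightarrow> 'a \<Rightarrow> 'a" where
  "mon_eval d m x = (\<Prod>i\<in>Poly_Mapping.keys m. ((d ^^ i) x) ^ lkp m i)"

lemma mon_eval_superset:
  assumes "finite S" "Poly_Mapping.keys m \<subseteq> S"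
  shows "mon_eval d m x = (\<Prod>i\<in>S. ((d ^^ i) x) ^ lkp m i)"
  unfolding mon_eval_def using assms by (intro prod.mono_neutral_left) (auto simp: in_keys_iff)

lemma mon_eval_add: "mon_eval d (m + m') x = mon_eval d m x * mon_eval d m' x"
proof -
  let ?S = "Poly_Mapping.keys m \<union> Poly_Mapping.keys m'"
  have "mon_eval d (m + m') x = (\<Prod>i\<in>?S. ((d ^^ i) x) ^ lkp (m + m') i)"
    by (rule mon_eval_superset) (use keys_add[of m m'] in auto)
  also have "\<dots> = (\<Prod>i\<in>?S. ((d ^^ i) x) ^ lkp m i) * (\<Prod>i\<in>?S. ((d ^^ i) x) ^ lkp m' i)"
    by (simp add: lookup_add power_add prod.distrib)
  also have "\<dots> = mon_eval d m x * mon_eval d m' x"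
    using mon_eval_superset[of ?S m d x] mon_eval_superset[of ?S m' d x] by simp
  finally show ?thesis .
qed

lemma dp_eval_mon: "dp_eval d p x = (\<Sum>m\<in>Poly_Mapping.keys p. lkp p m * mon_eval d m x)"
  by (simp add: dp_eval_def mon_eval_def)

lemma dp_eval_superset:
  assumes "finite S" "Poly_Mapping.keys p \<subseteq> S"
  shows "dp_eval d p x = (\<Sum>m\<in>S. lkp p m * mon_eval d m x)"
  unfolding dp_eval_mon using assms by (intro sum.mono_neutral_left) (auto simp: in_keys_iff)

lemma dp_eval_add: "dp_eval d (p + q) x = dp_eval d p x + dp_eval d q x"
proof -
  let ?S = "Poly_Mapping.keys p \<union> Poly_Mapping.keys q"
  have "dp_eval d (p + q) x = (\<Sum>m\<in>?S. lkp (p + q) m * mon_eval d m x)"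
    by (rule dp_eval_superset) (use keys_add[of p q] in auto)
  also have "\<dots> = (\<Sum>m\<in>?S. lkp p m * mon_eval d m x) + (\<Sum>m\<in>?S. lkp q m * mon_eval d m x)"
    by (simp add: lookup_add algebra_simps sum.distrib)
  finally show ?thesis using dp_eval_superset[of ?S p d x] dp_eval_superset[of ?S q d x] by simp
qed

lemma dp_eval_0 [simp]: "dp_eval d 0 x = 0"
  by (simp add: dp_eval_mon)

lemma dp_eval_sum: "dp_eval d (sum f A) x = (\<Sum>i\<in>A. dp_eval d (f i) x)"
  by (induction A rule: infinite_finite_induct) (auto simp: dp_eval_add)

lemma dp_eval_single: "dp_eval d (Poly_Mapping.single m c) x = c * mon_eval d m x"
  by (simp add: dp_eval_mon)

lemma dp_sum_singles:
  assumes "finite S" "Poly_Mapping.keys p \<subseteq> S"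
  shows "p = (\<Sum>m\<in>S. Poly_Mapping.single m (lkp p m))"
proof (rule poly_mapping_eqI)
  fix k
  have "(\<Sum>m\<in>S. lkp (Poly_Mapping.single m (lkp p m)) k) = (\<Sum>m\<in>S. if m = k then lkp p k else 0)"
    by (intro sum.cong) (auto simp: lookup_single)
  also have "\<dots> = lkp p k" using assms by (auto simp: in_keys_iff)
  finally show "lkp p k = lkp (\<Sum>m\<in>S. Poly_Mapping.single m (lkp p m)) k" by (simp add: lookup_sum)
qed

lemma dp_mult_singles:
  fixes p q :: "'a::comm_ring_1 diff_poly"
  assumes "finite S" "Poly_Mapping.keys p \<subseteq> S" "finite T" "Poly_Mapping.keys q \<subseteq> T"
  shows "p * q = (\<Sum>m\<in>S. \<Sum>k\<in>T. Poly_Mapping.single (m + k) (lkp p m * lkp q k))"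
  using dp_sum_singles[OF assms(1,2)] dp_sum_singles[OF assms(3,4)]
  by (metis (no_types, lifting) mult_single sum.cong sum_product)

lemma dp_eval_mult: "dp_eval d (p * q) x = dp_eval d p x * dp_eval d q x"
proof -
  have "dp_eval d (p * q) x = (\<Sum>m\<in>Poly_Mapping.keys p. \<Sum>k\<in>Poly_Mapping.keys q.
      (lkp p m * mon_eval d m x) * (lkp q k * mon_eval d k x))"
    unfolding dp_mult_singles[OF finite_keys subset_refl finite_keys subset_refl, of p q]
    by (simp add: dp_eval_sum dp_eval_single mon_eval_add algebra_simps)
  then show ?thesis by (simp add: dp_eval_mon sum_product)
qed

lemma mon_eval_0 [simp]: "mon_eval d 0 x = 1"
  by (simp add: mon_eval_def)

lemma dp_eval_1 [simp]: "dp_eval d 1 x = 1"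
  using dp_eval_single[of d 0 1 x] by simp

lemma dp_eval_prod: "dp_eval d (prod f A) x = (\<Prod>i\<in>A. dp_eval d (f i) x)"
  by (induction A rule: infinite_finite_induct) (auto simp: dp_eval_mult)

definition dpX :: "nat \<Rightarrow> 'a::comm_ring_1 diff_poly" where
  "dpX n = Poly_Mapping.single (Poly_Mapping.single n 1) 1"

lemma dp_eval_dpX [simp]: "dp_eval d (dpX n) x = (d ^^ n) x"
  by (simp add: dpX_def dp_eval_single mon_eval_def)

lemma dpX_power: "dpX n ^ j = Poly_Mapping.single (Poly_Mapping.single n j) (1 :: 'a::comm_ring_1)"
  by (induction j) (simp_all add: dpX_def mult_single flip: single_add)

lemma dp_eval_poly: "dp_eval d (poly C (dpX n)) x = poly (map_poly (\<lambda>c. dp_eval d c x) C) ((d ^^ n) x)"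
  by (induction C) (simp_all add: map_poly_pCons dp_eval_add dp_eval_mult)

definition vars_in :: "nat set \<Rightarrow> 'a::zero diff_poly \<Rightarrow> bool" where
  "vars_in N p \<longleftrightarrow> (\<forall>m. lkp p m \<noteq> 0 \<longrightarrow> Poly_Mapping.keys m \<subseteq> N)"

definition coeffs_in :: "'a::zero set \<Rightarrow> 'a diff_poly \<Rightarrow> bool" where
  "coeffs_in E p \<longleftrightarrow> (\<forall>m. lkp p m \<in> E)"

definition dprel :: "('a::zero \<times> 'b::zero) set \<Rightarrow> 'a diff_poly \<Rightarrow> 'b diff_poly \<Rightarrow> bool" where
  "dprel G p q \<longleftrightarrow> (\<forall>m. (lkp p m, lkp q m) \<in> G)"

lemma vars_in_dp_vars: "vars_in N p \<longleftrightarrow> dp_vars p \<subseteq> N"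
  unfolding vars_in_def dp_vars_def UN_subset_iff Ball_def lookup_not_eq_zero_eq_in_keys ..

lemma vars_in_add: "vars_in N p \<Longrightarrow> vars_in N q \<Longrightarrow> vars_in N (p + q :: 'a::comm_ring_1 diff_poly)"
  unfolding vars_in_def by (metis add.right_neutral lookup_add)

lemma vars_in_0 [simp]: "vars_in N 0"
  by (simp add: vars_in_def)

lemma vars_in_sum: "(\<And>i. i \<in> A \<Longrightarrow> vars_in N (f i)) \<Longrightarrow> vars_in N (sum f A :: 'a::comm_ring_1 diff_poly)"
  by (induction A rule: infinite_finite_induct) (auto intro: vars_in_add)

lemma vars_in_single: "Poly_Mapping.keys m \<subseteq> N \<Longrightarrow> vars_in N (Poly_Mapping.single m c)"
  by (auto simp: vars_in_def lookup_single when_def)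

lemma vars_in_mult:
  fixes p q :: "'a::comm_ring_1 diff_poly"
  assumes "vars_in N p" "vars_in N q" shows "vars_in N (p * q)"
  unfolding dp_mult_singles[OF finite_keys subset_refl finite_keys subset_refl, of p q]
proof (intro vars_in_sum vars_in_single)
  fix m k assume "m \<in> Poly_Mapping.keys p" "k \<in> Poly_Mapping.keys q"
  then have "Poly_Mapping.keys m \<subseteq> N" "Poly_Mapping.keys k \<subseteq> N"
    using assms unfolding vars_in_def lookup_not_eq_zero_eq_in_keys by blast+
  then show "Poly_Mapping.keys (m + k) \<subseteq> N" using keys_add[of m k] by blast
qed

lemma vars_in_1: "vars_in N (1 :: 'a::comm_ring_1 diff_poly)"
  using vars_in_single[of 0 N "1 :: 'a"] by simp

lemma vars_in_prod: "(\<And>i. i \<in> A \<Longrightarrow> vars_in N (f i)) \<Longrightarrow> vars_in N (prod f A :: 'a::comm_ring_1 diff_poly)"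
  by (induction A rule: infinite_finite_induct) (auto intro: vars_in_mult vars_in_1)

lemma dprel_sum: "pring G \<Longrightarrow> (\<And>i. i \<in> A \<Longrightarrow> dprel G (f i) (g i)) \<Longrightarrow> dprel G (sum f A) (sum g A)"
  unfolding dprel_def lookup_sum by (auto intro: pring_sum)

lemma dprel_single: "pring G \<Longrightarrow> (a, b) \<in> G \<Longrightarrow> dprel G (Poly_Mapping.single m a) (Poly_Mapping.single m b)"
  unfolding dprel_def by (auto simp: lookup_single when_def pring_0)

lemma dprel_add: "pring G \<Longrightarrow> dprel G p q \<Longrightarrow> dprel G p' q' \<Longrightarrow> dprel G (p + p') (q + q')"
  unfolding dprel_def lookup_add by (auto intro: pring_add)

lemma dprel_mult:
  fixes p p' :: "'a::field diff_poly" and q q' :: "'b::comm_ring_1 diff_poly"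
  assumes "pring G" "dprel G p q" "dprel G p' q'"
  shows "dprel G (p * p') (q * q')"
proof -
  let ?S = "Poly_Mapping.keys p \<union> Poly_Mapping.keys q" and ?T = "Poly_Mapping.keys p' \<union> Poly_Mapping.keys q'"
  have 1: "p * p' = (\<Sum>m\<in>?S. \<Sum>k\<in>?T. Poly_Mapping.single (m + k) (lkp p m * lkp p' k))"
    and 2: "q * q' = (\<Sum>m\<in>?S. \<Sum>k\<in>?T. Poly_Mapping.single (m + k) (lkp q m * lkp q' k))"
    by (rule dp_mult_singles; simp)+
  show ?thesis unfolding 1 2
    using assms by (intro dprel_sum dprel_single pring_mult) (auto simp: dprel_def)
qed

lemma dprel_nonzero: "prehom G \<Longrightarrow> dprel G p q \<Longrightarrow> lkp p m = 0 \<longleftrightarrow> lkp q m = 0"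
  using prehom_nz by (auto simp: dprel_def)

lemma dprel_zero_iff: "prehom G \<Longrightarrow> dprel G p q \<Longrightarrow> p = 0 \<longleftrightarrow> q = 0"
  by (simp add: poly_mapping_eq_iff fun_eq_iff dprel_nonzero)

lemma dprel_vars: "prehom G \<Longrightarrow> dprel G p q \<Longrightarrow> vars_in N p \<longleftrightarrow> vars_in N q"
  by (simp add: vars_in_def dprel_nonzero)

lemma dprel_ex:
  fixes G :: "('a::field \<times> 'b::comm_ring_1) set"
  assumes "pring G" "coeffs_in (Domain G) p"
  shows "\<exists>q. dprel G p q"
proof -
  have "\<forall>m. \<exists>y. (lkp p m, y) \<in> G"
    using assms unfolding coeffs_in_def by (metis DomainE)
  then obtain f where f: "\<And>m. (lkp p m, f m) \<in> G" by metis
  have "dprel G (\<Sum>m\<in>Poly_Mapping.keys p. Poly_Mapping.single m (lkp p m))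
      (\<Sum>m\<in>Poly_Mapping.keys p. Poly_Mapping.single m (f m))"
    using f by (intro dprel_sum dprel_single assms) auto
  then show ?thesis using dp_sum_singles[OF finite_keys subset_refl, of p] by metis
qed

text \<open>The counterpart of \<open>padj\<close> for differential polynomials in the derivatives
  with index in \<open>N\<close>. Taking \<open>N = UNIV\<close> gives the generated differential
  ring; \<open>N = {..<n}\<close> gives the part below the order of a minimal equation.\<close>

definition Rset :: "('a::field_char_0 \<Rightarrow> 'a) \<Rightarrow> ('a \<times> 'a) set \<Rightarrow> nat set \<Rightarrow> 'a \<Rightarrow> 'a \<Rightarrow> ('a \<times> 'a) set" where
  "Rset d G N a a' = {(dp_eval d P a, dp_eval d P' a') | P P'. dprel G P P' \<and> vars_in N P}"

lemma RsetI: "dprel G P P' \<Longrightarrow> vars_in N P \<Longrightarrow> (dp_eval d P a, dp_eval d P' a') \<in> Rset d G N a a'"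
  unfolding Rset_def by blast

lemma Rset_subset: "pring G \<Longrightarrow> G \<subseteq> Rset d G N a a'"
proof clarify
  fix x y assume "pring G" "(x, y) \<in> G"
  then show "(x, y) \<in> Rset d G N a a'"
    using RsetI[OF dprel_single vars_in_single, of G x y 0 N d a a'] by (simp add: dp_eval_single)
qed

lemma Rset_mem:
  assumes "pring G" "i \<in> N" shows "((d ^^ i) a, (d ^^ i) a') \<in> Rset d G N a a'"
proof -
  have "vars_in N (dpX i :: 'a diff_poly)" unfolding dpX_def using assms(2) by (intro vars_in_single) simp
  moreover have "dprel G (dpX i) (dpX i)" unfolding dpX_def by (intro dprel_single pring_1 assms)
  ultimately show ?thesis using RsetI[of G "dpX i" "dpX i" N d a a'] by simp
qed

lemma Rset_pring:
  assumes G: "pring G" shows "pring (Rset d G N a a')"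
  unfolding pring_def
proof (intro conjI allI impI)
  show "(1, 1) \<in> Rset d G N a a'" using Rset_subset[OF G] pring_1[OF G] by blast
next
  fix x y x' y' assume "(x, y) \<in> Rset d G N a a'" "(x', y') \<in> Rset d G N a a'"
  then obtain P Q P' Q' where *: "x = dp_eval d P a" "y = dp_eval d Q a'" "dprel G P Q" "vars_in N P"
    "x' = dp_eval d P' a" "y' = dp_eval d Q' a'" "dprel G P' Q'" "vars_in N P'" by (auto simp: Rset_def)
  show "(x + x', y + y') \<in> Rset d G N a a'" "(x * x', y * y') \<in> Rset d G N a a'"
    using RsetI[OF dprel_add[OF G *(3,7)] vars_in_add[OF *(4,8)], of d a a']
      RsetI[OF dprel_mult[OF G *(3,7)] vars_in_mult[OF *(4,8)], of d a a'] *
    by (simp_all add: dp_eval_add dp_eval_mult)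
next
  fix x y assume "(x, y) \<in> Rset d G N a a'"
  then obtain P Q where *: "x = dp_eval d P a" "y = dp_eval d Q a'" "dprel G P Q" "vars_in N P"
    by (auto simp: Rset_def)
  have "(-1, -1) \<in> G" using pring_minus[OF G pring_1[OF G]] .
  from RsetI[OF dprel_mult[OF G dprel_single[OF G this] *(3)] vars_in_mult[OF vars_in_single *(4)], of 0 d a a']
  show "(- x, - y) \<in> Rset d G N a a'" using * by (simp add: dp_eval_mult dp_eval_single)
qed

lemma Rset_least:
  assumes G: "prehom G" and Z: "pring Z" "G \<subseteq> Z" "\<And>i. i \<in> N \<Longrightarrow> ((d ^^ i) a, (d ^^ i) a') \<in> Z"
  shows "Rset d G N a a' \<subseteq> Z"
proof clarify
  fix x y assume "(x, y) \<in> Rset d G N a a'"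
  then obtain P Q where *: "x = dp_eval d P a" "y = dp_eval d Q a'" "dprel G P Q" "vars_in N P"
    by (auto simp: Rset_def)
  let ?S = "Poly_Mapping.keys P \<union> Poly_Mapping.keys Q"
  have t: "(lkp P m * mon_eval d m a, lkp Q m * mon_eval d m a') \<in> Z" for m
  proof (cases "lkp P m = 0")
    case False
    have "(mon_eval d m a, mon_eval d m a') \<in> Z"
      unfolding mon_eval_def using False *(4) Z(3)
      by (intro pring_prod pring_power Z(1)) (auto simp: vars_in_def)
    then show ?thesis using *(3) Z(2) unfolding dprel_def by (intro pring_mult Z(1)) auto
  next
    case True
    then show ?thesis using dprel_nonzero[OF G *(3), of m] pring_0[OF Z(1)] by simp
  qed
  have "dp_eval d P a = (\<Sum>m\<in>?S. lkp P m * mon_eval d m a)" "dp_eval d Q a' = (\<Sum>m\<in>?S. lkp Q m * mon_eval d m a')"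
    by (rule dp_eval_superset; simp)+
  then show "(x, y) \<in> Z" using * t by (auto intro!: pring_sum Z(1))
qed

section \<open>Countable partial differential homomorphisms\<close>

lemma countable_closure:
  fixes fs :: "('c \<Rightarrow> 'c \<Rightarrow> 'c) set"
  assumes A: "countable A" and fs: "finite fs"
  shows "\<exists>B. A \<subseteq> B \<and> countable B \<and> (\<forall>f\<in>fs. \<forall>x\<in>B. \<forall>y\<in>B. f x y \<in> B)"
proof -
  define S where "S X = X \<union> (\<Union>f\<in>fs. (\<lambda>(x, y). f x y) ` (X \<times> X))" for X
  define T where "T n = (S ^^ n) A" for n
  have T_Suc: "T (Suc n) = S (T n)" for n by (simp add: T_def)
  have "countable (T n)" for n
  proof (induction n)
    case 0
    show ?case using A by (simp add: T_def)
  next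
    case (Suc n)
    then show ?case unfolding T_Suc S_def using countable_finite[OF fs]
      by (auto intro!: countable_Un countable_UN countable_image countable_SIGMA)
  qed
  moreover have mono: "T m \<subseteq> T n" if "m \<le> n" for m n
    by (rule lift_Suc_mono_le[OF _ that]) (auto simp: T_Suc S_def)
  have "f x y \<in> (\<Union>n. T n)" if fxy: "f \<in> fs" "x \<in> (\<Union>n. T n)" "y \<in> (\<Union>n. T n)" for f x y
  proof -
    obtain m n where "x \<in> T m" "y \<in> T n" using fxy by blast
    then have "x \<in> T (max m n)" "y \<in> T (max m n)" using mono[of m "max m n"] mono[of n "max m n"] by auto
    then have "f x y \<in> T (Suc (max m n))" using fxy(1) unfolding T_Suc S_def by blast
    then show ?thesis by blast
  qed
  moreover have "A \<subseteq> (\<Union>n. T n)"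
  proof -
    have "T 0 = A" by (simp add: T_def)
    then show ?thesis by blast
  qed
  ultimately show ?thesis by (intro exI[of _ "\<Union>n. T n"]) auto
qed

definition dphom :: "('a::field_char_0 \<Rightarrow> 'a) \<Rightarrow> ('a \<times> 'a) set \<Rightarrow> bool" where
  "dphom d G \<longleftrightarrow> phom G \<and> (\<forall>a b. (a, b) \<in> G \<longrightarrow> (d a, d b) \<in> G)"

text \<open>Saturation is applied over countable sets of parameters, so graphs are cut down to
  countable ones that are still closed under the field operations and \<open>d\<close>.\<close>

lemma dphom_countable_subset:
  fixes G :: "('a::field_char_0 \<times> 'a) set"
  assumes G: "dphom d G" and A: "A \<subseteq> G" "countable A"
  shows "\<exists>G'. A \<subseteq> G' \<and> G' \<subseteq> G \<and> countable G' \<and> dphom d G'"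
proof -
  have h: "phom G" and dG: "\<And>a b. (a, b) \<in> G \<Longrightarrow> (d a, d b) \<in> G" using G by (auto simp: dphom_def)
  note r = phom_pring[OF h]
  \<comment> \<open>The unary operations ignore their second argument, to fit the binary format of
    \<open>countable_closure\<close>.\<close>
  define fs where "fs = {\<lambda>p q. (fst p + fst q, snd p + snd q), \<lambda>p q. (fst p * fst q, snd p * snd q),
    \<lambda>p q. (- fst p, - snd p), \<lambda>p q. (inverse (fst p), inverse (snd p)), \<lambda>p q. (d (fst p), d (snd p))}"
  have "finite fs" by (simp add: fs_def)
  then obtain B where B: "insert (1, 1) A \<subseteq> B" "countable B" "\<forall>f\<in>fs. \<forall>x\<in>B. \<forall>y\<in>B. f x y \<in> B"
    using countable_closure[of "insert (1, 1) A" fs] A(2) by blast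
  have cl: "(a + a', b + b') \<in> B" "(a * a', b * b') \<in> B" "(- a, - b) \<in> B"
    "(inverse a, inverse b) \<in> B" "(d a, d b) \<in> B" if "(a, b) \<in> B" "(a', b') \<in> B" for a b a' b'
  proof -
    have "\<forall>f\<in>fs. f (a, b) (a', b') \<in> B" using B(3) that by blast
    then show "(a + a', b + b') \<in> B" "(a * a', b * b') \<in> B" "(- a, - b) \<in> B"
      "(inverse a, inverse b) \<in> B" "(d a, d b) \<in> B" unfolding fs_def by simp_all
  qed
  define H where "H = G \<inter> B"
  have Hr: "pring H"
    unfolding pring_def H_def using pring_1[OF r] pring_add[OF r] pring_mult[OF r] pring_minus[OF r] B(1) cl by auto
  have "prehom H"
    by (rule prehom_fieldI[OF Hr]) (use prehom_nz[OF phom_prehom[OF h]] in \<open>auto simp: H_def\<close>)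
  moreover have "(inverse a, b') \<in> H" if "(a, b) \<in> H" "b * b' = 1" for a b b'
  proof -
    have "b' = inverse b" using that(2) by (simp add: inverse_unique)
    then show ?thesis
      using that pfield_inverse[OF phom_pfield[OF h], of a b b'] cl(4) unfolding H_def by auto
  qed
  ultimately have "phom H" using Hr by (auto simp: phom_def pfield_def)
  moreover have "(d a, d b) \<in> H" if "(a, b) \<in> H" for a b using that dG cl(5) unfolding H_def by blast
  ultimately have "dphom d H" by (simp add: dphom_def)
  moreover have "A \<subseteq> H" "H \<subseteq> G" "countable H" using A(1) B(1,2) by (auto simp: H_def)
  ultimately show ?thesis by blast
qed

lemma dphom_converse:
  assumes "dphom d G" shows "dphom d (G\<inverse>)"
proof -
  have h: "phom G" and dG: "\<And>a b. (a, b) \<in> G \<Longrightarrow> (d a, d b) \<in> G" using assms by (auto simp: dphom_def)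
  note r = phom_pring[OF h]
  have Hr: "pring (G\<inverse>)"
    unfolding pring_def using pring_1[OF r] pring_add[OF r] pring_mult[OF r] pring_minus[OF r] by auto
  have pre: "prehom (G\<inverse>)"
    by (rule prehom_fieldI[OF Hr]) (use prehom_nz[OF phom_prehom[OF h]] in auto)
  have "(inverse a, b') \<in> G\<inverse>" if "(a, b) \<in> G\<inverse>" "b * b' = 1" for a b b'
  proof -
    have b': "b' = inverse b" using that(2) by (simp add: inverse_unique)
    have "b \<noteq> 0" using that(2) by auto
    then have "a \<noteq> 0" using that(1) prehom_nz[OF phom_prehom[OF h], of b a] by auto
    then have "(inverse b, inverse a) \<in> G"
      using that(1) by (intro pfield_inverse[OF phom_pfield[OF h], of b a]) auto
    then show ?thesis by (simp add: b')
  qed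
  then show ?thesis using Hr pre dG unfolding dphom_def phom_def pfield_def by auto
qed

lemma dphom_Id_on:
  assumes "field_set E" "\<And>a. a \<in> E \<Longrightarrow> d a \<in> E" shows "dphom d (Id_on E)"
  using Id_on_phom[OF assms(1)] assms(2) by (auto simp: dphom_def)

lemma countable_diff_field:
  fixes d :: "'a::field_char_0 \<Rightarrow> 'a"
  assumes E: "field_set E" "\<And>a. a \<in> E \<Longrightarrow> d a \<in> E" and A: "countable A" "A \<subseteq> E"
  shows "\<exists>K. A \<subseteq> K \<and> K \<subseteq> E \<and> countable K \<and> field_set K \<and> (\<forall>a\<in>K. d a \<in> K)"
proof -
  obtain G where G: "Id_on A \<subseteq> G" "G \<subseteq> Id_on E" "countable G" "dphom d G"
  proof -
    have "Id_on A \<subseteq> Id_on E" "countable (Id_on A)" using A by (auto simp: Id_on_def)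
    moreover have "dphom d (Id_on E)" by (rule dphom_Id_on[OF E])
    ultimately have "\<exists>G. Id_on A \<subseteq> G \<and> G \<subseteq> Id_on E \<and> countable G \<and> dphom d G"
      by (intro dphom_countable_subset)
    then show ?thesis using that by blast
  qed
  have dG: "(d a, d b) \<in> G" if "(a, b) \<in> G" for a b using G(4) that by (simp add: dphom_def)
  have "field_set (Domain G)" using G(4) by (intro field_set_Domain) (simp add: dphom_def)
  moreover have "countable (Domain G)" using G(3) by (simp add: Domain_fst)
  moreover have "d a \<in> Domain G" if "a \<in> Domain G" for a using that dG by blast
  ultimately show ?thesis using G(1,2) by (intro exI[of _ "Domain G"]) blast
qed

section \<open>Realizing equations and inequations by saturation\<close>

definition term_fun :: "('a::field_char_0 \<Rightarrow> 'a) \<Rightarrow> 'a set \<Rightarrow> ('a \<Rightarrow> 'a) \<Rightarrow> bool" where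
  "term_fun d C f \<longleftrightarrow> (\<exists>s. (\<forall>x. term_val d (\<lambda>_. x) s = f x) \<and> term_fv s \<subseteq> {0} \<and> term_params s \<subseteq> C)"

lemma term_fun_const: "c \<in> C \<Longrightarrow> term_fun d C (\<lambda>_. c)"
  unfolding term_fun_def by (intro exI[of _ "Param c"]) auto

lemma term_fun_0: "term_fun d C (\<lambda>_. 0)"
  unfolding term_fun_def by (intro exI[of _ Zero]) auto

lemma term_fun_1: "term_fun d C (\<lambda>_. 1)"
  unfolding term_fun_def by (intro exI[of _ One]) auto

lemma term_fun_add:
  assumes "term_fun d C f" "term_fun d C g" shows "term_fun d C (\<lambda>x. f x + g x)"
proof -
  obtain s u where "\<forall>x. term_val d (\<lambda>_. x) s = f x" "term_fv s \<subseteq> {0}" "term_params s \<subseteq> C"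
    "\<forall>x. term_val d (\<lambda>_. x) u = g x" "term_fv u \<subseteq> {0}" "term_params u \<subseteq> C"
    using assms unfolding term_fun_def by blast
  then show ?thesis unfolding term_fun_def by (intro exI[of _ "Add s u"]) auto
qed

lemma term_fun_mult:
  assumes "term_fun d C f" "term_fun d C g" shows "term_fun d C (\<lambda>x. f x * g x)"
proof -
  obtain s u where "\<forall>x. term_val d (\<lambda>_. x) s = f x" "term_fv s \<subseteq> {0}" "term_params s \<subseteq> C"
    "\<forall>x. term_val d (\<lambda>_. x) u = g x" "term_fv u \<subseteq> {0}" "term_params u \<subseteq> C"
    using assms unfolding term_fun_def by blast
  then show ?thesis unfolding term_fun_def by (intro exI[of _ "Mul s u"]) auto
qed

lemma term_fun_iter: "term_fun d C (\<lambda>x. (d ^^ i) x)"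
  unfolding term_fun_def
proof (intro exI conjI allI)
  show "term_val d (\<lambda>_. x) ((Der ^^ i) (Var 0)) = (d ^^ i) x" for x by (induction i) auto
  show "term_fv ((Der ^^ i) (Var 0)) \<subseteq> {0}" by (induction i) auto
  show "term_params ((Der ^^ i) (Var 0)) \<subseteq> C" by (induction i) auto
qed

lemma term_fun_power: "term_fun d C f \<Longrightarrow> term_fun d C (\<lambda>x. f x ^ n)"
  by (induction n) (auto intro: term_fun_1 term_fun_mult)

lemma term_fun_sum: "(\<And>i. i \<in> A \<Longrightarrow> term_fun d C (f i)) \<Longrightarrow> term_fun d C (\<lambda>x. \<Sum>i\<in>A. f i x)"
  by (induction A rule: infinite_finite_induct) (auto intro: term_fun_0 term_fun_add)

lemma term_fun_prod: "(\<And>i. i \<in> A \<Longrightarrow> term_fun d C (f i)) \<Longrightarrow> term_fun d C (\<lambda>x. \<Prod>i\<in>A. f i x)"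
  by (induction A rule: infinite_finite_induct) (auto intro: term_fun_1 term_fun_mult)

lemma dp_eval_term_fun: "coeffs_in C p \<Longrightarrow> term_fun d C (dp_eval d p)"
  unfolding dp_eval_mon mon_eval_def[abs_def] coeffs_in_def
  by (intro term_fun_sum term_fun_mult term_fun_prod term_fun_power term_fun_iter term_fun_const) auto

locale saturated_DCF0 = DCF0 d for d :: "'a::field_char_0 \<Rightarrow> 'a" +
  assumes sat: "saturated d" and unc: "uncountable (UNIV :: 'a set)"
begin

lemma derivation_d: "derivation d"
  by (intro derivationI d_add d_mult)

text \<open>Saturation for formulas together with inequations. A finite subset involves only
  finitely many of the inequations, and a countable set of parameters is smaller than the
  uncountable universe.\<close>

lemma realize:
  assumes C: "countable C" and \<Phi>: "\<And>\<phi>. \<phi> \<in> \<Phi> \<Longrightarrow> params \<phi> \<subseteq> C \<and> fv \<phi> \<subseteq> {0}"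
    and \<G>: "\<And>g. g \<in> \<G> \<Longrightarrow> coeffs_in C g"
    and fin: "\<And>S. finite S \<Longrightarrow> S \<subseteq> \<G> \<Longrightarrow>
      \<exists>x. (\<forall>\<phi>\<in>\<Phi>. holds d (\<lambda>_. x) \<phi>) \<and> (\<forall>g\<in>S. dp_eval d g x \<noteq> 0)"
  shows "\<exists>x. (\<forall>\<phi>\<in>\<Phi>. holds d (\<lambda>_. x) \<phi>) \<and> (\<forall>g\<in>\<G>. dp_eval d g x \<noteq> 0)"
proof -
  have "\<forall>g. \<exists>s. g \<in> \<G> \<longrightarrow> (\<forall>x. term_val d (\<lambda>_. x) s = dp_eval d g x) \<and> term_fv s \<subseteq> {0} \<and> term_params s \<subseteq> C"
    using dp_eval_term_fun[OF \<G>] unfolding term_fun_def by blast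
  then obtain tm where tm: "\<And>g x. g \<in> \<G> \<Longrightarrow> term_val d (\<lambda>_. x) (tm g) = dp_eval d g x"
    "\<And>g. g \<in> \<G> \<Longrightarrow> term_fv (tm g) \<subseteq> {0}" "\<And>g. g \<in> \<G> \<Longrightarrow> term_params (tm g) \<subseteq> C" by metis
  define ne where "ne g = Neg (Eq (tm g) Zero)" for g
  have ne: "holds d (\<lambda>_. x) (ne g) \<longleftrightarrow> dp_eval d g x \<noteq> 0" if "g \<in> \<G>" for g x
    using tm(1)[OF that] by (simp add: ne_def)
  have "C \<prec> (UNIV :: 'a set)"
    unfolding lesspoll_def using subset_imp_lepoll[of C UNIV] C unc
    by (auto simp: eqpoll_def dest: countable_image_inj_on bij_betw_imp_inj_on bij_betw_imp_surj_on
        intro: countable_lepoll)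
  moreover have "\<forall>\<phi>\<in>\<Phi> \<union> ne ` \<G>. params \<phi> \<subseteq> C \<and> fv \<phi> \<subseteq> {0}"
  proof
    fix \<phi> assume "\<phi> \<in> \<Phi> \<union> ne ` \<G>"
    then show "params \<phi> \<subseteq> C \<and> fv \<phi> \<subseteq> {0}"
    proof
      assume "\<phi> \<in> ne ` \<G>"
      then obtain g where "g \<in> \<G>" "\<phi> = ne g" by blast
      then show ?thesis using tm(2,3)[of g] by (simp add: ne_def)
    qed (rule \<Phi>)
  qed
  moreover have "\<exists>x. \<forall>\<phi>\<in>q. holds d (\<lambda>_. x) \<phi>" if q: "finite q" "q \<subseteq> \<Phi> \<union> ne ` \<G>" for q
  proof -
    have "q - \<Phi> \<subseteq> ne ` \<G>" "finite (q - \<Phi>)" using q by auto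
    then obtain S where S: "S \<subseteq> \<G>" "finite S" "q - \<Phi> = ne ` S" by (meson finite_subset_image)
    obtain x where x: "\<forall>\<phi>\<in>\<Phi>. holds d (\<lambda>_. x) \<phi>" "\<forall>g\<in>S. dp_eval d g x \<noteq> 0" using fin[OF S(2,1)] by blast
    have "holds d (\<lambda>_. x) \<phi>" if phq: "\<phi> \<in> q" for \<phi>
    proof (cases "\<phi> \<in> \<Phi>")
      case False
      then obtain g where "g \<in> S" "\<phi> = ne g" using S(3) phq by blast
      then show ?thesis using ne S(1) x(2) by blast
    qed (use x in blast)
    then show ?thesis by blast
  qed
  ultimately obtain x where "\<forall>\<phi>\<in>\<Phi> \<union> ne ` \<G>. holds d (\<lambda>_. x) \<phi>"
    using sat unfolding saturated_def by meson
  then show ?thesis using ne by blast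
qed

lemma dp_order_less: "vars_in {..<n} g \<Longrightarrow> dp_order g < int n"
proof -
  assume "vars_in {..<n} g"
  then have v: "dp_vars g \<subseteq> {..<n}" by (simp add: vars_in_dp_vars)
  have "finite (dp_vars g)" by (rule finite_subset[OF v]) simp
  then have "Max (dp_vars g) < n" if "dp_vars g \<noteq> {}" using Max_in[of "dp_vars g"] that v by blast
  then show ?thesis by (auto simp: dp_order_def)
qed

text \<open>Finitely many inequations combine into one for their product, which still has order
  below \<open>n\<close>, so Blum's axiom solves them; saturation then treats all of them at
  once.\<close>

lemma generic_solution:
  assumes C: "countable C" and F: "coeffs_in C F" "dp_order F = int n"
  shows "\<exists>x. dp_eval d F x = 0 \<and> (\<forall>g. g \<noteq> 0 \<longrightarrow> coeffs_in C g \<longrightarrow> vars_in {..<n} g \<longrightarrow> dp_eval d g x \<noteq> 0)"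
proof -
  obtain s where s: "\<And>x. term_val d (\<lambda>_. x) s = dp_eval d F x" "term_fv s \<subseteq> {0}" "term_params s \<subseteq> C"
    using dp_eval_term_fun[OF F(1), of d] unfolding term_fun_def by blast
  let ?G = "{g. g \<noteq> 0 \<and> coeffs_in C g \<and> vars_in {..<n} g}"
  have "\<exists>x. (\<forall>\<phi>\<in>{Eq s Zero}. holds d (\<lambda>_. x) \<phi>) \<and> (\<forall>g\<in>?G. dp_eval d g x \<noteq> 0)"
  proof (rule realize[OF C])
    fix S assume S: "finite S" "S \<subseteq> ?G"
    have "prod (\<lambda>g. g) S \<noteq> 0" using S by auto
    moreover have "vars_in {..<n} (prod (\<lambda>g. g) S)" using S by (intro vars_in_prod) auto
    then have "dp_order (prod (\<lambda>g. g) S) < dp_order F" using dp_order_less F(2) by metis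
    ultimately obtain x where "dp_eval d F x = 0" "dp_eval d (prod (\<lambda>g. g) S) x \<noteq> 0" using blum by blast
    then show "\<exists>x. (\<forall>\<phi>\<in>{Eq s Zero}. holds d (\<lambda>_. x) \<phi>) \<and> (\<forall>g\<in>S. dp_eval d g x \<noteq> 0)"
      using S(1) s(1) by (intro exI[of _ x]) (auto simp: dp_eval_prod)
  qed (use s in auto)
  then show ?thesis using s(1) by auto
qed

lemma dp_order_dpX: "dp_order (dpX n :: 'a diff_poly) = int n"
  by (simp add: dp_order_def dp_vars_def dpX_def)

lemma generic_point:
  assumes C: "countable C"
  shows "\<exists>x. \<forall>g. g \<noteq> 0 \<longrightarrow> coeffs_in C g \<longrightarrow> dp_eval d g x \<noteq> 0"
proof -
  let ?G = "{g. g \<noteq> 0 \<and> coeffs_in C g}"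
  have "\<exists>x. (\<forall>\<phi>\<in>{}. holds d (\<lambda>_. x) \<phi>) \<and> (\<forall>g\<in>?G. dp_eval d g x \<noteq> 0)"
  proof (rule realize[OF C])
    fix S assume S: "finite S" "S \<subseteq> ?G"
    have "prod (\<lambda>g. g) S \<noteq> 0" using S by auto
    moreover have "finite (dp_vars (prod (\<lambda>g. g) S))" by (simp add: dp_vars_def)
    then obtain k where "dp_vars (prod (\<lambda>g. g) S) \<subseteq> {..<k}"
      by (metis finite_nat_set_iff_bounded lessThan_iff subsetI)
    \<comment> \<open>The equation stating that a high derivative vanishes is imposed only to make
      Blum's axiom applicable to the product.\<close>
    then have "dp_order (prod (\<lambda>g. g) S) < dp_order (dpX k :: 'a diff_poly)"
      unfolding dp_order_dpX by (intro dp_order_less) (simp add: vars_in_dp_vars)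
    ultimately obtain x where "dp_eval d (prod (\<lambda>g. g) S) x \<noteq> 0" using blum by blast
    then show "\<exists>x. (\<forall>\<phi>\<in>{}. holds d (\<lambda>_. x) \<phi>) \<and> (\<forall>g\<in>S. dp_eval d g x \<noteq> 0)"
      using S(1) by (intro exI[of _ x]) (auto simp: dp_eval_prod)
  qed auto
  then show ?thesis by auto
qed

end

section \<open>Extending partial differential homomorphisms\<close>

lemma dp_split_var:
  fixes P :: "'a::field_char_0 diff_poly"
  assumes P: "vars_in {..<Suc n} P" "coeffs_in D P" and D: "field_set D"
  shows "\<exists>C. P = poly C (dpX n) \<and> (\<forall>j. coeffs_in D (coeff C j) \<and> vars_in {..<n} (coeff C j))"
proof -
  define r where "r m = Poly_Mapping.update n 0 m" for m :: "nat \<Rightarrow>\<^sub>0 nat"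
  have r: "r m + Poly_Mapping.single n (lkp m n) = m" for m
    by (rule poly_mapping_eqI) (auto simp: r_def lookup_add lookup_update lookup_single when_def)
  have rk: "Poly_Mapping.keys (r m) = Poly_Mapping.keys m - {n}" for m
    by (auto simp: r_def in_keys_iff lookup_update split: if_splits)
  define C where "C = (\<Sum>m\<in>Poly_Mapping.keys P. monom (Poly_Mapping.single (r m) (lkp P m)) (lkp m n))"
  have "poly C (dpX n) = (\<Sum>m\<in>Poly_Mapping.keys P. Poly_Mapping.single m (lkp P m))"
    unfolding C_def poly_sum poly_monom dpX_power mult_single r by simp
  then have "P = poly C (dpX n)" using dp_sum_singles[OF finite_keys subset_refl, of P] by simp
  moreover have "coeffs_in D (coeff C j)" for j
    unfolding C_def coeffs_in_def coeff_sum lookup_sum coeff_monom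
    using P(2) field_set_0[OF D]
    by (auto intro!: field_set_sum[OF D] simp: coeffs_in_def lookup_single when_def)
  moreover have "vars_in {..<n} (coeff C j)" for j
    unfolding C_def coeff_sum coeff_monom
  proof (intro vars_in_sum)
    fix m assume "m \<in> Poly_Mapping.keys P"
    then have "Poly_Mapping.keys m \<subseteq> {..<Suc n}" using P(1) by (auto simp: vars_in_def lookup_not_eq_zero_eq_in_keys)
    then have "Poly_Mapping.keys (r m) \<subseteq> {..<n}" unfolding rk by (auto simp: less_Suc_eq)
    then show "vars_in {..<n} (if lkp m n = j then Poly_Mapping.single (r m) (lkp P m) else 0)"
      by (auto intro: vars_in_single)
  qed
  ultimately show ?thesis by blast
qed

lemma lookup_mult_dpX_power:
  fixes c :: "'a::comm_ring_1 diff_poly"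
  shows "lkp (c * dpX n ^ i) k = (\<Sum>m\<in>Poly_Mapping.keys c. if m + Poly_Mapping.single n i = k then lkp c m else 0)"
proof -
  have "c * dpX n ^ i = (\<Sum>m\<in>Poly_Mapping.keys c. \<Sum>l\<in>{Poly_Mapping.single n i}. Poly_Mapping.single (m + l) (lkp c m * lkp (dpX n ^ i) l))"
    by (rule dp_mult_singles) (simp_all add: dpX_power)
  then have "c * dpX n ^ i = (\<Sum>m\<in>Poly_Mapping.keys c. Poly_Mapping.single (m + Poly_Mapping.single n i) (lkp c m))"
    by (simp add: dpX_power)
  then show ?thesis by (simp add: lookup_sum lookup_single when_def)
qed

text \<open>Coefficients free of the \<open>n\<close>-th variable can be read off again, so no
  cancellation occurs. This shows that the transported minimal equation really has order
  \<open>n\<close>.\<close>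

lemma lookup_poly_dpX:
  fixes C :: "'a::comm_ring_1 diff_poly poly"
  assumes C: "\<And>j. vars_in {..<n} (coeff C j)" and m: "Poly_Mapping.keys m \<subseteq> {..<n}"
  shows "lkp (poly C (dpX n)) (m + Poly_Mapping.single n j) = lkp (coeff C j) m"
proof -
  have t: "lkp (coeff C i * dpX n ^ i) (m + Poly_Mapping.single n j) = (if i = j then lkp (coeff C j) m else 0)" for i
  proof -
    have "lkp (coeff C i * dpX n ^ i) (m + Poly_Mapping.single n j) =
      (\<Sum>m'\<in>Poly_Mapping.keys (coeff C i). if m' = m then if i = j then lkp (coeff C j) m else 0 else 0)"
      unfolding lookup_mult_dpX_power
    proof (intro sum.cong refl)
      fix m' assume "m' \<in> Poly_Mapping.keys (coeff C i)"
      then have "Poly_Mapping.keys m' \<subseteq> {..<n}" using C[of i] by (auto simp: vars_in_def lookup_not_eq_zero_eq_in_keys)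
      then have "lkp m' n = 0" "lkp m n = 0" using m by (auto simp: in_keys_iff)
      then have "m' + Poly_Mapping.single n i = m + Poly_Mapping.single n j \<longleftrightarrow> i = j \<and> m' = m"
        by (metis (no_types, lifting) add_cancel_left_left add_right_cancel lookup_add lookup_single_eq)
      then show "(if m' + Poly_Mapping.single n i = m + Poly_Mapping.single n j then lkp (coeff C i) m' else 0) =
        (if m' = m then if i = j then lkp (coeff C j) m else 0 else 0)" by auto
    qed
    also have "\<dots> = (if i = j then lkp (coeff C j) m else 0)" by (auto simp: in_keys_iff)
    finally show ?thesis .
  qed
  have "lkp (poly C (dpX n)) (m + Poly_Mapping.single n j) = (\<Sum>i\<le>degree C. if i = j then lkp (coeff C j) m else 0)"
    unfolding poly_altdef lookup_sum t ..
  then show ?thesis by (auto simp: coeff_eq_0)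
qed

lemma Rset_prehom:
  assumes G: "phom G"
    and a: "\<And>P. coeffs_in (Domain G) P \<Longrightarrow> P \<noteq> 0 \<Longrightarrow> vars_in N P \<Longrightarrow> dp_eval d P a \<noteq> 0"
    and a': "\<And>P. coeffs_in (Range G) P \<Longrightarrow> P \<noteq> 0 \<Longrightarrow> vars_in N P \<Longrightarrow> dp_eval d P a' \<noteq> 0"
  shows "prehom (Rset d G N a a')"
proof (rule prehom_fieldI[OF Rset_pring[OF phom_pring[OF G]]])
  note pre = phom_prehom[OF G]
  fix x y assume "(x, y) \<in> Rset d G N a a'"
  then obtain P Q where *: "x = dp_eval d P a" "y = dp_eval d Q a'" "dprel G P Q" "vars_in N P"
    by (auto simp: Rset_def)
  have "coeffs_in (Domain G) P" "coeffs_in (Range G) Q" using *(3) by (auto simp: coeffs_in_def dprel_def)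
  moreover have "vars_in N Q" using dprel_vars[OF pre *(3)] *(4) by simp
  moreover have "P = 0 \<longleftrightarrow> Q = 0" by (rule dprel_zero_iff[OF pre *(3)])
  ultimately show "x = 0 \<longleftrightarrow> y = 0" using a a' * by (metis dp_eval_0)
qed

text \<open>For \<open>N = {..<n}\<close> the derivative of the last generator leaves the ring, so
  the derivatives are sought in a larger graph \<open>H\<close>.\<close>

lemma Rset_derivation:
  assumes G: "dphom d G" and d: "derivation d" and R: "prehom (Rset d G N a a')"
    and H: "phom H" "pfrac (Rset d G N a a') \<subseteq> H"
    and N: "\<And>i. i \<in> N \<Longrightarrow> ((d ^^ Suc i) a, (d ^^ Suc i) a') \<in> H"
    and xy: "(x, y) \<in> pfrac (Rset d G N a a')"
  shows "(d x, d y) \<in> H"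
proof -
  let ?R = "Rset d G N a a'"
  have hG: "phom G" and dG: "\<And>a b. (a, b) \<in> G \<Longrightarrow> (d a, d b) \<in> G" using G by (auto simp: dphom_def)
  have RH: "?R \<subseteq> H" using pfrac_subset[OF prehom_pring[OF R]] H(2) by blast
  have GR: "G \<subseteq> ?R" by (rule Rset_subset[OF phom_pring[OF hG]])
  let ?Z = "{(x, y). (x, y) \<in> H \<and> (d x, d y) \<in> H}"
  have Z: "pfield ?Z" by (rule pfield_derivation[OF H(1) d d])
  have "?R \<subseteq> ?Z"
  proof (rule Rset_least[OF phom_prehom[OF hG] pfield_pring[OF Z]])
    show "G \<subseteq> ?Z" using dG GR RH by auto
    show "((d ^^ i) a, (d ^^ i) a') \<in> ?Z" if "i \<in> N" for i
      using N[OF that] Rset_mem[OF phom_pring[OF hG] that, of d a a'] RH by auto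
  qed
  then have "pfrac ?R \<subseteq> ?Z" by (rule pfrac_least[OF R Z])
  then show ?thesis using xy by blast
qed

lemma countable_converse:
  assumes "countable G" shows "countable (G\<inverse>)"
proof -
  have "G\<inverse> = prod.swap ` G" by force
  then show ?thesis using assms by simp
qed

text \<open>The polynomial \<open>X - b\<close>: with it among the inequations, a realization
  differs from \<open>b\<close>.\<close>

lemma linear_dp:
  fixes b :: "'a::comm_ring_1"
  defines "g \<equiv> dpX 0 + Poly_Mapping.single 0 (- b)"
  shows "g \<noteq> 0" "{0, 1, - b} \<subseteq> C \<Longrightarrow> coeffs_in C g" "0 \<in> N \<Longrightarrow> vars_in N g"
proof -
  have nz: "Poly_Mapping.single 0 1 \<noteq> (0 :: nat \<Rightarrow>\<^sub>0 nat)"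
  proof
    assume "Poly_Mapping.single 0 1 = (0 :: nat \<Rightarrow>\<^sub>0 nat)"
    from arg_cong[OF this, of "\<lambda>m. lkp m 0"] show False by simp
  qed
  have l: "lkp g m = (if m = Poly_Mapping.single 0 1 then 1 else if m = 0 then - b else 0)" for m
  proof -
    have "lkp g m = lkp (dpX 0 :: 'a diff_poly) m + lkp (Poly_Mapping.single 0 (- b)) m"
      unfolding g_def by (rule lookup_add)
    then show ?thesis using nz unfolding dpX_def lookup_single when_def by auto
  qed
  show "g \<noteq> 0"
  proof
    assume "g = 0"
    then have "lkp g (Poly_Mapping.single 0 1) = 0" by simp
    then show False unfolding l by simp
  qed
  show "coeffs_in C g" if "{0, 1, - b} \<subseteq> C" using that unfolding coeffs_in_def l by simp
  show "vars_in N g" if "0 \<in> N"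
    unfolding g_def dpX_def using that by (intro vars_in_add vars_in_single) auto
qed

context saturated_DCF0
begin

lemma extend_transcendental:
  assumes G: "dphom d G" "countable G" and B: "countable B"
    and a: "\<And>P. coeffs_in (Domain G) P \<Longrightarrow> P \<noteq> 0 \<Longrightarrow> dp_eval d P a \<noteq> 0"
  shows "\<exists>a' H. a' \<notin> B \<and> dphom d H \<and> G \<subseteq> H \<and> (a, a') \<in> H"
proof -
  have hG: "phom G" using G by (simp add: dphom_def)
  note r = phom_pring[OF hG]
  define C where "C = insert 0 (insert 1 (Range G \<union> uminus ` B))"
  have C: "countable C" using G(2) B by (simp add: C_def Range_snd)
  obtain a' where a': "\<And>g. g \<noteq> 0 \<Longrightarrow> coeffs_in C g \<Longrightarrow> dp_eval d g a' \<noteq> 0"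
    using generic_point[OF C] by blast
  have "a' \<notin> B"
  proof
    assume "a' \<in> B"
    then have "dp_eval d (dpX 0 + Poly_Mapping.single 0 (- a')) a' \<noteq> 0"
      by (intro a' linear_dp) (auto simp: C_def)
    then show False by (simp add: dp_eval_add dp_eval_single)
  qed
  have R: "prehom (Rset d G UNIV a a')"
    using a a' by (intro Rset_prehom[OF hG]) (auto simp: coeffs_in_def C_def)
  let ?H = "pfrac (Rset d G UNIV a a')"
  have H: "phom ?H" by (rule pfrac_phom[OF R])
  have RH: "Rset d G UNIV a a' \<subseteq> ?H" by (rule pfrac_subset[OF prehom_pring[OF R]])
  have mem: "((d ^^ i) a, (d ^^ i) a') \<in> ?H" for i using Rset_mem[OF r, of i UNIV d a a'] RH by blast
  have "(d x, d y) \<in> ?H" if "(x, y) \<in> ?H" for x y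
    by (rule Rset_derivation[OF G(1) derivation_d R H subset_refl mem that])
  then have "dphom d ?H" using H by (simp add: dphom_def)
  moreover have "G \<subseteq> ?H" using Rset_subset[OF r] RH by blast
  moreover have "(a, a') \<in> ?H" using mem[of 0] by simp
  ultimately show ?thesis using \<open>a' \<notin> B\<close> by blast
qed

lemma const_vars:
  assumes "vars_in {..<0} P"
  shows "dp_eval d P z = lkp P 0" "P \<noteq> 0 \<Longrightarrow> lkp P 0 \<noteq> 0"
proof -
  have k: "Poly_Mapping.keys P \<subseteq> {0}" using assms by (auto simp: vars_in_def lookup_not_eq_zero_eq_in_keys)
  show "dp_eval d P z = lkp P 0" using dp_eval_superset[of "{0}" P d z] k by simp
  show "P \<noteq> 0 \<Longrightarrow> lkp P 0 \<noteq> 0"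
    using k by (metis keys_eq_empty in_keys_iff singletonI subset_singletonD)
qed

text \<open>
  Blum's axiom provides a generic solution \<open>a'\<close> of the transported minimal equation of \<open>a\<close>; it
  automatically has the same quantifier-free type.
\<close>

lemma extend_algebraic:
  assumes G: "dphom d G" "countable G" and B: "countable B"
    and ex: "\<exists>P. coeffs_in (Domain G) P \<and> P \<noteq> 0 \<and> dp_eval d P a = 0"
  shows "\<exists>a' H. (alg (Domain G) a \<or> a' \<notin> B) \<and> dphom d H \<and> G \<subseteq> H \<and> (a, a') \<in> H"
proof -
  have hG: "phom G" and dG: "\<And>a b. (a, b) \<in> G \<Longrightarrow> (d a, d b) \<in> G" using G by (auto simp: dphom_def)
  note r = phom_pring[OF hG] and pre = phom_prehom[OF hG]
  define D where "D = Domain G"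
  have D: "field_set D" unfolding D_def by (rule field_set_Domain[OF hG])
  let ?Q = "\<lambda>n. \<exists>P. coeffs_in D P \<and> P \<noteq> 0 \<and> vars_in {..<n} P \<and> dp_eval d P a = 0"
  have "\<exists>n. ?Q n"
  proof -
    obtain P where P: "coeffs_in D P" "P \<noteq> 0" "dp_eval d P a = 0" using ex by (auto simp: D_def)
    have "finite (dp_vars P)" by (simp add: dp_vars_def)
    then obtain k where "dp_vars P \<subseteq> {..<k}"
      by (metis finite_nat_set_iff_bounded lessThan_iff subsetI)
    then show ?thesis using P by (auto simp: vars_in_dp_vars)
  qed
  \<comment> \<open>\<open>n0\<close> counts the derivatives \<open>X_0, ..., X_n\<close> in a
    relation of least order, so that \<open>n0 = n + 1\<close> with \<open>n\<close> the order of
    the minimal equation.\<close>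
  define n0 where "n0 = (LEAST n. ?Q n)"
  have Qn0: "?Q n0" unfolding n0_def using \<open>\<exists>n. ?Q n\<close> by (rule LeastI_ex)
  have "n0 \<noteq> 0" using Qn0 const_vars by metis
  then obtain n where n: "n0 = Suc n" by (cases n0) auto
  have ind: "dp_eval d P a \<noteq> 0" if "coeffs_in D P" "P \<noteq> 0" "vars_in {..<n} P" for P
    using not_less_Least[of n ?Q] that n unfolding n0_def[symmetric] by auto
  define an where "an = (d ^^ n) a"
  define ev where "ev C = map_poly (\<lambda>c. dp_eval d c a) C" for C
  have cev: "coeff (ev C) j = dp_eval d (coeff C j) a" for C j by (simp add: ev_def coeff_map_poly)
  let ?W = "\<lambda>C. C \<noteq> 0 \<and> (\<forall>j. coeffs_in D (coeff C j) \<and> vars_in {..<n} (coeff C j)) \<and> poly (ev C) an = 0"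
  obtain P where P: "coeffs_in D P" "P \<noteq> 0" "vars_in {..<Suc n} P" "dp_eval d P a = 0" using Qn0 n by blast
  obtain C0 where "P = poly C0 (dpX n)" "\<forall>j. coeffs_in D (coeff C0 j) \<and> vars_in {..<n} (coeff C0 j)"
    using dp_split_var[OF P(3,1) D] by blast
  then have "?W C0" using P by (auto simp: dp_eval_poly ev_def an_def)
  \<comment> \<open>Among the relations of order \<open>n\<close>, one of least degree in the
    \<open>n\<close>-th derivative.\<close>
  define C where "C = arg_min degree ?W"
  have C: "C \<noteq> 0" "\<And>j. coeffs_in D (coeff C j)" "\<And>j. vars_in {..<n} (coeff C j)" "poly (ev C) an = 0"
    and Cmin: "\<And>C'. ?W C' \<Longrightarrow> degree C \<le> degree C'"
    unfolding C_def using arg_min_natI[of ?W C0 degree, OF \<open>?W C0\<close>] arg_min_nat_le[of ?W _ degree] by blast+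
  have ev0: "coeff (ev C) j = 0 \<longleftrightarrow> coeff C j = 0" for j
    using ind[OF C(2) _ C(3)] unfolding cev by (metis dp_eval_0)
  have dev: "degree (ev C) = degree C" unfolding degree_def ev0 ..
  have ev_nz: "ev C \<noteq> 0" using C(1) ev0 by (metis leading_coeff_0_iff coeff_0)
  have dC: "degree C > 0"
  proof (rule ccontr)
    assume "\<not> degree C > 0"
    then have "degree (ev C) = 0" using dev by simp
    then obtain c where "ev C = [:c:]" using degree_eq_zeroE by blast
    then show False using C(4) ev_nz by simp
  qed
  have "\<forall>j. \<exists>q. dprel G (coeff C j) q" using dprel_ex[OF r] C(2) unfolding D_def by blast
  then obtain f where f: "\<And>j. dprel G (coeff C j) (f j)" by metis
  define C' where "C' = (\<Sum>j\<le>degree C. monom (f j) j)"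
  have z: "dprel G 0 0" using pring_0[OF r] by (simp add: dprel_def)
  have CC': "dprel G (coeff C j) (coeff C' j)" for j
    using f z by (cases "j \<le> degree C") (auto simp: C'_def coeff_sum coeff_eq_0)
  have C'v: "vars_in {..<n} (coeff C' j)" for j using dprel_vars[OF pre CC'] C(3) by blast
  have C'0: "coeff C' j = 0 \<longleftrightarrow> coeff C j = 0" for j using dprel_zero_iff[OF pre CC'] by blast
  have dC': "degree C' = degree C" unfolding degree_def C'0 ..
  \<comment> \<open>The minimal equation transported along \<open>G\<close>. Its order must be
    exactly \<open>n\<close> so that its generic solution avoids all relations of smaller
    order.\<close>
  define F where "F = poly C' (dpX n)"
  have FF: "dprel G (poly C (dpX n)) F"
  proof -
    have one: "dprel G (dpX n ^ j) (dpX n ^ j)" for j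
      unfolding dpX_power by (intro dprel_single r pring_1)
    show ?thesis unfolding F_def poly_altdef dC'
      by (intro dprel_sum dprel_mult r CC' one)
  qed
  have Fv: "vars_in {..<Suc n} F"
    unfolding F_def poly_altdef
  proof (intro vars_in_sum vars_in_mult)
    fix j
    show "vars_in {..<Suc n} (coeff C' j)" using C'v[of j] by (auto simp: vars_in_dp_vars)
    show "vars_in {..<Suc n} (dpX n ^ j)" unfolding dpX_power by (intro vars_in_single) auto
  qed
  have Fn: "n \<in> dp_vars F"
  proof -
    have "coeff C' (degree C) \<noteq> 0" using C'0 C(1) by simp
    then obtain m where m: "lkp (coeff C' (degree C)) m \<noteq> 0" by (metis poly_mapping_eqI lookup_zero)
    then have mv: "Poly_Mapping.keys m \<subseteq> {..<n}" using C'v[of "degree C"] by (auto simp: vars_in_def)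
    have "lkp F (m + Poly_Mapping.single n (degree C)) \<noteq> 0"
      unfolding F_def lookup_poly_dpX[OF C'v mv] by (rule m)
    moreover have "n \<in> Poly_Mapping.keys (m + Poly_Mapping.single n (degree C))"
      using dC by (simp add: in_keys_iff lookup_add)
    ultimately show ?thesis unfolding dp_vars_def by (auto simp: in_keys_iff)
  qed
  have Fo: "dp_order F = int n"
  proof -
    have "dp_vars F \<subseteq> {..<Suc n}" using Fv by (simp add: vars_in_dp_vars)
    then have "Max (dp_vars F) = n"
      using Fn by (intro Max_eqI) (auto simp: less_Suc_eq_le finite_subset)
    then show ?thesis using Fn by (auto simp: dp_order_def)
  qed
  define K where "K = insert 0 (insert 1 (Range G \<union> uminus ` B))"
  have K: "countable K" using G(2) B by (simp add: K_def Range_snd)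
  have KF: "coeffs_in K F" using FF unfolding coeffs_in_def dprel_def K_def by blast
  obtain a' where a': "dp_eval d F a' = 0"
    "\<And>g. g \<noteq> 0 \<Longrightarrow> coeffs_in K g \<Longrightarrow> vars_in {..<n} g \<Longrightarrow> dp_eval d g a' \<noteq> 0"
    using generic_solution[OF K KF Fo] by blast
  define an' where "an' = (d ^^ n) a'"
  define R where "R = Rset d G {..<n} a a'"
  have R: "prehom R"
    unfolding R_def using ind a'(2) by (intro Rset_prehom[OF hG]) (auto simp: coeffs_in_def K_def D_def)
  define H1 where "H1 = pfrac R"
  have H1: "phom H1" unfolding H1_def by (rule pfrac_phom[OF R])
  have RH1: "R \<subseteq> H1" unfolding H1_def by (rule pfrac_subset[OF prehom_pring[OF R]])
  have GR: "G \<subseteq> R" unfolding R_def by (rule Rset_subset[OF r])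
  define g g' where "g = ev C" and "g' = map_poly (\<lambda>c. dp_eval d c a') C'"
  have gg: "prel H1 g g'"
    unfolding prel_def
  proof
    fix j
    have "(coeff g j, coeff g' j) \<in> R"
      unfolding g_def g'_def cev R_def using RsetI[OF CC' C(3)] by (simp add: coeff_map_poly)
    then show "(coeff g j, coeff g' j) \<in> H1" using RH1 by blast
  qed
  have g0: "poly g an = 0" "g \<noteq> 0" using C(4) ev_nz by (simp_all add: g_def)
  have g'0: "poly g' an' = 0" using a'(1) unfolding F_def dp_eval_poly g'_def an'_def .
  \<comment> \<open>After clearing denominators, a relation of smaller degree over \<open>H1\<close>
    would have differential polynomials over \<open>D\<close> as coefficients, against the choice of
    \<open>C\<close>.\<close>
  have min: "min_rel H1 an g g'"
    unfolding min_rel_def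
  proof (intro conjI allI impI gg g0)
    fix p q assume pq: "prel H1 p q" "p \<noteq> 0" "degree p < degree g"
    show "poly p an \<noteq> 0"
    proof
      assume p0: "poly p an = 0"
      obtain s s' where s: "s \<noteq> 0" "prel R (smult s p) (smult s' q)"
        using common_denominator[OF R] pq(1) unfolding H1_def by blast
      have "\<forall>j. \<exists>P. coeffs_in D P \<and> vars_in {..<n} P \<and> s * coeff p j = dp_eval d P a"
        using s(2) unfolding prel_def R_def Rset_def D_def coeffs_in_def dprel_def by auto blast
      then obtain h where h: "\<And>j. coeffs_in D (h j)" "\<And>j. vars_in {..<n} (h j)" "\<And>j. s * coeff p j = dp_eval d (h j) a"
        by metis
      define E where "E = (\<Sum>j\<le>degree p. monom (h j) j)"
      have z: "coeffs_in D 0" using field_set_0[OF D] by (simp add: coeffs_in_def)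
      have cE: "coeff E j = (if j \<le> degree p then h j else 0)" for j by (auto simp: E_def coeff_sum)
      have evE: "ev E = smult s p"
        by (rule poly_eqI) (auto simp: cev cE h(3)[symmetric] coeff_eq_0)
      have "E \<noteq> 0"
      proof
        assume "E = 0"
        then have "smult s p = 0" using evE by (simp add: ev_def)
        then show False using s(1) pq(2) by simp
      qed
      moreover have "coeffs_in D (coeff E j) \<and> vars_in {..<n} (coeff E j)" for j
        using h z by (simp add: cE)
      moreover have "poly (ev E) an = 0" using p0 by (simp add: evE)
      ultimately have "degree C \<le> degree E" by (intro Cmin) blast
      moreover have "degree E \<le> degree p" by (rule degree_le) (simp add: cE)
      ultimately show False using pq(3) dev by (simp add: g_def)
    qed
  qed
  define H where "H = pext H1 an an'"
  have preH: "prehom (padj H1 an an')" by (rule min_rel_prehom[OF H1 min g'0])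
  have H: "phom H" unfolding H_def by (rule pext_phom[OF preH])
  have H1H: "H1 \<subseteq> H" "(an, an') \<in> H"
    unfolding H_def using pext_subset[OF phom_pring[OF H1]] pext_mem[OF phom_pring[OF H1]] by blast+
  have mem: "((d ^^ i) a, (d ^^ i) a') \<in> H" if "i \<le> n" for i
  proof (cases "i = n")
    case True
    then show ?thesis using H1H(2) by (simp add: an_def an'_def)
  next
    case False
    then have "((d ^^ i) a, (d ^^ i) a') \<in> R" unfolding R_def using that by (intro Rset_mem[OF r]) auto
    then show ?thesis using RH1 H1H(1) by blast
  qed
  have d1: "(d x, d y) \<in> H" if "(x, y) \<in> H1" for x y
  proof (rule Rset_derivation[OF G(1) derivation_d _ H])
    show "prehom (Rset d G {..<n} a a')" using R by (simp add: R_def)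
    show "pfrac (Rset d G {..<n} a a') \<subseteq> H" using H1H(1) by (simp add: H1_def R_def)
    show "(x, y) \<in> pfrac (Rset d G {..<n} a a')" using that by (simp add: H1_def R_def)
    show "((d ^^ Suc i) a, (d ^^ Suc i) a') \<in> H" if "i \<in> {..<n}" for i using mem[of "Suc i"] that by simp
  qed
  have "(d an, d an') \<in> H"
    unfolding H_def by (rule min_rel_derivation[OF H1 min g'0 derivation_d derivation_d]) (use d1 in \<open>simp add: H_def\<close>)
  then have "(d x, d y) \<in> H" if "(x, y) \<in> H" for x y
    using pext_derivation[OF H derivation_d derivation_d H1H(1) preH H1H(2) d1] that unfolding H_def by blast
  then have "dphom d H" using H by (simp add: dphom_def)
  moreover have "G \<subseteq> H" using GR RH1 H1H by blast
  moreover have "(a, a') \<in> H" using mem[of 0] by simp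
  \<comment> \<open>For \<open>n = 0\<close> the minimal equation is an ordinary polynomial relation
    over \<open>D\<close>. For \<open>n > 0\<close> each \<open>X - b\<close> with \<open>b\<close>
    in \<open>B\<close> has order below \<open>n\<close>, so the generic solution avoids it.\<close>
  moreover have "alg D a \<or> a' \<notin> B"
  proof (cases "n = 0")
    case True
    have "coeff g j \<in> D" for j
      using const_vars(1)[of "coeff C j" a] C(2,3)[of j] True by (simp add: g_def cev coeffs_in_def)
    then show ?thesis using g0 True unfolding alg_def an_def by auto
  next
    case False
    have "a' \<notin> B"
    proof
      assume "a' \<in> B"
      then have "dp_eval d (dpX 0 + Poly_Mapping.single 0 (- a')) a' \<noteq> 0"
        using False by (intro a' linear_dp) (auto simp: K_def)
      then show False by (simp add: dp_eval_add dp_eval_single)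
    qed
    then show ?thesis by blast
  qed
  ultimately show ?thesis unfolding D_def by blast
qed

text \<open>The forth step of back-and-forth. The set \<open>B\<close> is what later moves a
  non-algebraic element out of a finite fibre.\<close>

lemma extend:
  assumes G: "dphom d G" "countable G" and B: "countable B"
  shows "\<exists>a' H. (alg (Domain G) a \<or> a' \<notin> B) \<and> dphom d H \<and> countable H \<and> G \<subseteq> H \<and> (a, a') \<in> H"
proof -
  have "\<exists>a' H. (alg (Domain G) a \<or> a' \<notin> B) \<and> dphom d H \<and> G \<subseteq> H \<and> (a, a') \<in> H"
    using extend_algebraic[OF G B, of a] extend_transcendental[OF G B, of a] by blast
  then obtain a' H where H: "alg (Domain G) a \<or> a' \<notin> B" "dphom d H" "G \<subseteq> H" "(a, a') \<in> H" by blast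
  moreover obtain H' where "insert (a, a') G \<subseteq> H'" "H' \<subseteq> H" "countable H'" "dphom d H'"
    using dphom_countable_subset[OF H(2), of "insert (a, a') G"] H G(2) by auto
  ultimately show ?thesis by (intro exI[of _ a'] exI[of _ H']) auto
qed

lemma term_val_dphom:
  assumes G: "dphom d G" and e: "\<And>n. n \<in> term_fv s \<Longrightarrow> (e n, e' n) \<in> G"
    and c: "\<And>c. c \<in> term_params s \<Longrightarrow> (c, c) \<in> G"
  shows "(term_val d e s, term_val d e' s) \<in> G"
proof -
  have h: "phom G" and dG: "\<And>a b. (a, b) \<in> G \<Longrightarrow> (d a, d b) \<in> G" using G by (auto simp: dphom_def)
  note r = phom_pring[OF h]
  show ?thesis
    using e c by (induction s) (auto intro: pring_0[OF r] pring_1[OF r] pring_add[OF r] pring_diff[OF r] pring_mult[OF r] dG)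
qed

text \<open>Back and forth: at a quantifier the graph is extended by the witness, or its converse is
  when the witness lies on the other side. Passing to the extension is why \<open>G\<close> is
  arbitrary in the induction.\<close>

lemma holds_dphom:
  assumes "dphom d G" "countable G" "\<And>n. n \<in> fv \<phi> \<Longrightarrow> (e n, e' n) \<in> G" "\<And>c. c \<in> params \<phi> \<Longrightarrow> (c, c) \<in> G"
  shows "holds d e \<phi> \<longleftrightarrow> holds d e' \<phi>"
  using assms
proof (induction \<phi> arbitrary: G e e')
  case (Eq s u)
  have h: "phom G" using Eq.prems(1) by (simp add: dphom_def)
  have "(term_val d e s, term_val d e' s) \<in> G" "(term_val d e u, term_val d e' u) \<in> G"
    using Eq.prems by (intro term_val_dphom; simp)+
  then have "(term_val d e s - term_val d e u, term_val d e' s - term_val d e' u) \<in> G"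
    by (intro pring_diff phom_pring h)
  then show ?case using prehom_nz[OF phom_prehom[OF h]] by (metis holds.simps(1) right_minus_eq)
next
  case (Neg \<phi>)
  show ?case using Neg.IH[OF Neg.prems(1,2)] Neg.prems(3,4) by simp
next
  case (Conj \<phi> \<psi>)
  have "holds d e \<phi> = holds d e' \<phi>" by (rule Conj.IH(1)[OF Conj.prems(1,2)]) (use Conj.prems(3,4) in auto)
  moreover have "holds d e \<psi> = holds d e' \<psi>" by (rule Conj.IH(2)[OF Conj.prems(1,2)]) (use Conj.prems(3,4) in auto)
  ultimately show ?case by simp
next
  case (Exists n \<phi>)
  have step: "holds d (e(n := x)) \<phi> \<longleftrightarrow> holds d (e'(n := x')) \<phi>"
    if H: "dphom d H" "countable H" "G \<subseteq> H" "(x, x') \<in> H" for H x x'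
  proof (rule Exists.IH[OF H(1,2)])
    show "((e(n := x)) m, (e'(n := x')) m) \<in> H" if "m \<in> fv \<phi>" for m
      using Exists.prems(3)[of m] that H(3,4) by auto
    show "(c, c) \<in> H" if "c \<in> params \<phi>" for c using Exists.prems(4)[of c] that H(3) by auto
  qed
  show ?case
  proof
    assume "holds d e (Exists n \<phi>)"
    then obtain x where x: "holds d (e(n := x)) \<phi>" by auto
    obtain x' H where "dphom d H" "countable H" "G \<subseteq> H" "(x, x') \<in> H"
      using extend[OF Exists.prems(1,2) countable_empty, of x] by blast
    then show "holds d e' (Exists n \<phi>)" using step x by auto
  next
    assume "holds d e' (Exists n \<phi>)"
    then obtain x' where x': "holds d (e'(n := x')) \<phi>" by auto
    obtain x H where H: "dphom d H" "countable H" "G\<inverse> \<subseteq> H" "(x', x) \<in> H"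
      using extend[OF dphom_converse[OF Exists.prems(1)] countable_converse[OF Exists.prems(2)] countable_empty, of x']
      by blast
    have "holds d (e(n := x)) \<phi> \<longleftrightarrow> holds d (e'(n := x')) \<phi>"
      by (rule step[OF dphom_converse[OF H(1)] countable_converse[OF H(2)]]) (use H(3,4) in auto)
    then have "holds d (e(n := x)) \<phi>" using x' by blast
    then show "holds d e (Exists n \<phi>)" by auto
  qed
qed

end

section \<open>Orthogonality\<close>

text \<open>An ordinary polynomial, read as a differential polynomial of order 0; it connects Blum's
  axiom with algebraic closedness.\<close>

definition dp_of_poly :: "'a::field_char_0 poly \<Rightarrow> 'a diff_poly" where
  "dp_of_poly p = (\<Sum>i\<le>degree p. Poly_Mapping.single (Poly_Mapping.single 0 i) (coeff p i))"

lemma dp_eval_of_poly: "dp_eval d (dp_of_poly p) x = poly p x"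
proof -
  have "mon_eval d (Poly_Mapping.single 0 i) x = x ^ i" for i
    using mon_eval_superset[of "{0}" "Poly_Mapping.single 0 i" d x] by simp
  then show ?thesis by (simp add: dp_of_poly_def dp_eval_sum dp_eval_single poly_altdef)
qed

lemma coeffs_in_of_poly:
  assumes "field_set K" "\<And>i. coeff p i \<in> K" shows "coeffs_in K (dp_of_poly p)"
  unfolding coeffs_in_def dp_of_poly_def lookup_sum
  using assms by (auto intro!: field_set_sum simp: lookup_single when_def field_set_0)

lemma dp_order_of_poly:
  assumes p: "degree p > 0" shows "dp_order (dp_of_poly p) = 0"
proof -
  let ?m = "Poly_Mapping.single 0 (degree p) :: nat \<Rightarrow>\<^sub>0 nat"
  have inj: "Poly_Mapping.single 0 i = ?m \<longleftrightarrow> i = degree p" for i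
    by (metis lookup_single_eq)
  have "lkp (dp_of_poly p) ?m = (\<Sum>i\<le>degree p. if i = degree p then lead_coeff p else 0)"
    unfolding dp_of_poly_def lookup_sum
    by (intro sum.cong refl) (auto simp: lookup_single when_def inj)
  then have "lkp (dp_of_poly p) ?m \<noteq> 0" using p by auto
  then have "0 \<in> dp_vars (dp_of_poly p)"
    using p unfolding dp_vars_def by (auto simp: in_keys_iff intro!: bexI[of _ ?m])
  moreover have "dp_vars (dp_of_poly p) \<subseteq> {0}"
    unfolding vars_in_dp_vars[symmetric] dp_of_poly_def
    by (intro vars_in_sum vars_in_single) simp
  ultimately have "dp_vars (dp_of_poly p) = {0}" by blast
  then show ?thesis by (simp add: dp_order_def)
qed

lemma term_val_cong: "(\<And>n. n \<in> term_fv s \<Longrightarrow> e n = e' n) \<Longrightarrow> term_val d e s = term_val d e' s"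
  by (induction s) auto

lemma holds_cong: "(\<And>n. n \<in> fv \<phi> \<Longrightarrow> e n = e' n) \<Longrightarrow> holds d e \<phi> \<longleftrightarrow> holds d e' \<phi>"
proof (induction \<phi> arbitrary: e e')
  case (Eq s u)
  then have "term_val d e s = term_val d e' s" "term_val d e u = term_val d e' u"
    by (intro term_val_cong; simp)+
  then show ?case by simp
next
  case (Neg \<phi>)
  have "holds d e \<phi> \<longleftrightarrow> holds d e' \<phi>" by (rule Neg.IH) (use Neg.prems in auto)
  then show ?case by simp
next
  case (Conj \<phi> \<psi>)
  have "holds d e \<phi> \<longleftrightarrow> holds d e' \<phi>" "holds d e \<psi> \<longleftrightarrow> holds d e' \<psi>"
    by (rule Conj.IH; use Conj.prems in auto)+
  then show ?case by simp
next
  case (Exists n \<phi>)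
  have "holds d (e(n := x)) \<phi> \<longleftrightarrow> holds d (e'(n := x)) \<phi>" for x
    by (rule Exists.IH) (use Exists.prems in auto)
  then show ?case by simp
qed

lemma alg_mono: "alg E z \<Longrightarrow> E \<subseteq> F \<Longrightarrow> alg F z"
  unfolding alg_def by blast

lemma field_set_UNIV: "field_set (UNIV :: 'a::field_char_0 set)"
  by (simp add: field_set_def)

lemma finite_to_one_on_infinite_image:
  assumes "finite_to_one_on f A" "infinite A" shows "infinite (f ` A)"
proof
  assume "finite (f ` A)"
  then have "finite (\<Union>b\<in>f ` A. {a \<in> A. f a = b})"
    using assms(1) unfolding finite_to_one_on_def by (intro finite_UN_I) auto
  moreover have "A \<subseteq> (\<Union>b\<in>f ` A. {a \<in> A. f a = b})" by blast
  ultimately show False using assms(2) finite_subset by blast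
qed

context saturated_DCF0
begin

lemma algebraically_closed:
  fixes p :: "'a poly"
  assumes "degree p > 0" shows "\<exists>z. poly p z = 0"
proof -
  have "dp_order (1 :: 'a diff_poly) < int 0" by (intro dp_order_less vars_in_1)
  then show ?thesis using blum[of 1 "dp_of_poly p"] dp_order_of_poly[OF assms] by (auto simp: dp_eval_of_poly)
qed

text \<open>Finitely many differential polynomials with finite zero sets cannot exhaust an infinite
  set, so saturation avoids all of those over \<open>K\<close>; the nonzero ordinary polynomials are
  among them.\<close>

lemma generic_element:
  assumes K: "countable K" "field_set K" and \<phi>: "params \<phi> \<subseteq> K" "fv \<phi> \<subseteq> {0}"
    and inf: "infinite {x. holds d (\<lambda>_. x) \<phi>}"
  shows "\<exists>x. holds d (\<lambda>_. x) \<phi> \<and> \<not> alg K x"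
proof -
  let ?G = "{g. coeffs_in K g \<and> finite {x. dp_eval d g x = 0}}"
  have "\<exists>x. (\<forall>\<phi>\<in>{\<phi>}. holds d (\<lambda>_. x) \<phi>) \<and> (\<forall>g\<in>?G. dp_eval d g x \<noteq> 0)"
  proof (rule realize[OF K(1)])
    fix S assume S: "finite S" "S \<subseteq> ?G"
    then have "finite (\<Union>g\<in>S. {x. dp_eval d g x = 0})" by blast
    then have "infinite ({x. holds d (\<lambda>_. x) \<phi>} - (\<Union>g\<in>S. {x. dp_eval d g x = 0}))"
      using inf by (rule Diff_infinite_finite)
    then obtain x where "x \<in> {x. holds d (\<lambda>_. x) \<phi>} - (\<Union>g\<in>S. {x. dp_eval d g x = 0})"
      using infinite_imp_nonempty by blast
    then show "\<exists>x. (\<forall>\<phi>\<in>{\<phi>}. holds d (\<lambda>_. x) \<phi>) \<and> (\<forall>g\<in>S. dp_eval d g x \<noteq> 0)" by blast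
  qed (use \<phi> in auto)
  then obtain x where x: "holds d (\<lambda>_. x) \<phi>" "\<And>g. g \<in> ?G \<Longrightarrow> dp_eval d g x \<noteq> 0" by blast
  have "\<not> alg K x"
  proof
    assume "alg K x"
    then obtain p where p: "p \<noteq> 0" "\<And>i. coeff p i \<in> K" "poly p x = 0" unfolding alg_def by blast
    have "dp_of_poly p \<in> ?G"
      using coeffs_in_of_poly[OF K(2) p(2)] poly_roots_finite[OF p(1)] by (simp add: dp_eval_of_poly)
    from x(2)[OF this] show False using p(3) by (simp add: dp_eval_of_poly)
  qed
  then show ?thesis using x(1) by blast
qed

text \<open>If \<open>y\<close> were not algebraic over \<open>E\<close>, an extension of the
  identity of \<open>E\<close> would send it to some \<open>y'\<close> outside the finite fibre,
  although \<open>y'\<close> satisfies the same formula.\<close>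

lemma definable_fiber_alg:
  assumes E: "countable E" "field_set E" "\<And>a. a \<in> E \<Longrightarrow> d a \<in> E"
    and \<phi>: "params \<phi> \<subseteq> E" "\<And>m. m \<in> fv \<phi> - {n} \<Longrightarrow> e m \<in> E"
    and fin: "finite {z. holds d (e(n := z)) \<phi>}" and y: "holds d (e(n := y)) \<phi>"
  shows "alg E y"
proof (rule ccontr)
  assume "\<not> alg E y"
  moreover have "Domain (Id_on E) = E" by auto
  moreover have "countable (Id_on E)"
  proof -
    have "Id_on E = (\<lambda>a. (a, a)) ` E" by auto
    then show ?thesis using E(1) by simp
  qed
  ultimately obtain y' H where H: "y' \<notin> {z. holds d (e(n := z)) \<phi>}" "dphom d H" "countable H" "Id_on E \<subseteq> H" "(y, y') \<in> H"
    using extend[OF dphom_Id_on[of E d, OF E(2,3)] _ countable_finite[OF fin], of y] by auto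
  have "holds d (e(n := y)) \<phi> \<longleftrightarrow> holds d (e(n := y')) \<phi>"
  proof (rule holds_dphom[OF H(2,3)])
    show "((e(n := y)) m, (e(n := y')) m) \<in> H" if "m \<in> fv \<phi>" for m
      using \<phi>(2)[of m] that H(4,5) by auto
    show "(c, c) \<in> H" if "c \<in> params \<phi>" for c using \<phi>(1) that H(4) by auto
  qed
  then show False using y H(1) by simp
qed

end

theorem proposition5p1:
  fixes d :: "'a::field_char_0 \<Rightarrow> 'a" and \<iota> :: "complex \<Rightarrow> 'a" and t :: 'a and \<alpha> :: complex
  assumes "universal_DCF0 d \<iota> t"
    and "\<not> algebraic \<alpha>"
  shows "orthogonal d (painleve_I d t) (painleve_II d t (\<iota> \<alpha>))"
  unfolding orthogonal_def
proof
  assume "nonorthogonal d (painleve_I d t) (painleve_II d t (\<iota> \<alpha>))"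
  then obtain R \<phi> where RXY: "R \<subseteq> painleve_I d t \<times> painleve_II d t (\<iota> \<alpha>)" and inf: "infinite R"
    and fin: "finite_to_one_on fst R" "finite_to_one_on snd R"
    and \<phi>: "fv \<phi> \<subseteq> {0, 1}" and R: "R = {(x, y). holds d (\<lambda>n. if n = 0 then x else y) \<phi>}"
    unfolding nonorthogonal_def definable_rel_def by blast
  interpret universal_DCF0 d \<iota> t by fact
  interpret saturated_DCF0 d
  proof
    show "saturated d" by (rule saturated)
    show "uncountable (UNIV :: 'a set)"
    proof
      assume "countable (UNIV :: 'a set)"
      then have "countable (UNIV :: real set)"
        using continuum by (metis eqpoll_sym countable_lepoll eqpoll_imp_lepoll)
      then show False using uncountable_UNIV_real by blast
    qed
  qed
  note d = derivation_d
  \<comment> \<open>Only the variables 0 and 1 matter, so membership in \<open>R\<close> can be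
    tested with updates of constant assignments.\<close>
  have hR: "holds d e \<phi> \<longleftrightarrow> (e 0, e 1) \<in> R" for e
    unfolding R using \<phi> by (auto intro!: holds_cong)
  define c where "c = \<iota> \<alpha>"
  \<comment> \<open>The base field contains both equations and the parameters of the relation, and
    its countability is what saturation asks for.\<close>
  have "countable (insert t (insert c (params \<phi>)))" by (intro countable_finite) simp
  then obtain K where K: "insert t (insert c (params \<phi>)) \<subseteq> K" "countable K" "field_set K" "\<forall>a\<in>K. d a \<in> K"
    using countable_diff_field[OF _ UNIV_I _ subset_UNIV, of "insert t (insert c (params \<phi>))" d] field_set_UNIV by blast
  have "fst ` R \<subseteq> {x. holds d (\<lambda>_. x) (Exists 1 \<phi>)}" by (force simp: hR)
  then have "infinite {x. holds d (\<lambda>_. x) (Exists 1 \<phi>)}"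
    using finite_to_one_on_infinite_image[OF fin(1) inf] finite_subset by blast
  then obtain x where "holds d (\<lambda>_. x) (Exists 1 \<phi>)" and x: "\<not> alg K x"
    using generic_element[OF K(2,3), of "Exists 1 \<phi>"] K(1) \<phi> by auto
  then obtain y where xy: "(x, y) \<in> R" by (auto simp: hR)
  \<comment> \<open>An infinite definable set has points not algebraic over \<open>K\<close>; the
    constants thus supply the direction \<open>w\<close> at infinity.\<close>
  have "infinite {c. d c = 0}"
    using bij_betw_finite[OF \<iota>_bij] infinite_UNIV_char_0[where 'a = complex] by blast
  then obtain w where w: "d w = 0" "\<not> alg K w"
    using generic_element[OF K(2,3), of "Eq (Der (Var 0)) Zero"] by auto
  define u v where "u = d x" and "v = d y"
  have u: "d u = 6 * x ^ 2 + t" using xy RXY by (auto simp: painleve_I_def u_def)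
  have v: "d v = 2 * y ^ 3 + t * y + c" using xy RXY by (auto simp: painleve_II_def v_def c_def)
  \<comment> \<open>The fibre lemma works over a countable differential field, so a countable
    differential subfield containing \<open>K\<close> and the base point of the fibre is used, and
    algebraicity is passed up.\<close>
  have algebraic_over: "alg E0 z"
    if E0: "field_set E0" "\<And>a. a \<in> E0 \<Longrightarrow> d a \<in> E0" "insert b K \<subseteq> E0"
      and e: "\<And>m. m \<in> {0, 1} - {n} \<Longrightarrow> e m = b" "finite {z. holds d (e(n := z)) \<phi>}" "holds d (e(n := z)) \<phi>"
    for E0 b e n z
  proof -
    obtain E where E: "insert b K \<subseteq> E" "E \<subseteq> E0" "countable E" "field_set E" "\<forall>a\<in>E. d a \<in> E"
      using countable_diff_field[where d = d, OF E0(1,2) _ E0(3)] K(2) by auto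
    have "alg E z"
      by (rule definable_fiber_alg[OF E(3,4) _ _ _ e(2,3)]) (use E(1,5) K(1) \<phi> e(1) in auto)
    then show ?thesis using E(2) by (rule alg_mono)
  qed
  \<comment> \<open>The equations have order 2: adjoining a solution and its derivative already
    gives a field closed under \<open>d\<close>.\<close>
  have stable: "field_set (fext (fext K a) b)" "insert a K \<subseteq> fext (fext K a) b"
      "z \<in> fext (fext K a) b \<Longrightarrow> d z \<in> fext (fext K a) b"
    if ab: "d a = b" "\<And>L. field_set L \<Longrightarrow> K \<subseteq> L \<Longrightarrow> a \<in> L \<Longrightarrow> d b \<in> L" for a b z
  proof -
    note Ka = fext_field[OF K(3), of a]
    show L: "field_set (fext (fext K a) b)" by (rule fext_field[OF Ka])
    show Ks: "insert a K \<subseteq> fext (fext K a) b"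
      using fext_subset[OF K(3), of a] fext_subset[OF Ka, of b] fext_mem[OF K(3), of a] by blast
    show "d z \<in> fext (fext K a) b" if z: "z \<in> fext (fext K a) b"
    proof (rule fext2_stable[OF K(3) d _ _ _ z])
      show "d z' \<in> fext (fext K a) b" if "z' \<in> K" for z' using K(4) that Ks by blast
      show "d a \<in> fext (fext K a) b" using ab(1) fext_mem[OF Ka, of b] by simp
      show "d b \<in> fext (fext K a) b" using ab(2)[OF L] Ks by blast
    qed
  qed
  have tK: "t \<in> K" and cK: "c \<in> K" using K(1) by auto
  have "6 * x ^ 2 + t \<in> L" if "field_set L" "K \<subseteq> L" "x \<in> L" for L
    using that tK by (auto intro!: field_setD field_set_numeral)
  note sx = stable[OF u_def[symmetric], unfolded u, OF this]
  have "2 * y ^ 3 + t * y + c \<in> L" if "field_set L" "K \<subseteq> L" "y \<in> L" for L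
    using that tK cK by (auto intro!: field_setD field_set_numeral)
  note sy = stable[OF v_def[symmetric], unfolded v, OF this]
  have "alg (fext (fext K x) u) y"
  proof (rule algebraic_over[OF sx(1,3,2)])
    have "{z. (x, z) \<in> R} \<subseteq> snd ` {a \<in> R. fst a = x}" by force
    then have "finite {z. (x, z) \<in> R}" using fin(1) finite_subset unfolding finite_to_one_on_def by blast
    then show "finite {z. holds d ((\<lambda>_. x)(1 := z)) \<phi>}" by (simp add: hR)
    show "holds d ((\<lambda>_. x)(1 := y)) \<phi>" using xy by (simp add: hR)
  qed simp_all
  moreover have "alg (fext (fext K y) v) x"
  proof (rule algebraic_over[OF sy(1,3,2)])
    have "{z. (z, y) \<in> R} \<subseteq> fst ` {a \<in> R. snd a = y}" by force
    then have "finite {z. (z, y) \<in> R}" using fin(2) finite_subset unfolding finite_to_one_on_def by blast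
    then show "finite {z. holds d ((\<lambda>_. y)(0 := z)) \<phi>}" by (simp add: hR)
    show "holds d ((\<lambda>_. y)(0 := x)) \<phi>" using xy by (simp add: hR)
  qed simp_all
  ultimately show False
    using no_algebraic_correspondence[OF algebraically_closed K(3) d bspec[OF K(4)] tK d_t cK x u_def[symmetric] u v_def[symmetric] v _ _ w(2,1)]
    by blast
qed

end
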